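(* Let $k\ge0$, $0<\alpha\le1$ and $f\in L^{p,p'}(Q_1)$ with $1\le p,p'\le+\infty$. Let $E\subset Q_{1/2}$ be a compact set. Suppose that there exists a constant $K$ such that for any $X_0\in E$ there exists $P_{X_0}\in\mathcal P_k$ with $$\|f-P_{X_0}\|^*_{L^{p,p'}(Q(X_0,r))}\le Kr^{k+\alpha}\quad\forall\,0<r<1/2,\qquad(\ast)$$ and $$K_0:=\sup_{X_0\in E}\sum_{i=0}^k|D^iP_{X_0}(X_0)|+\inf\{K:(\ast)\text{ holds with }K\text{ for all }X_0\in E\}<+\infty.$$ Then $f$ extends from $E$ to a $C^{k,\alpha}$ function $\tilde f$ in $Q'_1$, i.e. $D^i\tilde f(X)=D^iP_X(X)$ for all $X\in E$, $0\le i\le k$, and $$\|\tilde f\|_{C^{k,\alpha}(\bar Q'_1)}\le CK_0,$$ where $C$ depends only on $n,k$ and $\alpha$.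
   Context: Notation: $X=(x,t)\in\mathbb R^n\times\mathbb R$, $|X|=(|x|^2+|t|)^{1/2}$, $Q(X_0,r)=B_r(x_0)\times(t_0-r^2,t_0]$, $Q_r=Q(0,r)$, $Q'_1=B_1(0)\times(-1,1)$. For $U=\Omega\times I$, $\|g\|^*_{L^{p,p'}(U)}=\big(\frac1{|I|}\int_I(\frac1{|\Omega|}\int_\Omega|g|^p dx)^{p'/p}dt\big)^{1/p'}$ (usual modification for infinite exponents); $L^{p,p'}$ is the corresponding mixed space. For $\sigma\in\mathbb N^{n+1}$, $|\sigma|=\sigma_1+\cdots+\sigma_n+2\sigma_{n+1}$, $(x,t)^\sigma=x_1^{\sigma_1}\cdots x_n^{\sigma_n}t^{\sigma_{n+1}}$, $D^\sigma=\partial_{x_1}^{\sigma_1}\cdots\partial_{x_n}^{\sigma_n}\partial_t^{\sigma_{n+1}}$, $D^i\varphi=\{D^\sigma\varphi:|\sigma|=i\}$, $|D^i\varphi|=(\sum_{|\sigma|=i}|D^\sigma\varphi|^2)^{1/2}$; $\mathcal P_k$ is the set of polynomials $\sum_{|\sigma|\le k}\frac{a_\sigma}{\sigma!}(x,t)^\sigma$. The value of $f$ at $X\in E$ is understood as $P_X(X)$. Parabolic Hölder norms on $\Omega\subset\mathbb R^{n+1}$: $[h]_{C^\alpha(\bar\Omega)}=\sup_{X\ne Y\in\Omega}\frac{|h(X)-h(Y)|}{|X-Y|^\alpha}$, $[h]^t_{C^\beta(\bar\Omega)}=\sup_{(x,t),(x,s)\in\Omega,\,t\ne s}\frac{|h(x,t)-h(x,s)|}{|t-s|^\beta}$;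 for $k\ge1$, $\|g\|_{C^{k,\alpha}(\bar\Omega)}=\sum_{i=0}^k\sup_\Omega|D^ig|+[D^kg]_{C^\alpha(\bar\Omega)}+[D^{k-1}g]^t_{C^{(1+\alpha)/2}(\bar\Omega)}$ (derivatives $D^\sigma g$, $|\sigma|\le k$, existing and continuous); for $k=0$, $\|g\|_{C^{0,\alpha}(\bar\Omega)}=\sup_\Omega|g|+[g]_{C^\alpha(\bar\Omega)}$. *)

theory Defs
  imports "HOL-Analysis.Analysis" "HOL-Probability.Essential_Supremum"
begin

section \<open>Parabolic geometry\<close>

text \<open>A point of space-time is a pair of a space point and a time.\<close>

type_synonym 'n pt = "(real^'n) \<times> real"

definition par_norm :: "'n::finite pt \<Rightarrow> real" where
  "par_norm X = sqrt ((norm (fst X))\<^sup>2 + \<bar>snd X\<bar>)"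

text \<open>The cylinders are half-open in time: they contain their top but not their bottom.\<close>

definition cyl_time :: "'n::finite pt \<Rightarrow> real \<Rightarrow> real set" where
  "cyl_time X r = {snd X - r\<^sup>2 <.. snd X}"

definition cyl :: "'n::finite pt \<Rightarrow> real \<Rightarrow> 'n pt set" where
  "cyl X r = ball (fst X) r \<times> cyl_time X r"

definition full_cyl1 :: "'n::finite pt set" where
  "full_cyl1 = ball 0 1 \<times> {-1 <..< 1}"


section \<open>Mixed Lebesgue norms\<close>

text \<open>Real power of an extended nonnegative number; only used for positive exponents.\<close>

definition epowr :: "ennreal \<Rightarrow> real \<Rightarrow> ennreal" where
  "epowr y a = (if y = \<infinity> then \<infinity> else ennreal (enn2real y powr a))"

definition lp_norm :: "ennreal \<Rightarrow> 'a measure \<Rightarrow> ('a \<Rightarrow> ennreal) \<Rightarrow> ennreal" where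
  "lp_norm p M g =
     (if p = \<infinity> then esssup M g
      else epowr (\<integral>\<^sup>+ x. epowr (g x) (enn2real p) \<partial>M) (1 / enn2real p))"

definition mixed_norm ::
  "ennreal \<Rightarrow> ennreal \<Rightarrow> 'a measure \<Rightarrow> 'b measure \<Rightarrow> ('a \<times> 'b \<Rightarrow> real) \<Rightarrow> ennreal" where
  "mixed_norm p p' M N g = lp_norm p' N (\<lambda>t. lp_norm p M (\<lambda>x. ennreal \<bar>g (x, t)\<bar>))"

definition mixed_space ::
  "ennreal \<Rightarrow> ennreal \<Rightarrow> 'a::euclidean_space set \<Rightarrow> 'b::euclidean_space set \<Rightarrow> ('a \<times> 'b \<Rightarrow> real) set"
  where
  "mixed_space p p' \<Omega> I =
     {g \<in> borel_measurable (lebesgue_on (\<Omega> \<times> I)).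
        mixed_norm p p' (lebesgue_on \<Omega>) (lebesgue_on I) g < \<infinity>}"

text \<open>Lebesgue measure on a set, normalised to total mass 1, so that integrals become means.\<close>

definition mean_measure :: "'a::euclidean_space set \<Rightarrow> 'a measure" where
  "mean_measure A = scale_measure (1 / emeasure lebesgue A) (lebesgue_on A)"

definition mean_norm ::
  "ennreal \<Rightarrow> ennreal \<Rightarrow> 'a::euclidean_space set \<Rightarrow> 'b::euclidean_space set \<Rightarrow> ('a \<times> 'b \<Rightarrow> real) \<Rightarrow> ennreal"
  where
  "mean_norm p p' \<Omega> I g = mixed_norm p p' (mean_measure \<Omega>) (mean_measure I) g"


section \<open>Multi-indices, derivatives and polynomials\<close>

type_synonym 'n mindex = "(nat^'n) \<times> nat"

definition weight :: "'n::finite mindex \<Rightarrow> nat" where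
  "weight \<sigma> = (\<Sum>i\<in>UNIV. fst \<sigma> $ i) + 2 * snd \<sigma>"

definition mfact :: "'n::finite mindex \<Rightarrow> real" where
  "mfact \<sigma> = (\<Prod>i\<in>UNIV. fact (fst \<sigma> $ i)) * fact (snd \<sigma>)"

definition mpow :: "'n::finite pt \<Rightarrow> 'n mindex \<Rightarrow> real" where
  "mpow X \<sigma> = (\<Prod>i\<in>UNIV. fst X $ i ^ (fst \<sigma> $ i)) * snd X ^ snd \<sigma>"

lemma finite_weight_le: "finite {\<sigma>::'n::finite mindex. weight \<sigma> \<le> k}"
proof (rule finite_subset)
  have "fst \<sigma> $ i \<le> k" if "weight \<sigma> \<le> k" for \<sigma> :: "'n mindex" and i
    using that member_le_sum[of i UNIV "\<lambda>i. fst \<sigma> $ i"] by (simp add: weight_def)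
  then show "{\<sigma>::'n mindex. weight \<sigma> \<le> k} \<subseteq> vec_lambda ` (UNIV \<rightarrow>\<^sub>E {..k}) \<times> {..k}"
    by (auto simp: weight_def PiE_UNIV_domain image_iff vec_eq_iff intro!: exI[of _ "($) _"])
qed (intro finite_cartesian_product finite_imageI finite_PiE; simp)

lemma finite_weight_eq: "finite {\<sigma>::'n::finite mindex. weight \<sigma> = i}"
  by (rule finite_subset[OF _ finite_weight_le[of i]]) auto

definition par_polys :: "nat \<Rightarrow> ('n::finite pt \<Rightarrow> real) set" where
  "par_polys k = {\<lambda>X. \<Sum>\<sigma> | weight \<sigma> \<le> k. a \<sigma> / mfact \<sigma> * mpow X \<sigma> | a. True}"

definition partial_D :: "'n::finite pt \<Rightarrow> ('n pt \<Rightarrow> real) \<Rightarrow> 'n pt \<Rightarrow> real" where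
  "partial_D e g X = deriv (\<lambda>s. g (X + s *\<^sub>R e)) 0"

text \<open>Iterated partial derivatives along a list of directions, the last entry of the list being
  applied first, and the assertion that all the derivatives involved exist on \<open>U\<close>.\<close>

primrec iter_D :: "'n::finite pt list \<Rightarrow> ('n pt \<Rightarrow> real) \<Rightarrow> 'n pt \<Rightarrow> real" where
  "iter_D [] g = g"
| "iter_D (e # es) g = partial_D e (iter_D es g)"

primrec iter_D_exists :: "'n::finite pt set \<Rightarrow> 'n pt list \<Rightarrow> ('n pt \<Rightarrow> real) \<Rightarrow> bool" where
  "iter_D_exists U [] g \<longleftrightarrow> True"
| "iter_D_exists U (e # es) g \<longleftrightarrow> iter_D_exists U es g \<and>
     (\<forall>X\<in>U. (\<lambda>s. iter_D es g (X + s *\<^sub>R e)) field_differentiable (at 0))"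

text \<open>The index type carries no order, so the order \<open>x\<^sub>1, \<dots>, x\<^sub>n\<close> of the coordinates in
  an iterated derivative is an arbitrary fixed enumeration. The choice is immaterial for functions
  whose derivatives up to the relevant weight exist and are continuous.\<close>

definition coords :: "'n::finite list" where
  "coords = (SOME xs. set xs = UNIV \<and> distinct xs)"

lemma coords: "set (coords :: 'n::finite list) = UNIV" "distinct (coords :: 'n list)"
  using someI_ex[OF finite_distinct_list[OF finite[of "UNIV :: 'n set"]]]
  by (auto simp: coords_def)

definition dirs :: "'n::finite mindex \<Rightarrow> 'n pt list" where
  "dirs \<sigma> = concat (map (\<lambda>i. replicate (fst \<sigma> $ i) (axis i 1, 0)) coords)
            @ replicate (snd \<sigma>) (0, 1)"

definition D :: "'n::finite mindex \<Rightarrow> ('n pt \<Rightarrow> real) \<Rightarrow> 'n pt \<Rightarrow> real" where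
  "D \<sigma> g = iter_D (dirs \<sigma>) g"

definition D_norm :: "nat \<Rightarrow> ('n::finite pt \<Rightarrow> real) \<Rightarrow> 'n pt \<Rightarrow> real" where
  "D_norm i g X = L2_set (\<lambda>\<sigma>. D \<sigma> g X) {\<sigma>. weight \<sigma> = i}"

text \<open>Euclidean length of the difference of the tuples \<open>D\<^sup>i g\<close> at two points.\<close>

definition D_dist :: "nat \<Rightarrow> ('n::finite pt \<Rightarrow> real) \<Rightarrow> 'n pt \<Rightarrow> 'n pt \<Rightarrow> real" where
  "D_dist i g X Y = L2_set (\<lambda>\<sigma>. D \<sigma> g X - D \<sigma> g Y) {\<sigma>. weight \<sigma> = i}"


section \<open>Parabolic Hoelder spaces\<close>

text \<open>All suprema are taken in \<^typ>\<open>ennreal\<close>, so an infinite norm is represented as such.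
  For open \<open>U\<close> only the values of \<open>g\<close> on \<open>U\<close> matter.\<close>

definition par_Ck :: "nat \<Rightarrow> 'n::finite pt set \<Rightarrow> ('n pt \<Rightarrow> real) \<Rightarrow> bool" where
  "par_Ck k U g \<longleftrightarrow>
     (\<forall>\<sigma>. weight \<sigma> \<le> k \<longrightarrow> iter_D_exists U (dirs \<sigma>) g \<and> continuous_on U (D \<sigma> g))"

definition holder_seminorm :: "nat \<Rightarrow> real \<Rightarrow> 'n::finite pt set \<Rightarrow> ('n pt \<Rightarrow> real) \<Rightarrow> ennreal" where
  "holder_seminorm i \<alpha> U g =
     (SUP (X, Y) \<in> {(X, Y). X \<in> U \<and> Y \<in> U \<and> X \<noteq> Y}.
        ennreal (D_dist i g X Y / par_norm (X - Y) powr \<alpha>))"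

definition holder_seminorm_t :: "nat \<Rightarrow> real \<Rightarrow> 'n::finite pt set \<Rightarrow> ('n pt \<Rightarrow> real) \<Rightarrow> ennreal" where
  "holder_seminorm_t i \<beta> U g =
     (SUP (x, t, s) \<in> {(x, t, s). (x, t) \<in> U \<and> (x, s) \<in> U \<and> t \<noteq> s}.
        ennreal (D_dist i g (x, t) (x, s) / \<bar>t - s\<bar> powr \<beta>))"

definition holder_norm :: "nat \<Rightarrow> real \<Rightarrow> 'n::finite pt set \<Rightarrow> ('n pt \<Rightarrow> real) \<Rightarrow> ennreal" where
  "holder_norm k \<alpha> U g =
     (\<Sum>i\<le>k. SUP X\<in>U. ennreal (D_norm i g X)) + holder_seminorm k \<alpha> U g
     + (if k = 0 then 0 else holder_seminorm_t (k - 1) ((1 + \<alpha>) / 2) U g)"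

definition par_Ck_alpha :: "nat \<Rightarrow> real \<Rightarrow> 'n::finite pt set \<Rightarrow> ('n pt \<Rightarrow> real) set" where
  "par_Ck_alpha k \<alpha> U = {g. par_Ck k U g \<and> holder_norm k \<alpha> U g < \<infinity>}"


section \<open>Pointwise approximation by polynomials\<close>

definition approximates ::
  "ennreal \<Rightarrow> ennreal \<Rightarrow> nat \<Rightarrow> real \<Rightarrow> ('n::finite pt \<Rightarrow> real) \<Rightarrow> 'n pt set
   \<Rightarrow> ('n pt \<Rightarrow> 'n pt \<Rightarrow> real) \<Rightarrow> real \<Rightarrow> bool" where
  "approximates p p' k \<alpha> f E P K \<longleftrightarrow>
     (\<forall>X\<^sub>0\<in>E. \<forall>r. 0 < r \<and> r < 1/2 \<longrightarrow>
        mean_norm p p' (ball (fst X\<^sub>0) r) (cyl_time X\<^sub>0 r) (\<lambda>X. f X - P X\<^sub>0 X)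
          \<le> ennreal (K * r powr (real k + \<alpha>)))"

text \<open>The restriction to \<open>K \<ge> 0\<close> only matters for empty \<open>E\<close>, where it makes the infimum 0.\<close>

definition whitney_const ::
  "ennreal \<Rightarrow> ennreal \<Rightarrow> nat \<Rightarrow> real \<Rightarrow> ('n::finite pt \<Rightarrow> real) \<Rightarrow> 'n pt set
   \<Rightarrow> ('n pt \<Rightarrow> 'n pt \<Rightarrow> real) \<Rightarrow> ennreal" where
  "whitney_const p p' k \<alpha> f E P =
     (SUP X\<^sub>0\<in>E. ennreal (\<Sum>i\<le>k. D_norm i (P X\<^sub>0) X\<^sub>0))
     + (INF K\<in>{K. 0 \<le> K \<and> approximates p p' k \<alpha> f E P K}. ennreal K)"

end

theory Submission
  imports Defs
begin

text \<open>
  This is Whitney's extension argument in parabolic scaling. Comparing \<open>P\<^sub>X\<close> and \<open>P\<^sub>Y\<close> with \<open>f\<close> on the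
  cylinder of size \<open>|X - Y|\<close> below the earlier of the two points bounds the mean of \<open>|P\<^sub>X - P\<^sub>Y|\<close>
  there, hence (equivalence of norms on polynomials of bounded degree)
  \<open>|D\<^sup>\<sigma> (P\<^sub>X - P\<^sub>Y)(X)| \<le> C K\<^sub>0 |X - Y|\<^bsup>k + \<alpha> - |\<sigma>|\<^esup>\<close>.

  For each \<open>j\<close> let \<open>\<phi>\<^sub>j\<^sub>m\<close> be a partition of unity by lattice bumps of parabolic size \<open>\<epsilon>\<^sub>j = \<Lambda>\<^bsup>-j\<^esup>\<close>,
  restricted to the bumps close to \<open>E\<close>, let \<open>h\<^sub>j = \<Sum>\<^sub>m \<phi>\<^sub>j\<^sub>m P\<^bsub>Y(j,m)\<^esub>\<close> with \<open>Y(j,m) \<in> E\<close> close to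
  the support, and \<open>\<chi>\<^sub>j = \<Sum>\<^sub>m \<phi>\<^sub>j\<^sub>m\<close>. The extension is \<open>g = h\<^sub>0 + \<Sum>\<^sub>j (h\<^sub>j\<^sub>+\<^sub>1 - \<chi>\<^sub>j\<^sub>+\<^sub>1 h\<^sub>j)\<close>. For \<open>\<Lambda>\<close> large,
  \<open>\<chi>\<^sub>j = 1\<close> near the support of \<open>\<chi>\<^sub>j\<^sub>+\<^sub>1\<close>, so the partial sums \<open>G\<^sub>j\<close> agree with \<open>h\<^sub>j\<close> near \<open>E\<close>, and the
  \<open>j\<close>-th summand has derivatives of order \<open>\<epsilon>\<^sub>j\<^bsup>k + \<alpha> - |\<sigma>|\<^esup>\<close>. Summing these bounds gives the \<open>C\<^sup>k\<close> part; it
  would lose a logarithm in the Hoelder seminorms when \<open>\<alpha> = 1\<close>. There one uses instead that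
  derivatives of \<open>G\<^sub>j\<close> of weight \<open>> k\<close> annihilate the polynomials and are therefore
  \<open>O(\<epsilon>\<^sub>j\<^bsup>k + \<alpha> - |\<sigma>|\<^esup>)\<close> everywhere, and compares \<open>g\<close> with \<open>G\<^sub>j\<close> for \<open>\<epsilon>\<^sub>j\<close> of the size of \<open>|X - Y|\<close>.
\<close>

section \<open>Iterated partial derivatives with parabolic scaling\<close>

text \<open>Two budgets shape the constants. Smoothness: the final comparison differentiates once
  beyond weight \<open>k\<close>, and a time derivative weighs 2, so bumps with derivatives up to
  weight \<open>k + 2\<close> suffice and splines can be used. Geometry: the ratio of consecutive
  scales is fixed just above the radius, in units of the scale, of the neighbourhood of
  \<open>E\<close> that carries the pieces. This nesting has a second effect: at each point either
  the correction vanishes nearby or the partial sum is a single local average, so bounds for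
  derivatives of high weight are renewed instead of added up.

  Cylinders look only backwards in time. The cylinder of one point fits into an enlarged cylinder of
  the other only if the first point is the earlier one; the estimate is obtained there and, if
  needed, carried to the later point by propagation.

  Polynomials enter through two facts: their derivatives of weight above \<open>k\<close> vanish,
  and a compactness argument bounds their coefficients by integrals.\<close>

text \<open>Space-time coordinates are indexed by \<open>'n option\<close>, with \<open>None\<close> for time; this treats the
  weights 1 and 2 uniformly.\<close>

definition coord :: "'n::finite pt \<Rightarrow> 'n option \<Rightarrow> real" where
  "coord X c = (case c of None \<Rightarrow> snd X | Some i \<Rightarrow> fst X $ i)"

definition cdir :: "'n::finite option \<Rightarrow> 'n pt" where
  "cdir c = (case c of None \<Rightarrow> (0, 1) | Some i \<Rightarrow> (axis i 1, 0))"

definition cwt :: "'n option \<Rightarrow> nat" where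
  "cwt c = (case c of None \<Rightarrow> 2 | Some i \<Rightarrow> 1)"

definition pt_of :: "('n::finite option \<Rightarrow> real) \<Rightarrow> 'n pt" where
  "pt_of f = (\<chi> i. f (Some i), f None)"

definition lwt :: "'n option list \<Rightarrow> nat" where
  "lwt cs = sum_list (map cwt cs)"

abbreviation cderiv :: "'n::finite option list \<Rightarrow> ('n pt \<Rightarrow> real) \<Rightarrow> 'n pt \<Rightarrow> real" where
  "cderiv cs \<equiv> iter_D (map cdir cs)"

lemma coord_simps [simp]:
  "coord (X + Y) c = coord X c + coord Y c" "coord (X - Y) c = coord X c - coord Y c"
  "coord (r *\<^sub>R X) c = r * coord X c" "coord 0 c = 0"
  "coord (cdir c) c' = (if c = c' then 1 else 0)" "coord (pt_of f) c = f c"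
  by (auto simp: coord_def cdir_def pt_of_def axis_def split: option.splits)

lemma pt_eqI: "(\<And>c. coord X c = coord Y c) \<Longrightarrow> X = Y"
  by (metis coord_def option.simps(4) option.simps(5) prod.expand vec_eq_iff)

lemma continuous_on_coord [continuous_intros]: "continuous_on S (\<lambda>X. coord X c)"
  by (cases c) (auto simp: coord_def intro!: continuous_intros)

lemma cwt_pos: "1 \<le> cwt c" "cwt c \<le> 2" "0 < cwt c"
  by (auto simp: cwt_def split: option.splits)

lemma lwt_simps [simp]:
  "lwt [] = 0" "lwt (c # cs) = cwt c + lwt cs" "lwt (cs @ ds) = lwt cs + lwt ds"
  by (auto simp: lwt_def)

text \<open>\<open>iter_D\<close> recurses on the outermost derivative; peeling the innermost one
  instead turns a statement about \<open>f\<close> into one about \<open>partial_D e f\<close> with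
  a shorter list, which drives the inductions on the weight below.\<close>

lemma iter_D_snoc: "iter_D (es @ [e]) f = iter_D es (partial_D e f)"
  by (induction es) auto

lemma iter_D_exists_snoc:
  "iter_D_exists U (es @ [e]) f \<longleftrightarrow>
     (\<forall>X\<in>U. (\<lambda>s. f (X + s *\<^sub>R e)) field_differentiable (at 0)) \<and> iter_D_exists U es (partial_D e f)"
  by (induction es) (auto simp: iter_D_snoc)

text \<open>Derivatives are counted by parabolic weight, one time derivative costing two. The
  quantifier runs over lists and thus over every order of the directions, which makes the class
  stable under \<open>pd c\<close> at the price of \<open>cwt c\<close>.\<close>

definition smooth :: "nat \<Rightarrow> ('n::finite pt \<Rightarrow> real) \<Rightarrow> bool" where
  "smooth N f \<longleftrightarrow> (\<forall>cs. lwt cs \<le> N \<longrightarrow>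
     iter_D_exists UNIV (map cdir cs) f \<and> continuous_on UNIV (cderiv cs f))"

definition has_pd :: "'n::finite option \<Rightarrow> ('n pt \<Rightarrow> real) \<Rightarrow> ('n pt \<Rightarrow> real) \<Rightarrow> bool" where
  "has_pd c f f' \<longleftrightarrow> (\<forall>X. ((\<lambda>s. f (X + s *\<^sub>R cdir c)) has_real_derivative f' X) (at 0))"

abbreviation pd :: "'n::finite option \<Rightarrow> ('n pt \<Rightarrow> real) \<Rightarrow> 'n pt \<Rightarrow> real" where
  "pd c \<equiv> partial_D (cdir c)"

lemma pd_eq: "has_pd c f f' \<Longrightarrow> pd c f = f'"
  unfolding has_pd_def partial_D_def by (intro ext DERIV_imp_deriv) auto

lemma has_pd_pd_iff:
  "has_pd c f (pd c f) \<longleftrightarrow> (\<forall>X. (\<lambda>s. f (X + s *\<^sub>R cdir c)) field_differentiable (at 0))"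
  unfolding has_pd_def partial_D_def
  by (metis DERIV_deriv_iff_field_differentiable)

text \<open>Splitting a list at its innermost direction gives a recursion in \<open>N\<close>. Since
  \<open>cwt c\<close> is positive, closure properties follow by well-founded induction on
  \<open>N\<close>, with one sum or product rule per step.\<close>

lemma smooth_iff:
  "smooth N f \<longleftrightarrow> continuous_on UNIV f \<and>
     (\<forall>c. cwt c \<le> N \<longrightarrow> has_pd c f (pd c f) \<and> smooth (N - cwt c) (pd c f))"
  (is "?L \<longleftrightarrow> ?R")
proof
  assume L: ?L
  show ?R
  proof (intro conjI allI impI)
    show "continuous_on UNIV f" using L[unfolded smooth_def, rule_format, of "[]"] by simp
    fix c :: "'a option" assume c: "cwt c \<le> N"
    show "has_pd c f (pd c f)"
      using L[unfolded smooth_def, rule_format, of "[c]"] c by (simp add: has_pd_pd_iff)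
    show "smooth (N - cwt c) (pd c f)"
      unfolding smooth_def
    proof (intro allI impI)
      fix cs :: "'a option list" assume "lwt cs \<le> N - cwt c"
      then show "iter_D_exists UNIV (map cdir cs) (pd c f) \<and> continuous_on UNIV (cderiv cs (pd c f))"
        using L[unfolded smooth_def, rule_format, of "cs @ [c]"] c
        by (simp add: iter_D_snoc iter_D_exists_snoc)
    qed
  qed
next
  assume R: ?R
  show ?L
    unfolding smooth_def
  proof (intro allI impI)
    fix cs :: "'a option list" assume "lwt cs \<le> N"
    then show "iter_D_exists UNIV (map cdir cs) f \<and> continuous_on UNIV (cderiv cs f)"
    proof (cases cs rule: rev_cases)
      case Nil then show ?thesis using R by simp
    next
      case (snoc ds c)
      with \<open>lwt cs \<le> N\<close> have "cwt c \<le> N" "lwt ds \<le> N - cwt c" by auto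
      then show ?thesis using R unfolding smooth_def has_pd_pd_iff
        by (simp add: snoc iter_D_snoc iter_D_exists_snoc)
    qed
  qed
qed

lemma smI:
  assumes "continuous_on UNIV f"
    "\<And>c. cwt c \<le> N \<Longrightarrow> \<exists>f'. has_pd c f f' \<and> smooth (N - cwt c) f'"
  shows "smooth N f"
  using assms pd_eq unfolding smooth_iff[of N] by metis

lemma smD:
  assumes "smooth N f"
  shows "continuous_on UNIV f" "cwt c \<le> N \<Longrightarrow> has_pd c f (pd c f)"
    "cwt c \<le> N \<Longrightarrow> smooth (N - cwt c) (pd c f)"
  using assms smooth_iff by auto

lemma smooth_mono: "smooth N f \<Longrightarrow> M \<le> N \<Longrightarrow> smooth M f"
  unfolding smooth_def by auto

lemma smooth_has_pd_itd:
  assumes "smooth N f" "lwt cs + cwt c \<le> N"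
  shows "has_pd c (cderiv cs f) (cderiv (c # cs) f)"
  using assms(1)[unfolded smooth_def, rule_format, of "c # cs"] assms(2)
  by (simp add: has_pd_pd_iff)

section \<open>Closure of the smooth class and linearity of iterated derivatives\<close>

lemma has_pd_const: "has_pd c (\<lambda>X. a) (\<lambda>X. 0)"
  by (simp add: has_pd_def)

lemma has_pd_add: "has_pd c f f' \<Longrightarrow> has_pd c g g' \<Longrightarrow> has_pd c (\<lambda>X. f X + g X) (\<lambda>X. f' X + g' X)"
  unfolding has_pd_def by (auto intro!: DERIV_add)

lemma has_pd_mult:
  assumes "has_pd c f f'" "has_pd c g g'"
  shows "has_pd c (\<lambda>X. f X * g X) (\<lambda>X. f' X * g X + f X * g' X)"
  unfolding has_pd_def
proof
  fix X
  show "((\<lambda>s. f (X + s *\<^sub>R cdir c) * g (X + s *\<^sub>R cdir c)) has_real_derivative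
      f' X * g X + f X * g' X) (at 0)"
    using DERIV_mult[OF assms(1)[unfolded has_pd_def, rule_format, of X]
        assms(2)[unfolded has_pd_def, rule_format, of X]]
    by (simp add: algebra_simps)
qed

lemma smooth_const: "smooth N (\<lambda>X. a)"
proof (induction N arbitrary: a rule: less_induct)
  case (less N)
  show ?case
  proof (rule smI)
    fix c :: "'a option" assume "cwt c \<le> N"
    then have "smooth (N - cwt c) (\<lambda>X::'a pt. 0)" using less cwt_pos(3)[of c] by auto
    then show "\<exists>f'. has_pd c (\<lambda>X. a) f' \<and> smooth (N - cwt c) f'" using has_pd_const by blast
  qed simp
qed

lemma smooth_add: "smooth N f \<Longrightarrow> smooth N g \<Longrightarrow> smooth N (\<lambda>X. f X + g X)"
proof (induction N arbitrary: f g rule: less_induct)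
  case (less N)
  show ?case
  proof (rule smI)
    show "continuous_on UNIV (\<lambda>X. f X + g X)"
      using less.prems smD(1) by (intro continuous_intros) auto
    fix c :: "'a option" assume c: "cwt c \<le> N"
    then have "smooth (N - cwt c) (\<lambda>X. pd c f X + pd c g X)"
      using less smD(3) cwt_pos(3)[of c] by (metis diff_less le_trans less_le_trans)
    moreover have "has_pd c (\<lambda>X. f X + g X) (\<lambda>X. pd c f X + pd c g X)"
      using less.prems c smD(2) by (intro has_pd_add) auto
    ultimately show "\<exists>f'. has_pd c (\<lambda>X. f X + g X) f' \<and> smooth (N - cwt c) f'" by blast
  qed
qed

lemma smooth_mult: "smooth N f \<Longrightarrow> smooth N g \<Longrightarrow> smooth N (\<lambda>X. f X * g X)"
proof (induction N arbitrary: f g rule: less_induct)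
  case (less N)
  show ?case
  proof (rule smI)
    show "continuous_on UNIV (\<lambda>X. f X * g X)"
      using less.prems smD(1) by (intro continuous_intros) auto
    fix c :: "'a option" assume c: "cwt c \<le> N"
    then have lt: "N - cwt c < N" using cwt_pos(3)[of c] by auto
    have "smooth (N - cwt c) f" "smooth (N - cwt c) g"
      using less.prems(1,2) smooth_mono[OF _ diff_le_self] by auto
    then have "smooth (N - cwt c) (\<lambda>X. pd c f X * g X + f X * pd c g X)"
      using less.prems c smD(3) by (intro smooth_add less.IH[OF lt]) auto
    moreover have "has_pd c (\<lambda>X. f X * g X) (\<lambda>X. pd c f X * g X + f X * pd c g X)"
      using less.prems c smD(2) by (intro has_pd_mult) auto
    ultimately show "\<exists>f'. has_pd c (\<lambda>X. f X * g X) f' \<and> smooth (N - cwt c) f'" by blast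
  qed
qed

lemma smooth_diff: "smooth N f \<Longrightarrow> smooth N g \<Longrightarrow> smooth N (\<lambda>X. f X - g X)"
  using smooth_add[of N f "\<lambda>X. (-1) * g X"] smooth_mult[OF smooth_const, of N g "-1"] by simp

lemma smooth_sum: "finite I \<Longrightarrow> (\<And>i. i \<in> I \<Longrightarrow> smooth N (f i)) \<Longrightarrow> smooth N (\<lambda>X. \<Sum>i\<in>I. f i X)"
  by (induction I rule: finite_induct) (auto intro: smooth_add smooth_const)

lemma smooth_prod: "finite I \<Longrightarrow> (\<And>i. i \<in> I \<Longrightarrow> smooth N (f i)) \<Longrightarrow> smooth N (\<lambda>X. \<Prod>i\<in>I. f i X)"
  by (induction I rule: finite_induct) (auto intro: smooth_mult smooth_const)

lemma cderiv_add:
  assumes "smooth N f" "smooth N g" "lwt cs \<le> N"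
  shows "cderiv cs (\<lambda>X. f X + g X) = (\<lambda>X. cderiv cs f X + cderiv cs g X)"
  using assms(3)
proof (induction cs)
  case (Cons c cs)
  then have "has_pd c (\<lambda>X. cderiv cs f X + cderiv cs g X) (\<lambda>X. cderiv (c # cs) f X + cderiv (c # cs) g X)"
    using assms by (intro has_pd_add smooth_has_pd_itd) auto
  then show ?case using Cons pd_eq by fastforce
qed simp

lemma cderiv_cmult:
  assumes "smooth N f" "lwt cs \<le> N"
  shows "cderiv cs (\<lambda>X. a * f X) = (\<lambda>X. a * cderiv cs f X)"
  using assms(2)
proof (induction cs)
  case (Cons c cs)
  then have "has_pd c (\<lambda>X. a * cderiv cs f X) (\<lambda>X. 0 * cderiv cs f X + a * cderiv (c # cs) f X)"
    using assms by (intro has_pd_mult has_pd_const smooth_has_pd_itd) auto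
  then show ?case using Cons pd_eq by fastforce
qed simp

lemma cderiv_diff:
  assumes "smooth N f" "smooth N g" "lwt cs \<le> N"
  shows "cderiv cs (\<lambda>X. f X - g X) = (\<lambda>X. cderiv cs f X - cderiv cs g X)"
  using cderiv_add[OF assms(1) smooth_mult[OF smooth_const assms(2)] assms(3), of "-1"]
    cderiv_cmult[OF assms(2,3), of "-1"] by simp

lemma cderiv_zero: "cderiv cs (\<lambda>X. 0) = (\<lambda>X. 0)"
  using cderiv_cmult[OF smooth_const order_refl, of cs 0 0] by simp

lemma cderiv_sum:
  "finite I \<Longrightarrow> (\<And>i. i \<in> I \<Longrightarrow> smooth N (f i)) \<Longrightarrow> lwt cs \<le> N \<Longrightarrow>
   cderiv cs (\<lambda>X. \<Sum>i\<in>I. f i X) = (\<lambda>X. \<Sum>i\<in>I. cderiv cs (f i) X)"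
proof (induction I rule: finite_induct)
  case (insert i I)
  then show ?case using cderiv_add[of N "f i" "\<lambda>X. \<Sum>i\<in>I. f i X" cs] by (simp add: smooth_sum)
qed (simp add: cderiv_zero)

text \<open>Derivatives see only the germ, so on an open set \<open>f\<close> may be exchanged for a
  simpler expression before estimating; this is how cut-offs equal to 1 and vanishing pieces are
  dropped.\<close>

lemma cderiv_local:
  assumes "open U" "\<And>X. X \<in> U \<Longrightarrow> f X = g X" "X \<in> U"
  shows "cderiv cs f X = cderiv cs g X"
  using assms(3)
proof (induction cs arbitrary: X)
  case (Cons c cs)
  have "((\<lambda>s. X + s *\<^sub>R cdir c) \<longlongrightarrow> X + 0 *\<^sub>R cdir c) (nhds 0)"
    by (intro tendsto_intros filterlim_ident)
  then have "\<forall>\<^sub>F s in nhds 0. X + s *\<^sub>R cdir c \<in> U"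
    using assms(1) Cons.prems topological_tendstoD by fastforce
  then have "\<forall>\<^sub>F s in nhds 0. cderiv cs f (X + s *\<^sub>R cdir c) = cderiv cs g (X + s *\<^sub>R cdir c)"
    by eventually_elim (use Cons.IH in auto)
  then show ?case unfolding list.map iter_D.simps partial_D_def
    by (rule deriv_cong_ev) simp
qed (use assms in simp)

text \<open>The size of a derivative of weight \<open>w\<close> at parabolic scale \<open>\<epsilon>\<close> is measured by \<open>A / \<epsilon>\<^sup>w\<close>, so that the
  bound is multiplicative up to a constant and no Leibniz formula is needed.\<close>

definition dbound :: "'n::finite pt \<Rightarrow> nat \<Rightarrow> real \<Rightarrow> real \<Rightarrow> ('n pt \<Rightarrow> real) \<Rightarrow> bool" where
  "dbound X N A \<epsilon> f \<longleftrightarrow> (\<forall>cs. lwt cs \<le> N \<longrightarrow> \<bar>cderiv cs f X\<bar> \<le> A / \<epsilon> ^ lwt cs)"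

lemma dboundD: "dbound X N A \<epsilon> f \<Longrightarrow> lwt cs \<le> N \<Longrightarrow> \<bar>cderiv cs f X\<bar> \<le> A / \<epsilon> ^ lwt cs"
  unfolding dbound_def by blast

text \<open>The innermost recursion again: one derivative in direction \<open>c\<close> divides the
  admissible size by \<open>\<epsilon> ^ cwt c\<close>.\<close>

lemma dbound_iff:
  "dbound X N A \<epsilon> f \<longleftrightarrow> \<bar>f X\<bar> \<le> A \<and> (\<forall>c. cwt c \<le> N \<longrightarrow> dbound X (N - cwt c) (A / \<epsilon> ^ cwt c) \<epsilon> (pd c f))"
  (is "?L \<longleftrightarrow> ?R")
proof
  assume L: ?L
  show ?R
  proof (intro conjI allI impI)
    show "\<bar>f X\<bar> \<le> A" using L[unfolded dbound_def, rule_format, of "[]"] by simp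
    fix c :: "'a option" assume c: "cwt c \<le> N"
    show "dbound X (N - cwt c) (A / \<epsilon> ^ cwt c) \<epsilon> (pd c f)"
      unfolding dbound_def
    proof (intro allI impI)
      fix cs :: "'a option list" assume "lwt cs \<le> N - cwt c"
      then show "\<bar>cderiv cs (pd c f) X\<bar> \<le> A / \<epsilon> ^ cwt c / \<epsilon> ^ lwt cs"
        using L[unfolded dbound_def, rule_format, of "cs @ [c]"] c
        by (simp add: iter_D_snoc power_add mult.commute)
    qed
  qed
next
  assume R: ?R
  show ?L
    unfolding dbound_def
  proof (intro allI impI)
    fix cs :: "'a option list" assume w: "lwt cs \<le> N"
    show "\<bar>cderiv cs f X\<bar> \<le> A / \<epsilon> ^ lwt cs"
    proof (cases cs rule: rev_cases)
      case Nil then show ?thesis using R by simp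
    next
      case (snoc ds c)
      with w have "cwt c \<le> N" "lwt ds \<le> N - cwt c" by auto
      then show ?thesis using R unfolding dbound_def
        by (simp add: snoc iter_D_snoc power_add mult.commute)
    qed
  qed
qed

text \<open>For a fixed constant the bound weakens as the scale shrinks, so factors known at
  different scales can be brought to the finest one before multiplying.\<close>

lemma dbound_mono:
  assumes "dbound X N A \<epsilon> f" "M \<le> N" "A \<le> B" "0 < \<delta>" "\<delta> \<le> \<epsilon>"
  shows "dbound X M B \<delta> f"
  unfolding dbound_def
proof (intro allI impI)
  fix cs :: "'a option list" assume "lwt cs \<le> M"
  then have "\<bar>cderiv cs f X\<bar> \<le> A / \<epsilon> ^ lwt cs" using dboundD[OF assms(1)] assms(2) by simp
  moreover have "0 \<le> A" using assms(1) dbound_iff by (metis abs_ge_zero order_trans)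
  ultimately show "\<bar>cderiv cs f X\<bar> \<le> B / \<delta> ^ lwt cs"
    using assms by (smt (verit) frac_le power_mono zero_less_power)
qed

lemma dbound_local:
  assumes "open U" "\<And>X. X \<in> U \<Longrightarrow> f X = g X" "X \<in> U"
  shows "dbound X N A \<epsilon> f \<longleftrightarrow> dbound X N A \<epsilon> g"
  unfolding dbound_def using cderiv_local[OF assms] by simp

lemma dbound_zero: "0 \<le> A \<Longrightarrow> 0 < \<epsilon> \<Longrightarrow> dbound X N A \<epsilon> (\<lambda>X. 0)"
  by (simp add: dbound_def cderiv_zero)

lemma dbound_one: "0 < \<epsilon> \<Longrightarrow> dbound X N 1 \<epsilon> (\<lambda>X. 1)"
  by (subst dbound_iff) (auto simp: pd_eq[OF has_pd_const] intro: dbound_zero)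

lemma dbound_add:
  assumes "smooth N f" "smooth N g" "dbound X N A \<epsilon> f" "dbound X N B \<epsilon> g"
  shows "dbound X N (A + B) \<epsilon> (\<lambda>X. f X + g X)"
  unfolding dbound_def
proof (intro allI impI)
  fix cs :: "'a option list" assume w: "lwt cs \<le> N"
  have "\<bar>cderiv cs f X\<bar> \<le> A / \<epsilon> ^ lwt cs" "\<bar>cderiv cs g X\<bar> \<le> B / \<epsilon> ^ lwt cs"
    using assms(3,4) w by (auto intro: dboundD)
  then show "\<bar>cderiv cs (\<lambda>X. f X + g X) X\<bar> \<le> (A + B) / \<epsilon> ^ lwt cs"
    by (simp add: cderiv_add[OF assms(1,2) w] add_divide_distrib)
qed

lemma dbound_diff:
  assumes "smooth N f" "smooth N g" "dbound X N A \<epsilon> f" "dbound X N B \<epsilon> g"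
  shows "dbound X N (A + B) \<epsilon> (\<lambda>X. f X - g X)"
  unfolding dbound_def
proof (intro allI impI)
  fix cs :: "'a option list" assume w: "lwt cs \<le> N"
  have "\<bar>cderiv cs f X\<bar> \<le> A / \<epsilon> ^ lwt cs" "\<bar>cderiv cs g X\<bar> \<le> B / \<epsilon> ^ lwt cs"
    using assms(3,4) w by (auto intro: dboundD)
  then show "\<bar>cderiv cs (\<lambda>X. f X - g X) X\<bar> \<le> (A + B) / \<epsilon> ^ lwt cs"
    by (simp add: cderiv_diff[OF assms(1,2) w] add_divide_distrib)
qed

lemma dbound_sum:
  fixes f :: "'i \<Rightarrow> 'b::finite pt \<Rightarrow> real"
  assumes "finite I" "\<And>i. i \<in> I \<Longrightarrow> smooth N (f i)" "\<And>i. i \<in> I \<Longrightarrow> dbound X N A \<epsilon> (f i)"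
  shows "dbound X N (real (card I) * A) \<epsilon> (\<lambda>X. \<Sum>i\<in>I. f i X)"
  unfolding dbound_def
proof (intro allI impI)
  fix cs :: "'b::finite option list" assume w: "lwt cs \<le> N"
  have "\<bar>\<Sum>i\<in>I. cderiv cs (f i) X\<bar> \<le> (\<Sum>i\<in>I. \<bar>cderiv cs (f i) X\<bar>)" by (rule sum_abs)
  also have "\<dots> \<le> (\<Sum>i\<in>I. A / \<epsilon> ^ lwt cs)"
    using assms w by (intro sum_mono dboundD) auto
  finally show "\<bar>cderiv cs (\<lambda>X. \<Sum>i\<in>I. f i X) X\<bar> \<le> real (card I) * A / \<epsilon> ^ lwt cs"
    by (simp add: cderiv_sum[OF assms(1,2) w])
qed

text \<open>Each application of the product rule doubles the number of terms, and each derivative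
  lowers \<open>N\<close> by at least 1; hence the factor \<open>2 ^ N\<close>.\<close>

lemma dbound_mult:
  "smooth N f \<Longrightarrow> smooth N g \<Longrightarrow> dbound X N A \<epsilon> f \<Longrightarrow> dbound X N B \<epsilon> g \<Longrightarrow> 0 \<le> A \<Longrightarrow> 0 \<le> B \<Longrightarrow> 0 < \<epsilon> \<Longrightarrow>
   dbound X N (2 ^ N * (A * B)) \<epsilon> (\<lambda>X. f X * g X)"
proof (induction N arbitrary: f g A B rule: less_induct)
  case (less N)
  have "\<bar>f X\<bar> \<le> A" "\<bar>g X\<bar> \<le> B" using less.prems dbound_iff by blast+
  then have "\<bar>f X * g X\<bar> \<le> A * B" by (simp add: abs_mult mult_mono')
  also have "\<dots> \<le> 2 ^ N * (A * B)"
    using less.prems mult_right_mono[of 1 "2^N" "A*B"] by simp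
  finally have 1: "\<bar>f X * g X\<bar> \<le> 2 ^ N * (A * B)" .
  have 2: "dbound X (N - cwt c) (2 ^ N * (A * B) / \<epsilon> ^ cwt c) \<epsilon> (pd c (\<lambda>X. f X * g X))"
    if c: "cwt c \<le> N" for c
  proof -
    have lt: "N - cwt c < N" using cwt_pos(3)[of c] c by auto
    have e: "pd c (\<lambda>X. f X * g X) = (\<lambda>X. pd c f X * g X + f X * pd c g X)"
      using less.prems c smD(2) by (intro pd_eq has_pd_mult) auto
    have s: "smooth (N - cwt c) f" "smooth (N - cwt c) g"
      using less.prems(1,2) smooth_mono[OF _ diff_le_self] by auto
    have s': "smooth (N - cwt c) (pd c f)" "smooth (N - cwt c) (pd c g)"
      using less.prems(1,2) smD(3) c by auto
    have b: "dbound X (N - cwt c) A \<epsilon> f" "dbound X (N - cwt c) B \<epsilon> g"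
      using dbound_mono[OF less.prems(3) diff_le_self order_refl less.prems(7) order_refl]
        dbound_mono[OF less.prems(4) diff_le_self order_refl less.prems(7) order_refl] by auto
    have b': "dbound X (N - cwt c) (A / \<epsilon> ^ cwt c) \<epsilon> (pd c f)" "dbound X (N - cwt c) (B / \<epsilon> ^ cwt c) \<epsilon> (pd c g)"
      using less.prems(3,4)[unfolded dbound_iff[of X N]] c by simp_all
    have 1: "dbound X (N - cwt c) (2 ^ (N - cwt c) * (A / \<epsilon> ^ cwt c * B) + 2 ^ (N - cwt c) * (A * (B / \<epsilon> ^ cwt c))) \<epsilon>
      (\<lambda>X. pd c f X * g X + f X * pd c g X)"
      by (intro dbound_add smooth_mult less.IH[OF lt] s s' b b') (use less.prems in auto)
    have 2: "2 ^ (N - cwt c) * (A / \<epsilon> ^ cwt c * B) + 2 ^ (N - cwt c) * (A * (B / \<epsilon> ^ cwt c))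
        = 2 ^ Suc (N - cwt c) * (A * B) / \<epsilon> ^ cwt c" by (simp add: field_simps)
    have 3: "2 ^ Suc (N - cwt c) * (A * B) / \<epsilon> ^ cwt c \<le> 2 ^ N * (A * B) / \<epsilon> ^ cwt c"
    proof -
      have "(2::real) ^ Suc (N - cwt c) \<le> 2 ^ N" using lt by (intro power_increasing) auto
      then show ?thesis using less.prems by (intro divide_right_mono mult_right_mono) auto
    qed
    show ?thesis unfolding e by (rule dbound_mono[OF 1[unfolded 2] order_refl 3 less.prems(7) order_refl])
  qed
  show ?case by (subst dbound_iff) (use 1 2 in auto)
qed

lemma dbound_prod:
  assumes "finite I" "\<And>i. i \<in> I \<Longrightarrow> smooth N (f i)" "\<And>i. i \<in> I \<Longrightarrow> dbound X N A \<epsilon> (f i)" "0 \<le> A" "0 < \<epsilon>"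
  shows "dbound X N ((2 ^ N * A) ^ card I) \<epsilon> (\<lambda>X. \<Prod>i\<in>I. f i X)"
  using assms(1-3)
proof (induction I rule: finite_induct)
  case (insert i I)
  have "dbound X N (2 ^ N * (A * (2 ^ N * A) ^ card I)) \<epsilon> (\<lambda>X. f i X * (\<Prod>i\<in>I. f i X))"
    using insert assms by (intro dbound_mult smooth_prod) auto
  then show ?case using insert by (simp add: mult.assoc)
qed (use dbound_one[OF assms(5)] in simp)

section \<open>Balls of the parabolic maximum metric, and mean value estimates along coordinate
  axes\<close>

definition pclose :: "real \<Rightarrow> 'n::finite pt \<Rightarrow> 'n pt \<Rightarrow> bool" where
  "pclose r X Y \<longleftrightarrow> (\<forall>c. \<bar>coord X c - coord Y c\<bar> \<le> r ^ cwt c)"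

text \<open>This gives the triangle inequality for \<open>pclose\<close>: in the time direction it
  says that squaring is superadditive on nonnegative numbers.\<close>

lemma power_add_le:
  fixes r s :: real assumes "0 \<le> r" "0 \<le> s"
  shows "r ^ cwt c + s ^ cwt c \<le> (r + s) ^ cwt c"
  using assms by (auto simp: cwt_def power2_eq_square algebra_simps split: option.splits)

lemma pclose_sym: "pclose r X Y \<longleftrightarrow> pclose r Y X"
  by (auto simp: pclose_def abs_minus_commute)

lemma pclose_trans:
  assumes "pclose r X Y" "pclose s Y Z" "0 \<le> r" "0 \<le> s"
  shows "pclose (r + s) X Z"
  unfolding pclose_def
proof
  fix c
  have "\<bar>coord X c - coord Y c\<bar> \<le> r ^ cwt c" "\<bar>coord Y c - coord Z c\<bar> \<le> s ^ cwt c"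
    using assms pclose_def by blast+
  then show "\<bar>coord X c - coord Z c\<bar> \<le> (r + s) ^ cwt c"
    using power_add_le[OF assms(3,4), of c] by linarith
qed

lemma pclose_mono: "pclose r X Y \<Longrightarrow> 0 \<le> r \<Longrightarrow> r \<le> s \<Longrightarrow> pclose s X Y"
  unfolding pclose_def by (meson order_trans power_mono)

lemma pclose_refl: "0 \<le> r \<Longrightarrow> pclose r X X"
  by (simp add: pclose_def)

text \<open>\<open>has_pd\<close> speaks of increments at 0 only, but at every base point; moving
  the base point along the line gives the derivative at every parameter.\<close>

lemma has_pd_line:
  assumes "has_pd c f f'"
  shows "((\<lambda>s. f (X + s *\<^sub>R cdir c)) has_real_derivative f' (X + t *\<^sub>R cdir c)) (at t)"
proof -
  have "((\<lambda>s. f (X + t *\<^sub>R cdir c + (s - t) *\<^sub>R cdir c)) has_real_derivative f' (X + t *\<^sub>R cdir c) * (1 - 0)) (at t)"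
    by (rule DERIV_chain2[of "\<lambda>u. f (X + t *\<^sub>R cdir c + u *\<^sub>R cdir c)" _ "\<lambda>s. s - t"])
      (use assms[unfolded has_pd_def, rule_format, of "X + t *\<^sub>R cdir c"] in
        \<open>auto intro!: derivative_eq_intros\<close>)
  then show ?thesis by (simp add: algebra_simps)
qed

lemma mvt_line:
  assumes "has_pd c f f'" "\<And>s. \<bar>s\<bar> \<le> \<bar>h\<bar> \<Longrightarrow> \<bar>f' (X + s *\<^sub>R cdir c)\<bar> \<le> B"
  shows "\<bar>f (X + h *\<^sub>R cdir c) - f X\<bar> \<le> \<bar>h\<bar> * B"
proof -
  have "norm (f (X + h *\<^sub>R cdir c) - f (X + 0 *\<^sub>R cdir c)) \<le> B * norm (h - 0)"
    by (rule field_differentiable_bound[of "{- \<bar>h\<bar>..\<bar>h\<bar>}" "\<lambda>s. f (X + s *\<^sub>R cdir c)"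
          "\<lambda>t. f' (X + t *\<^sub>R cdir c)"])
      (use assms(2) in \<open>auto intro!: has_field_derivative_at_within has_pd_line[OF assms(1)]\<close>)
  then show ?thesis by (simp add: mult.commute)
qed

text \<open>The path from \<open>Y\<close> to \<open>X\<close> changes one coordinate at a time.
  Hypotheses are requested only for coordinates that really change: for two points differing in time
  alone, only a time derivative is estimated, as the seminorm in time demands.\<close>

lemma mvt_box:
  assumes pd: "\<And>c. coord X c \<noteq> coord Y c \<Longrightarrow> has_pd c f (f' c)"
    and B: "\<And>c Z. coord X c \<noteq> coord Y c \<Longrightarrow> (\<And>d. \<bar>coord Z d - coord Y d\<bar> \<le> \<bar>coord X d - coord Y d\<bar>) \<Longrightarrow> \<bar>f' c Z\<bar> \<le> B c"
  shows "\<bar>f X - f Y\<bar> \<le> (\<Sum>c\<in>UNIV. \<bar>coord X c - coord Y c\<bar> * B c)"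
proof -
  \<comment> \<open>\<open>Z S\<close> has the coordinates of \<open>X\<close> in \<open>S\<close>
    and those of \<open>Y\<close> elsewhere, so the path stays in the box centred at
    \<open>Y\<close> whose half-widths are the coordinate distances to \<open>X\<close>.\<close>
  define Z where "Z S = pt_of (\<lambda>c. if c \<in> S then coord X c else coord Y c)" for S
  have "\<bar>f (Z S) - f Y\<bar> \<le> (\<Sum>c\<in>S. \<bar>coord X c - coord Y c\<bar> * B c)" if "finite S" for S
    using that
  proof (induction S rule: finite_induct)
    case empty
    have "Z {} = Y" by (rule pt_eqI) (simp add: Z_def)
    then show ?case by simp
  next
    case (insert c S)
    have eq: "Z (insert c S) = Z S + (coord X c - coord Y c) *\<^sub>R cdir c"
      by (rule pt_eqI) (use insert in \<open>auto simp: Z_def\<close>)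
    have "\<bar>f (Z (insert c S)) - f (Z S)\<bar> \<le> \<bar>coord X c - coord Y c\<bar> * B c"
    proof (cases "coord X c = coord Y c")
      case False
      show ?thesis unfolding eq
        by (rule mvt_line[OF pd[OF False]], rule B[OF False])
           (use insert in \<open>auto simp: Z_def\<close>)
    qed (simp add: eq)
    then show ?case using insert by simp
  qed
  moreover have "Z UNIV = X" by (rule pt_eqI) (simp add: Z_def)
  ultimately show ?thesis by (metis finite_code)
qed

text \<open>Descending induction on the weight of the derivative, by the mean value theorem; this replaces
  Taylor's formula.\<close>

lemma poly_propagation:
  fixes f :: "'n::finite pt \<Rightarrow> real"
  assumes smooth: "\<And>N. smooth N f" and z: "\<And>cs X. k < lwt cs \<Longrightarrow> cderiv cs f X = 0"
    and b: "dbound Y k A \<epsilon> f" and cl: "pclose (a * \<epsilon>) X Y" and a: "1 \<le> a" and e: "0 < \<epsilon>"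
  shows "dbound X N ((1 + real CARD('n option) * a\<^sup>2) ^ Suc k * A) \<epsilon> f"
proof -
  define \<kappa> where "\<kappa> = 1 + real CARD('n option) * a\<^sup>2"
  have \<kappa>: "1 \<le> \<kappa>" by (simp add: \<kappa>_def)
  have A: "0 \<le> A" using b dbound_iff by (metis abs_ge_zero order_trans)
  \<comment> \<open>\<open>d\<close> counts the levels up to weight \<open>k + 1\<close>, where the
    derivative vanishes; each level passed on the way down costs one factor \<kappa>.\<close>
  have main: "\<bar>cderiv cs f Z\<bar> \<le> A * \<kappa> ^ d / \<epsilon> ^ lwt cs" if "Suc k \<le> lwt cs + d" "pclose (a * \<epsilon>) Z Y" for d cs Z
    using that
  proof (induction d arbitrary: cs Z)
    case 0
    then show ?case using z A e by simp
  next
    case (Suc d)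
    show ?case
    proof (cases "k < lwt cs")
      case True
      then show ?thesis using z A e \<kappa> by simp
    next
      case False
      have "\<bar>cderiv cs f Z - cderiv cs f Y\<bar> \<le> (\<Sum>c\<in>UNIV. \<bar>coord Z c - coord Y c\<bar> * (A * \<kappa> ^ d / \<epsilon> ^ lwt (c # cs)))"
      proof (rule mvt_box)
        fix c :: "'n option"
        show "has_pd c (cderiv cs f) (cderiv (c # cs) f)"
          using smooth smooth_has_pd_itd by blast
        fix W assume W: "\<And>d. \<bar>coord W d - coord Y d\<bar> \<le> \<bar>coord Z d - coord Y d\<bar>"
        have "pclose (a * \<epsilon>) W Y" using W Suc.prems(2) unfolding pclose_def by (meson order_trans)
        then show "\<bar>cderiv (c # cs) f W\<bar> \<le> A * \<kappa> ^ d / \<epsilon> ^ lwt (c # cs)"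
          using Suc.prems(1) cwt_pos(1)[of c] by (intro Suc.IH) auto
      qed
      also have "\<dots> \<le> (\<Sum>c\<in>(UNIV::'n option set). a\<^sup>2 * (A * \<kappa> ^ d / \<epsilon> ^ lwt cs))"
      proof (rule sum_mono)
        fix c :: "'n option"
        \<comment> \<open>Displacements are at most \<open>(a * \<epsilon>) ^ cwt c\<close>; since
          weights are at most 2 and \<open>a\<close> is at least 1, the factor in \<open>a\<close>
          is bounded by its square in all directions alike.\<close>
        have "a ^ cwt c \<le> a\<^sup>2" using a cwt_pos(2) power_increasing by blast
        then have "\<bar>coord Z c - coord Y c\<bar> \<le> a\<^sup>2 * \<epsilon> ^ cwt c"
          using Suc.prems(2) e unfolding pclose_def power_mult_distrib
          by (meson mult_right_mono order_trans zero_less_power less_imp_le)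
        then have "\<bar>coord Z c - coord Y c\<bar> * (A * \<kappa> ^ d / \<epsilon> ^ lwt (c # cs)) \<le>
            a\<^sup>2 * \<epsilon> ^ cwt c * (A * \<kappa> ^ d / \<epsilon> ^ lwt (c # cs))"
          using A e \<kappa> by (intro mult_right_mono) auto
        also have "\<dots> = a\<^sup>2 * (A * \<kappa> ^ d / \<epsilon> ^ lwt cs)" using e by (simp add: power_add)
        finally show "\<bar>coord Z c - coord Y c\<bar> * (A * \<kappa> ^ d / \<epsilon> ^ lwt (c # cs)) \<le>
            a\<^sup>2 * (A * \<kappa> ^ d / \<epsilon> ^ lwt cs)" .
      qed
      also have "\<dots> = (\<kappa> - 1) * (A * \<kappa> ^ d / \<epsilon> ^ lwt cs)" by (simp add: \<kappa>_def)
      finally have 1: "\<bar>cderiv cs f Z - cderiv cs f Y\<bar> \<le> (\<kappa> - 1) * (A * \<kappa> ^ d / \<epsilon> ^ lwt cs)" .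
      have "\<bar>cderiv cs f Y\<bar> \<le> A / \<epsilon> ^ lwt cs" using b False dbound_def by (metis not_less)
      also have "\<dots> \<le> A * \<kappa> ^ d / \<epsilon> ^ lwt cs"
        using A e \<kappa> by (intro divide_right_mono mult_le_cancel_left1[THEN iffD2]) auto
      finally have "\<bar>cderiv cs f Z\<bar> \<le> (\<kappa> - 1) * (A * \<kappa> ^ d / \<epsilon> ^ lwt cs) + A * \<kappa> ^ d / \<epsilon> ^ lwt cs"
        using 1 by linarith
      then show ?thesis by (simp add: algebra_simps add_divide_distrib diff_divide_distrib)
    qed
  qed
  show ?thesis unfolding dbound_def
  proof (intro allI impI)
    fix cs :: "'n option list"
    show "\<bar>cderiv cs f X\<bar> \<le> (1 + real CARD('n option) * a\<^sup>2) ^ Suc k * A / \<epsilon> ^ lwt cs"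
      using main[of cs "Suc k" X] cl by (simp add: \<kappa>_def mult.commute)
  qed
qed

section \<open>A lattice partition of unity\<close>

text \<open>Integrated B-splines serve as smooth steps: \<open>spl m\<close> has \<open>m\<close> bounded derivatives, which is all the
  argument requires.\<close>

primrec spl :: "nat \<Rightarrow> real \<Rightarrow> real" where
  "spl 0 = (\<lambda>x. max 0 (min 1 x))"
| "spl (Suc m) = (\<lambda>x. integral {x - 1..x} (spl m))"

declare spl.simps(2) [simp del]

lemma has_real_derivative_window_integral:
  fixes f :: "real \<Rightarrow> real"
  assumes "continuous_on UNIV f"
  shows "((\<lambda>x. integral {x - 1..x} f) has_real_derivative f x - f (x - 1)) (at x)"
proof -
  \<comment> \<open>The base point \<open>x - 3\<close> lies to the left of every window
    \<open>{y - 1..y}\<close> with \<open>y\<close> close to \<open>x\<close>, so the moving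
    integral is a difference of two values of one antiderivative.\<close>
  define F where "F u = integral {x - 3..u} f" for u
  have cont: "continuous_on S f" for S using assms continuous_on_subset by blast
  have F': "(F has_real_derivative f u) (at u)" if "u \<in> {x - 3<..<x + 1}" for u
  proof -
    have "(F has_real_derivative f u) (at u within {x - 3..x + 1})"
      unfolding F_def using that by (intro integral_has_real_derivative cont) auto
    then show ?thesis using that at_within_interior[of u "{x - 3..x + 1}"] by simp
  qed
  have "((\<lambda>y. y - 1) has_real_derivative 1) (at x)"
    by (auto intro!: derivative_eq_intros)
  from DERIV_chain2[where f = F, OF F' this]
  have "((\<lambda>y. F (y - 1)) has_real_derivative f (x - 1)) (at x)" by simp
  with F'[of x] have "((\<lambda>y. F y - F (y - 1)) has_real_derivative f x - f (x - 1)) (at x)"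
    by (intro DERIV_diff) auto
  moreover have "\<forall>\<^sub>F y in nhds x. y \<in> {x - 1<..<x + 1}"
    by (rule eventually_nhds_in_open) auto
  then have "\<forall>\<^sub>F y in nhds x. integral {y - 1..y} f = F y - F (y - 1)"
  proof eventually_elim
    case (elim y)
    have "F (y - 1) + integral {y - 1..y} f = F y"
      unfolding F_def using elim by (intro Henstock_Kurzweil_Integration.integral_combine integrable_continuous_real cont) auto
    then show ?case by simp
  qed
  ultimately show ?thesis by (subst DERIV_cong_ev[OF refl _ refl]) auto
qed

lemma continuous_on_spl: "continuous_on UNIV (spl m)"
proof (induction m)
  case (Suc m)
  show ?case
    unfolding spl.simps(2)
    using DERIV_isCont[OF has_real_derivative_window_integral[OF Suc]]
    by (intro continuous_at_imp_continuous_on) blast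
qed (auto intro!: continuous_intros)

lemma spl_Suc_deriv: "(spl (Suc m) has_real_derivative spl m x - spl m (x - 1)) (at x)"
  using has_real_derivative_window_integral[OF continuous_on_spl] by (simp add: spl.simps(2))

lemma spl_range: "0 \<le> spl m x \<and> spl m x \<le> 1"
proof (induction m arbitrary: x)
  case (Suc m)
  have i: "spl m integrable_on {x - 1..x}"
    by (intro integrable_continuous_real continuous_on_subset[OF continuous_on_spl]) auto
  have "integral {x - 1..x} (spl m) \<le> integral {x - 1..x} (\<lambda>_. 1)"
    using Suc i by (intro integral_le) auto
  moreover have "0 \<le> integral {x - 1..x} (spl m)"
    using Suc i by (intro integral_nonneg) auto
  ultimately show ?case by (simp add: spl.simps(2))
qed auto

lemma spl_eq_0: "x \<le> 0 \<Longrightarrow> spl m x = 0"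
proof (induction m arbitrary: x)
  case (Suc m)
  then have "integral {x - 1..x} (spl m) = integral {x - 1..x} (\<lambda>_. 0)"
    by (intro Henstock_Kurzweil_Integration.integral_cong) auto
  then show ?case by (simp add: spl.simps(2))
qed auto

lemma spl_eq_1: "real m + 1 \<le> x \<Longrightarrow> spl m x = 1"
proof (induction m arbitrary: x)
  case (Suc m)
  then have "integral {x - 1..x} (spl m) = integral {x - 1..x} (\<lambda>_. 1)"
    by (intro Henstock_Kurzweil_Integration.integral_cong) auto
  then show ?case by (simp add: spl.simps(2))
qed auto

text \<open>Differentiating a window average gives a difference of two translates one level lower,
  scaled by the inner derivative \<open>a\<close>.\<close>

lemma has_pd_spl:
  "has_pd d (\<lambda>X. spl (Suc m) (a * coord X c + b))
     (if d = c then (\<lambda>X. a * (spl m (a * coord X c + b) - spl m (a * coord X c + (b - 1)))) else (\<lambda>X. 0))"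
proof (cases "d = c")
  case True
  have "((\<lambda>s. spl (Suc m) (a * (coord X c + s) + b)) has_real_derivative
      (spl m (a * coord X c + b) - spl m (a * coord X c + b - 1)) * a) (at 0)" for X
    by (rule DERIV_chain2[where f = "spl (Suc m)" and g = "\<lambda>s. a * (coord X c + s) + b"])
      (use spl_Suc_deriv[of m "a * coord X c + b"] in \<open>auto intro!: derivative_eq_intros\<close>)
  then show ?thesis using True by (simp add: has_pd_def algebra_simps)
qed (simp add: has_pd_def)

text \<open>With slope \<open>1 / \<epsilon> ^ cwt c\<close> a derivative produces exactly the
  factor that \<open>dbound\<close> allows, and the two translates double the constant. One level of
  \<open>spl\<close> is spent per derivative, that is, per at least one unit of weight, so
  \<open>N \<le> m\<close> suffices.\<close>

lemma spl_sm_bnd: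
  assumes "0 < \<epsilon>" "a = 1 / \<epsilon> ^ cwt c" "N \<le> m"
  shows "smooth N (\<lambda>X. spl m (a * coord X c + b)) \<and> dbound X N (2 ^ N) \<epsilon> (\<lambda>X. spl m (a * coord X c + b))"
  using assms(3)
proof (induction N arbitrary: m b rule: less_induct)
  case (less N)
  let ?f = "\<lambda>m b X. spl m (a * coord X c + b)"
  have cont: "continuous_on UNIV (?f m b)"
    by (rule continuous_on_compose2[OF continuous_on_spl]) (auto intro!: continuous_intros)
  have st: "smooth (N - cwt d) (pd d (?f m b)) \<and> has_pd d (?f m b) (pd d (?f m b)) \<and>
      dbound X (N - cwt d) (2 ^ N / \<epsilon> ^ cwt d) \<epsilon> (pd d (?f m b))" if d: "cwt d \<le> N" for d
  proof -
    obtain m' where m': "m = Suc m'" using d cwt_pos(3)[of d] less.prems by (cases m) auto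
    have lt: "N - cwt d < N" "N - cwt d \<le> m'" using d cwt_pos(3)[of d] less.prems m' by auto
    let ?g = "\<lambda>X. ?f m' b X - ?f m' (b - 1) X"
    have e: "pd d (?f m b) = (if d = c then (\<lambda>X. a * ?g X) else (\<lambda>X. 0))"
      unfolding m' using pd_eq[OF has_pd_spl[of d m' a c b]] by simp
    have h: "has_pd d (?f m b) (pd d (?f m b))"
      unfolding e unfolding m' by (rule has_pd_spl)
    have s: "smooth (N - cwt d) ?g" using less.IH[OF lt] by (intro smooth_diff) auto
    have g: "dbound X (N - cwt d) (2 ^ (N - cwt d) + 2 ^ (N - cwt d)) \<epsilon> ?g"
      using less.IH[OF lt] by (intro dbound_diff) auto
    have "(2::real) ^ Suc (N - cwt d) \<le> 2 ^ N" using lt by (intro power_increasing) auto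
    then have g': "dbound X (N - cwt d) (2 ^ N) \<epsilon> ?g"
      using dbound_mono[OF g order_refl _ assms(1) order_refl] by simp
    have "dbound X (N - cwt d) (2 ^ N / \<epsilon> ^ cwt d) \<epsilon> (\<lambda>X. a * ?g X)" if "d = c"
      unfolding dbound_def
    proof (intro allI impI)
      fix cs :: "'a option list" assume w: "lwt cs \<le> N - cwt d"
      have "\<bar>cderiv cs (\<lambda>X. a * ?g X) X\<bar> = \<bar>cderiv cs ?g X\<bar> / \<epsilon> ^ cwt d"
        unfolding cderiv_cmult[OF s w] using assms(1,2) by (simp add: abs_mult that)
      also have "\<dots> \<le> (2 ^ N / \<epsilon> ^ lwt cs) / \<epsilon> ^ cwt d"
        using dboundD[OF g' w] assms(1) by (intro divide_right_mono) auto
      finally show "\<bar>cderiv cs (\<lambda>X. a * ?g X) X\<bar> \<le> 2 ^ N / \<epsilon> ^ cwt d / \<epsilon> ^ lwt cs"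
        by (simp add: mult.commute)
    qed
    then show ?thesis
      using h smooth_mult[OF smooth_const s, of a] assms(1) unfolding e
      by (cases "d = c") (simp_all add: smooth_const dbound_zero)
  qed
  have "\<bar>?f m b X\<bar> \<le> 2 ^ N"
    using spl_range[of m] by (smt (verit) one_le_power)
  then show ?case
    unfolding smooth_iff[of N] dbound_iff[of X N] using cont st by blast
qed

text \<open>A B-spline, as the difference of two unit-shifted steps; it vanishes outside the
  interval from 0 to \<open>m + 2\<close>.\<close>

definition hat :: "nat \<Rightarrow> real \<Rightarrow> real" where
  "hat m x = spl m x - spl m (x - 1)"

lemma hat_eq_0: "x \<le> 0 \<or> real m + 2 \<le> x \<Longrightarrow> hat m x = 0"
  by (auto simp: hat_def spl_eq_0 spl_eq_1)

lemma hat_telescope: "(\<Sum>j\<le>l. hat m (z + real j)) = spl m (z + real l) - spl m (z - 1)"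
  by (induction l) (auto simp: hat_def algebra_simps)

text \<open>The sum over integer shifts telescopes to a step far to the right, which is 1, minus a
  step at a negative argument, which is 0. The finite range contains every shift with a nonzero
  value.\<close>

lemma hat_partition:
  "(\<Sum>i\<in>{\<lfloor>y\<rfloor> - int (m + 2)..\<lfloor>y\<rfloor>}. hat m (y - of_int i)) = 1"
proof -
  have "(\<Sum>i\<in>{\<lfloor>y\<rfloor> - int (m + 2)..\<lfloor>y\<rfloor>}. hat m (y - of_int i)) =
      (\<Sum>j\<le>m + 2. hat m (y - of_int \<lfloor>y\<rfloor> + real j))"
    by (rule sum.reindex_bij_witness[where i = "\<lambda>j. \<lfloor>y\<rfloor> - int j" and j = "\<lambda>i. nat (\<lfloor>y\<rfloor> - i)"])
      (auto simp: algebra_simps)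
  also have "\<dots> = spl m (y - of_int \<lfloor>y\<rfloor> + real (m + 2)) - spl m (y - of_int \<lfloor>y\<rfloor> - 1)"
    by (rule hat_telescope)
  also have "\<dots> = 1"
  proof -
    have "0 \<le> y - of_int \<lfloor>y\<rfloor>" "y - of_int \<lfloor>y\<rfloor> < 1" by linarith+
    then show ?thesis by (simp add: spl_eq_0 spl_eq_1)
  qed
  finally show ?thesis .
qed

definition bump :: "nat \<Rightarrow> real \<Rightarrow> ('n::finite option \<Rightarrow> int) \<Rightarrow> 'n pt \<Rightarrow> real" where
  "bump N \<epsilon> m X = (\<Prod>c\<in>UNIV. hat N (coord X c / \<epsilon> ^ cwt c - of_int (m c)))"

text \<open>A closed box containing the support, with lower corner
  \<open>lattice_pt \<epsilon> m\<close>; closedness lets finitely many cells that miss a point be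
  discarded on a whole neighbourhood.\<close>

definition bump_cell :: "nat \<Rightarrow> real \<Rightarrow> ('n::finite option \<Rightarrow> int) \<Rightarrow> 'n pt set" where
  "bump_cell N \<epsilon> m =
     {X. \<forall>c. 0 \<le> coord X c / \<epsilon> ^ cwt c - of_int (m c) \<and> coord X c / \<epsilon> ^ cwt c - of_int (m c) \<le> real N + 2}"

definition lattice_pt :: "real \<Rightarrow> ('n::finite option \<Rightarrow> int) \<Rightarrow> 'n pt" where
  "lattice_pt \<epsilon> m = pt_of (\<lambda>c. \<epsilon> ^ cwt c * of_int (m c))"

text \<open>\<open>2 ^ N + 2 ^ N\<close> bounds one hat as a difference of two steps; the other
  \<open>2 ^ N\<close> is paid for each multiplication over the coordinates. The type argument
  carries the dimension.\<close>

definition bump_const :: "nat \<Rightarrow> 'n::finite itself \<Rightarrow> real" where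
  "bump_const N _ = (2 ^ N * (2 ^ N + 2 ^ N)) ^ CARD('n option)"

lemma bump_sm_bnd:
  fixes X :: "'n::finite pt"
  assumes "0 < \<epsilon>"
  shows "smooth N (bump N \<epsilon> m :: 'n pt \<Rightarrow> real)" "dbound X N (bump_const N TYPE('n)) \<epsilon> (bump N \<epsilon> m)"
proof -
  let ?h = "\<lambda>c X::'n pt. spl N (1 / \<epsilon> ^ cwt c * coord X c + (- of_int (m c))) -
      spl N (1 / \<epsilon> ^ cwt c * coord X c + (- of_int (m c) - 1))"
  have e: "bump N \<epsilon> m = (\<lambda>X. \<Prod>c\<in>UNIV. ?h c X)"
    by (intro ext) (simp add: bump_def hat_def algebra_simps)
  have 1: "smooth N (?h c)" "dbound X N (2 ^ N + 2 ^ N) \<epsilon> (?h c)" for c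
    by (intro smooth_diff dbound_diff spl_sm_bnd[OF assms refl order_refl, THEN conjunct1]
        spl_sm_bnd[OF assms refl order_refl, THEN conjunct2])+
  show "smooth N (bump N \<epsilon> m :: 'n pt \<Rightarrow> real)"
    unfolding e by (intro smooth_prod 1) auto
  show "dbound X N (bump_const N TYPE('n)) \<epsilon> (bump N \<epsilon> m)"
    unfolding e bump_const_def by (rule dbound_prod[OF finite 1]) (use assms in auto)
qed

lemma bump_eq_0: "X \<notin> bump_cell N \<epsilon> m \<Longrightarrow> bump N \<epsilon> m X = 0"
proof -
  assume "X \<notin> bump_cell N \<epsilon> m"
  then obtain c where "\<not> (0 \<le> coord X c / \<epsilon> ^ cwt c - of_int (m c) \<and>
      coord X c / \<epsilon> ^ cwt c - of_int (m c) \<le> real N + 2)"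
    unfolding bump_cell_def by blast
  then have "hat N (coord X c / \<epsilon> ^ cwt c - of_int (m c)) = 0"
    by (intro hat_eq_0) linarith
  then show ?thesis unfolding bump_def by (intro prod_zero) auto
qed

lemma closed_bump_cell: "closed (bump_cell N \<epsilon> m)"
  unfolding bump_cell_def divide_inverse
  by (intro closed_Collect_all closed_Collect_conj closed_Collect_le continuous_intros)

lemma bump_cell_close:
  assumes "X \<in> bump_cell N \<epsilon> m" "0 < \<epsilon>"
  shows "pclose ((real N + 2) * \<epsilon>) X (lattice_pt \<epsilon> m)"
  unfolding pclose_def
proof
  fix c
  have "0 \<le> coord X c / \<epsilon> ^ cwt c - of_int (m c)" "coord X c / \<epsilon> ^ cwt c - of_int (m c) \<le> real N + 2"
    using assms(1) by (auto simp: bump_cell_def)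
  then have "\<bar>coord X c - \<epsilon> ^ cwt c * of_int (m c)\<bar> \<le> (real N + 2) * \<epsilon> ^ cwt c"
    using assms(2) by (simp add: field_simps)
  also have "\<dots> \<le> (real N + 2) ^ cwt c * \<epsilon> ^ cwt c"
    using assms(2) cwt_pos(1)[of c] self_le_power[of "real N + 2" "cwt c"] cwt_pos(3)[of c]
    by (intro mult_right_mono) auto
  finally show "\<bar>coord X c - coord (lattice_pt \<epsilon> m) c\<bar> \<le> ((real N + 2) * \<epsilon>) ^ cwt c"
    by (simp add: lattice_pt_def power_mult_distrib)
qed

definition cells_at :: "nat \<Rightarrow> real \<Rightarrow> 'n::finite pt \<Rightarrow> ('n option \<Rightarrow> int) set" where
  "cells_at N \<epsilon> X = {m. X \<in> bump_cell N \<epsilon> m}"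

lemma cells_at_subset:
  "cells_at N \<epsilon> X \<subseteq> (\<Pi>\<^sub>E c\<in>UNIV. {\<lfloor>coord X c / \<epsilon> ^ cwt c\<rfloor> - int (N + 2)..\<lfloor>coord X c / \<epsilon> ^ cwt c\<rfloor>})"
proof
  fix m assume m: "m \<in> cells_at N \<epsilon> X"
  have "\<lfloor>coord X c / \<epsilon> ^ cwt c\<rfloor> - int (N + 2) \<le> m c \<and> m c \<le> \<lfloor>coord X c / \<epsilon> ^ cwt c\<rfloor>" for c
    using m[unfolded cells_at_def bump_cell_def, simplified, rule_format, of c] by linarith
  then show "m \<in> (\<Pi>\<^sub>E c\<in>UNIV. {\<lfloor>coord X c / \<epsilon> ^ cwt c\<rfloor> - int (N + 2)..\<lfloor>coord X c / \<epsilon> ^ cwt c\<rfloor>})"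
    by auto
qed

lemma finite_cells_at: "finite (cells_at N \<epsilon> X)"
  by (rule finite_subset[OF cells_at_subset]) (intro finite_PiE; simp)

lemma card_cells_at: "card (cells_at N \<epsilon> (X::'n::finite pt)) \<le> (N + 3) ^ CARD('n option)"
proof -
  have "card (cells_at N \<epsilon> X) \<le>
      card (\<Pi>\<^sub>E c\<in>(UNIV::'n option set). {\<lfloor>coord X c / \<epsilon> ^ cwt c\<rfloor> - int (N + 2)..\<lfloor>coord X c / \<epsilon> ^ cwt c\<rfloor>})"
    by (intro card_mono cells_at_subset finite_PiE) auto
  also have "\<dots> = (N + 3) ^ CARD('n option)"
    by (subst card_PiE) (auto simp: nat_add_distrib add.commute simp flip: power_Suc)
  finally show ?thesis .
qed

text \<open>A product of one-dimensional partitions, expanded. Any finite index set containing the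
  cells at \<open>X\<close> will do, because the other bumps vanish there; later this is the set of
  cells close to \<open>E\<close>.\<close>

lemma bump_partition:
  assumes "finite A" "cells_at N \<epsilon> X \<subseteq> A"
  shows "(\<Sum>m\<in>A. bump N \<epsilon> m X) = 1"
proof -
  let ?B = "\<lambda>c. {\<lfloor>coord X c / \<epsilon> ^ cwt c\<rfloor> - int (N + 2)..\<lfloor>coord X c / \<epsilon> ^ cwt c\<rfloor>}"
  have "(\<Sum>m\<in>A. bump N \<epsilon> m X) = (\<Sum>m\<in>cells_at N \<epsilon> X. bump N \<epsilon> m X)"
    using assms by (intro sum.mono_neutral_right) (auto simp: cells_at_def bump_eq_0)
  also have "\<dots> = (\<Sum>m\<in>(\<Pi>\<^sub>E c\<in>UNIV. ?B c). bump N \<epsilon> m X)"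
    using cells_at_subset[of N \<epsilon> X]
    by (intro sum.mono_neutral_left finite_PiE) (auto simp: cells_at_def bump_eq_0)
  also have "\<dots> = (\<Prod>c\<in>UNIV. \<Sum>i\<in>?B c. hat N (coord X c / \<epsilon> ^ cwt c - of_int i))"
    unfolding bump_def by (subst prod_sum_PiE) auto
  also have "\<dots> = 1" by (simp only: hat_partition prod.neutral_const)
  finally show ?thesis .
qed

section \<open>Parabolic polynomials\<close>

definition expo :: "'n::finite mindex \<Rightarrow> 'n option \<Rightarrow> nat" where
  "expo \<sigma> c = (case c of None \<Rightarrow> snd \<sigma> | Some i \<Rightarrow> fst \<sigma> $ i)"

definition uindex :: "'n::finite option \<Rightarrow> 'n mindex" where
  "uindex c = (case c of None \<Rightarrow> (0, 1) | Some i \<Rightarrow> (axis i 1, 0))"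

definition index_of :: "'n::finite option list \<Rightarrow> 'n mindex" where
  "index_of cs = sum_list (map uindex cs)"

definition nmon :: "'n::finite mindex \<Rightarrow> 'n pt \<Rightarrow> real" where
  "nmon \<sigma> X = (\<Prod>c\<in>UNIV. coord X c ^ expo \<sigma> c / fact (expo \<sigma> c))"

text \<open>Taylor form about \<open>X\<^sub>0\<close>. When \<open>a\<close> vanishes above weight
  \<open>k\<close>, as the lemmas below assume, \<open>a \<sigma>\<close> is the derivative of index
  \<sigma> at the centre, and differentiation is a pure shift of the coefficient family with
  \<open>k\<close> kept fixed.\<close>

definition cpoly :: "nat \<Rightarrow> ('n::finite mindex \<Rightarrow> real) \<Rightarrow> 'n pt \<Rightarrow> 'n pt \<Rightarrow> real" where
  "cpoly k a X\<^sub>0 X = (\<Sum>\<sigma> | weight \<sigma> \<le> k. a \<sigma> * nmon \<sigma> (X - X\<^sub>0))"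

lemma expo_simps [simp]:
  "expo (\<sigma> + \<tau>) c = expo \<sigma> c + expo \<tau> c" "expo 0 c = 0" "expo (\<sigma> - \<tau>) c = expo \<sigma> c - expo \<tau> c"
  "expo (uindex c) d = (if c = d then 1 else 0)"
  by (auto simp: expo_def uindex_def axis_def split: option.splits)

lemma mindex_eqI: "(\<And>c. expo \<sigma> c = expo \<tau> c) \<Longrightarrow> \<sigma> = \<tau>"
  by (metis option.simps(4) option.simps(5) prod.expand expo_def vec_eq_iff)

lemma sum_UNIV_option:
  "(\<Sum>c\<in>(UNIV :: 'n::finite option set). g c) = (\<Sum>i\<in>UNIV. g (Some i)) + (g None :: 'b::comm_monoid_add)"
  by (simp add: UNIV_option_conv sum.insert sum.reindex add.commute)

lemma prod_UNIV_option:
  "(\<Prod>c\<in>(UNIV :: 'n::finite option set). g c) = (\<Prod>i\<in>UNIV. g (Some i)) * (g None :: 'b::comm_monoid_mult)"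
  by (simp add: UNIV_option_conv prod.insert prod.reindex mult.commute)

lemma weight_expo: "weight \<sigma> = (\<Sum>c\<in>UNIV. cwt c * expo \<sigma> c)"
  by (simp add: weight_def sum_UNIV_option expo_def cwt_def)

lemma weight_add: "weight (\<sigma> + \<tau>) = weight \<sigma> + weight \<tau>"
  by (simp add: weight_expo sum.distrib distrib_left)

lemma weight_uindex: "weight (uindex c) = cwt c"
proof -
  have "weight (uindex c) = (\<Sum>d\<in>UNIV. if c = d then cwt d else 0)"
    unfolding weight_expo by (intro sum.cong) auto
  then show ?thesis by simp
qed

lemma index_of_simps [simp]: "index_of [] = 0" "index_of (c # cs) = uindex c + index_of cs" "index_of (cs @ ds) = index_of cs + index_of ds"
  by (auto simp: index_of_def)

lemma weight_index_of: "weight (index_of cs) = lwt cs"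
proof (induction cs)
  case Nil show ?case by (simp add: weight_expo)
qed (simp add: weight_add weight_uindex)

lemma nmon_mpow: "nmon \<sigma> X = mpow X \<sigma> / mfact \<sigma>"
  by (simp add: nmon_def mpow_def mfact_def prod_UNIV_option coord_def expo_def prod_dividef)

lemma nmon_0: "nmon \<sigma> 0 = (if \<sigma> = 0 then 1 else 0)"
proof (cases "\<sigma> = 0")
  case False
  then obtain c where "expo \<sigma> c \<noteq> 0" using mindex_eqI[of \<sigma> 0] by auto
  then have "\<exists>c. coord 0 c ^ expo \<sigma> c / fact (expo \<sigma> c) = 0" by (metis coord_simps(4) div_0 power_0_left)
  then show ?thesis using False unfolding nmon_def by (auto intro: prod_zero)
qed (simp add: nmon_def)

text \<open>The factorials in the normalisation absorb the exponent, so a partial derivative lowers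
  the index by one unit. The case split is there because subtraction of indices truncates at
  0.\<close>

lemma has_pd_nmon:
  "has_pd c (\<lambda>X. nmon \<sigma> (X - X\<^sub>0)) (\<lambda>X. if expo \<sigma> c = 0 then 0 else nmon (\<sigma> - uindex c) (X - X\<^sub>0))"
  unfolding has_pd_def
proof
  fix X :: "'a pt"
  define R where "R = (\<Prod>d\<in>UNIV - {c}. coord (X - X\<^sub>0) d ^ expo \<sigma> d / fact (expo \<sigma> d))"
  have "(\<Prod>d\<in>UNIV - {c}. coord (X + s *\<^sub>R cdir c - X\<^sub>0) d ^ expo \<sigma> d / fact (expo \<sigma> d)) = R" for s
    unfolding R_def by (intro prod.cong) auto
  then have e: "nmon \<sigma> (X + s *\<^sub>R cdir c - X\<^sub>0) = (coord (X - X\<^sub>0) c + s) ^ expo \<sigma> c / fact (expo \<sigma> c) * R" for s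
    unfolding nmon_def by (subst prod.remove[of UNIV c]) (auto simp: algebra_simps)
  have r: "(\<Prod>d\<in>UNIV - {c}. coord (X - X\<^sub>0) d ^ expo (\<sigma> - uindex c) d / fact (expo (\<sigma> - uindex c) d)) = R"
    unfolding R_def by (intro prod.cong) auto
  have e': "nmon (\<sigma> - uindex c) (X - X\<^sub>0) = coord (X - X\<^sub>0) c ^ (expo \<sigma> c - 1) / fact (expo \<sigma> c - 1) * R"
    unfolding nmon_def by (subst prod.remove[of UNIV c]) (simp_all only: r finite UNIV_I, simp)
  show "((\<lambda>s. nmon \<sigma> (X + s *\<^sub>R cdir c - X\<^sub>0)) has_real_derivative
      (if expo \<sigma> c = 0 then 0 else nmon (\<sigma> - uindex c) (X - X\<^sub>0))) (at 0)"
  proof (cases "expo \<sigma> c")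
    case 0
    then show ?thesis unfolding e by simp
  next
    case (Suc m)
    have "((\<lambda>s. coord (X - X\<^sub>0) c + s) has_real_derivative 1) (at 0)"
      by (auto intro!: derivative_eq_intros)
    from DERIV_cmult_right[OF DERIV_cdivide[OF DERIV_power_Suc[OF this, of m], of "fact (Suc m)"], of R]
    have "((\<lambda>s. (coord (X - X\<^sub>0) c + s) ^ Suc m / fact (Suc m) * R) has_real_derivative
       real (Suc m) * coord (X - X\<^sub>0) c ^ m / fact (Suc m) * R) (at 0)"
      by (simp only: of_nat_Suc add_0_right mult_1)
    moreover have "real (Suc m) * x / fact (Suc m) = x / fact m" for x
      by (simp add: fact_Suc field_simps del: of_nat_Suc)
    ultimately show ?thesis unfolding e e' Suc by simp
  qed
qed

lemma continuous_on_nmon: "continuous_on S (\<lambda>X. nmon \<sigma> (X - X\<^sub>0))"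
  unfolding nmon_def by (auto intro!: continuous_intros)

lemma continuous_on_cpoly: "continuous_on S (cpoly k a X\<^sub>0)"
  unfolding cpoly_def by (intro continuous_intros continuous_on_nmon)

lemma has_pd_sum:
  "finite I \<Longrightarrow> (\<And>i. i \<in> I \<Longrightarrow> has_pd c (f i) (f' i)) \<Longrightarrow>
    has_pd c (\<lambda>X. \<Sum>i\<in>I. f i X) (\<lambda>X. \<Sum>i\<in>I. f' i X)"
  by (induction I rule: finite_induct) (auto intro: has_pd_add has_pd_const)

lemma has_pd_cpoly:
  assumes a: "\<And>\<sigma>. k < weight \<sigma> \<Longrightarrow> a \<sigma> = 0"
  shows "has_pd c (cpoly k a X\<^sub>0) (cpoly k (\<lambda>\<sigma>. a (\<sigma> + uindex c)) X\<^sub>0)"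
proof -
  let ?m = "\<lambda>\<sigma> X. if expo \<sigma> c = 0 then 0 else nmon (\<sigma> - uindex c) (X - X\<^sub>0)"
  have "has_pd c (\<lambda>X. a \<sigma> * nmon \<sigma> (X - X\<^sub>0)) (\<lambda>X. a \<sigma> * ?m \<sigma> X)" for \<sigma>
    using has_pd_mult[OF has_pd_const[of c "a \<sigma>"] has_pd_nmon[of c \<sigma> X\<^sub>0]] by simp
  then have 1: "has_pd c (cpoly k a X\<^sub>0) (\<lambda>X. \<Sum>\<sigma> | weight \<sigma> \<le> k. a \<sigma> * ?m \<sigma> X)"
    unfolding cpoly_def[abs_def] by (rule has_pd_sum[OF finite_weight_le])
  have "(\<Sum>\<sigma> | weight \<sigma> \<le> k. a \<sigma> * ?m \<sigma> X) = cpoly k (\<lambda>\<sigma>. a (\<sigma> + uindex c)) X\<^sub>0 X" for X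
  proof -
    have "(\<Sum>\<sigma> | weight \<sigma> \<le> k. a \<sigma> * ?m \<sigma> X) =
        (\<Sum>\<sigma> | weight \<sigma> \<le> k \<and> expo \<sigma> c \<noteq> 0. a \<sigma> * nmon (\<sigma> - uindex c) (X - X\<^sub>0))"
      by (intro sum.mono_neutral_cong_right finite_weight_le) auto
    also have "\<dots> = (\<Sum>\<sigma> | weight \<sigma> + cwt c \<le> k. a (\<sigma> + uindex c) * nmon \<sigma> (X - X\<^sub>0))"
    proof (rule sum.reindex_bij_witness[where i = "\<lambda>\<sigma>. \<sigma> + uindex c" and j = "\<lambda>\<sigma>. \<sigma> - uindex c"])
      fix \<sigma> :: "'a mindex" assume \<sigma>: "\<sigma> \<in> {\<sigma>. weight \<sigma> \<le> k \<and> expo \<sigma> c \<noteq> 0}"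
      show e: "\<sigma> - uindex c + uindex c = \<sigma>" using \<sigma> by (intro mindex_eqI) auto
      then have "weight \<sigma> = weight (\<sigma> - uindex c) + cwt c" by (metis weight_add weight_uindex)
      then show "\<sigma> - uindex c \<in> {\<sigma>. weight \<sigma> + cwt c \<le> k}" using \<sigma> by auto
      show "a (\<sigma> - uindex c + uindex c) * nmon (\<sigma> - uindex c) (X - X\<^sub>0) = a \<sigma> * nmon (\<sigma> - uindex c) (X - X\<^sub>0)"
        by (simp add: e)
    next
      fix \<tau> :: "'a mindex" assume "\<tau> \<in> {\<sigma>. weight \<sigma> + cwt c \<le> k}"
      then show "\<tau> + uindex c \<in> {\<sigma>. weight \<sigma> \<le> k \<and> expo \<sigma> c \<noteq> 0}" by (simp add: weight_add weight_uindex)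
      show "\<tau> + uindex c - uindex c = \<tau>" by (rule mindex_eqI) simp
    qed
    \<comment> \<open>For the indices added here \<open>\<sigma> + uindex c\<close> has weight above
      \<open>k\<close>, where \<open>a\<close> is 0.\<close>
    also have "\<dots> = (\<Sum>\<sigma> | weight \<sigma> \<le> k. a (\<sigma> + uindex c) * nmon \<sigma> (X - X\<^sub>0))"
      by (intro sum.mono_neutral_left finite_weight_le) (auto simp: a weight_add weight_uindex)
    finally show ?thesis by (simp add: cpoly_def)
  qed
  then have "(\<lambda>X. \<Sum>\<sigma> | weight \<sigma> \<le> k. a \<sigma> * ?m \<sigma> X) = cpoly k (\<lambda>\<sigma>. a (\<sigma> + uindex c)) X\<^sub>0"
    by (rule ext)
  with 1 show ?thesis by (simp only:)
qed

lemma cderiv_pol: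
  assumes a: "\<And>\<sigma>. k < weight \<sigma> \<Longrightarrow> a \<sigma> = 0"
  shows "cderiv cs (cpoly k a X\<^sub>0) = cpoly k (\<lambda>\<sigma>. a (\<sigma> + index_of cs)) X\<^sub>0"
proof (induction cs)
  case (Cons c cs)
  have "has_pd c (cpoly k (\<lambda>\<sigma>. a (\<sigma> + index_of cs)) X\<^sub>0) (cpoly k (\<lambda>\<sigma>. a (\<sigma> + uindex c + index_of cs)) X\<^sub>0)"
    by (rule has_pd_cpoly) (simp add: a weight_add)
  then show ?case using Cons pd_eq by (simp add: add.assoc)
qed simp

lemma smooth_pol:
  assumes a: "\<And>\<sigma>. k < weight \<sigma> \<Longrightarrow> a \<sigma> = 0"
  shows "smooth N (cpoly k a X\<^sub>0)"
  using assms
proof (induction N arbitrary: a rule: less_induct)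
  case (less N)
  show ?case
  proof (rule smI[OF continuous_on_cpoly])
    fix c :: "'a option" assume "cwt c \<le> N"
    then have "smooth (N - cwt c) (cpoly k (\<lambda>\<sigma>. a (\<sigma> + uindex c)) X\<^sub>0)"
      using cwt_pos(3)[of c] less.prems by (intro less.IH) (auto simp: weight_add)
    then show "\<exists>f'. has_pd c (cpoly k a X\<^sub>0) f' \<and> smooth (N - cwt c) f'"
      using has_pd_cpoly[of k a c X\<^sub>0] less.prems by blast
  qed
qed

lemma cpoly_center: "cpoly k a X\<^sub>0 X\<^sub>0 = a 0"
proof -
  have "cpoly k a X\<^sub>0 X\<^sub>0 = (\<Sum>\<sigma>::'a mindex | weight \<sigma> \<le> k. if \<sigma> = 0 then a 0 else 0)"
    unfolding cpoly_def by (intro sum.cong) (auto simp: nmon_0)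
  then show ?thesis by (simp add: finite_weight_le) (simp add: weight_expo)
qed

lemma cderiv_pol_center:
  "(\<And>\<sigma>. k < weight \<sigma> \<Longrightarrow> a \<sigma> = 0) \<Longrightarrow> cderiv cs (cpoly k a X\<^sub>0) X\<^sub>0 = a (index_of cs)"
  by (simp add: cderiv_pol cpoly_center)

lemma cderiv_pol_zero:
  "(\<And>\<sigma>. k < weight \<sigma> \<Longrightarrow> a \<sigma> = 0) \<Longrightarrow> k < lwt cs \<Longrightarrow> cderiv cs (cpoly k a X\<^sub>0) X = 0"
  by (simp add: cderiv_pol weight_add weight_index_of cpoly_def)

lemma exists_close: "\<exists>a\<ge>1. pclose a X Y"
proof (intro exI[of _ "1 + (\<Sum>c\<in>UNIV. \<bar>coord X c - coord Y c\<bar>)"] conjI)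
  let ?a = "1 + (\<Sum>c\<in>UNIV. \<bar>coord X c - coord Y c\<bar>)"
  show "pclose ?a X Y"
    unfolding pclose_def
  proof
    fix c :: "'a option"
    have "\<bar>coord X c - coord Y c\<bar> \<le> (\<Sum>c\<in>UNIV. \<bar>coord X c - coord Y c\<bar>)"
      by (rule member_le_sum) auto
    also have "\<dots> \<le> ?a" by simp
    also have "\<dots> \<le> ?a ^ cwt c"
      using cwt_pos(3)[of c] by (intro self_le_power) (auto simp: sum_nonneg)
    finally show "\<bar>coord X c - coord Y c\<bar> \<le> ?a ^ cwt c" .
  qed
qed (simp add: sum_nonneg)

text \<open>Propagation from \<open>Y\<close> with constant 0 at scale 1. Applied to differences, it
  identifies polynomials by their derivatives at one point.\<close>

lemma poly_eq_zero:
  assumes smooth: "\<And>N. smooth N f" and z: "\<And>cs X. k < lwt cs \<Longrightarrow> cderiv cs f X = 0"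
    and c: "\<And>cs. lwt cs \<le> k \<Longrightarrow> cderiv cs f Y = 0"
  shows "f X = 0"
proof -
  obtain a where "1 \<le> a" "pclose a X Y" using exists_close by blast
  moreover have "dbound Y k 0 1 f" unfolding dbound_def using c by simp
  ultimately have "dbound X 0 ((1 + real CARD('a option) * a\<^sup>2) ^ Suc k * 0) 1 f"
    using smooth z by (intro poly_propagation) auto
  then show ?thesis using dboundD[of X 0 0 1 f "[]"] by simp
qed

text \<open>The new coefficients are the derivatives of the polynomial at \<open>X\<^sub>1\<close>,
  so all derivatives of the difference of both sides vanish at \<open>X\<^sub>1\<close>.\<close>

lemma cpoly_recenter:
  assumes a: "\<And>\<sigma>. k < weight \<sigma> \<Longrightarrow> a \<sigma> = 0"
  shows "cpoly k a X\<^sub>0 = cpoly k (\<lambda>\<sigma>. cpoly k (\<lambda>\<tau>. a (\<tau> + \<sigma>)) X\<^sub>0 X\<^sub>1) X\<^sub>1"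
    "k < weight \<sigma> \<Longrightarrow> cpoly k (\<lambda>\<tau>. a (\<tau> + \<sigma>)) X\<^sub>0 X\<^sub>1 = 0"
proof -
  let ?b = "\<lambda>\<sigma>. cpoly k (\<lambda>\<tau>. a (\<tau> + \<sigma>)) X\<^sub>0 X\<^sub>1"
  show b: "?b \<sigma> = 0" if "k < weight \<sigma>" for \<sigma>
    using that by (simp add: cpoly_def a weight_add)
  have "cpoly k a X\<^sub>0 X - cpoly k ?b X\<^sub>1 X = 0" for X
  proof (rule poly_eq_zero[where k = k and Y = X\<^sub>1 and f = "\<lambda>X. cpoly k a X\<^sub>0 X - cpoly k ?b X\<^sub>1 X"])
    show smooth: "smooth N (\<lambda>X. cpoly k a X\<^sub>0 X - cpoly k ?b X\<^sub>1 X)" for N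
      by (intro smooth_diff smooth_pol a b)
    have i: "cderiv cs (\<lambda>X. cpoly k a X\<^sub>0 X - cpoly k ?b X\<^sub>1 X) = (\<lambda>X. cderiv cs (cpoly k a X\<^sub>0) X - cderiv cs (cpoly k ?b X\<^sub>1) X)" for cs
      by (rule cderiv_diff[OF smooth_pol smooth_pol order_refl]) (auto intro: a b)
    show "cderiv cs (\<lambda>X. cpoly k a X\<^sub>0 X - cpoly k ?b X\<^sub>1 X) X = 0" if "k < lwt cs" for cs X
      unfolding i using cderiv_pol_zero[OF a that] cderiv_pol_zero[OF b that] by simp
    show "cderiv cs (\<lambda>X. cpoly k a X\<^sub>0 X - cpoly k ?b X\<^sub>1 X) X\<^sub>1 = 0" if "lwt cs \<le> k" for cs
      unfolding i using cderiv_pol_center[of k ?b cs X\<^sub>1] b by (simp add: cderiv_pol a)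
  qed
  then show "cpoly k a X\<^sub>0 = cpoly k ?b X\<^sub>1" by (intro ext) simp
qed

lemma par_polysE:
  assumes "P \<in> par_polys k"
  obtains a where "\<And>\<sigma>. k < weight \<sigma> \<Longrightarrow> a \<sigma> = 0" "P = cpoly k a X\<^sub>0"
proof -
  obtain a where P: "P = (\<lambda>X. \<Sum>\<sigma> | weight \<sigma> \<le> k. a \<sigma> / mfact \<sigma> * mpow X \<sigma>)"
    using assms unfolding par_polys_def by blast
  define a' where "a' \<sigma> = (if weight \<sigma> \<le> k then a \<sigma> else 0)" for \<sigma>
  have "P = cpoly k a' 0"
    unfolding P cpoly_def by (intro ext sum.cong) (auto simp: a'_def nmon_mpow)
  moreover have a': "a' \<sigma> = 0" if "k < weight \<sigma>" for \<sigma> using that by (simp add: a'_def)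
  ultimately show ?thesis
    using that[of "\<lambda>\<sigma>. cpoly k (\<lambda>\<tau>. a' (\<tau> + \<sigma>)) 0 X\<^sub>0"] cpoly_recenter[of k a', OF a'] by simp
qed

definition dir_coords :: "'n::finite mindex \<Rightarrow> 'n option list" where
  "dir_coords \<sigma> = concat (map (\<lambda>i. replicate (fst \<sigma> $ i) (Some i)) coords) @ replicate (snd \<sigma>) None"

lemma dirs_eq: "dirs \<sigma> = map cdir (dir_coords \<sigma>)"
  by (simp add: dirs_def dir_coords_def map_concat comp_def cdir_def)

lemma index_of_dir_coords: "index_of (dir_coords \<sigma>) = \<sigma>"
proof (rule mindex_eqI)
  fix c
  have rep: "expo (index_of (replicate m d)) c = (if c = d then m else 0)" for m and d :: "'a option"
    by (induction m) auto
  have cat: "expo (index_of (concat xss)) c = sum_list (map (\<lambda>xs. expo (index_of xs) c) xss)" for xss :: "'a option list list"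
    by (induction xss) auto
  have e: "expo (index_of (dir_coords \<sigma>)) c =
      sum_list (map (\<lambda>i. if c = Some i then fst \<sigma> $ i else 0) coords) + (if c = None then snd \<sigma> else 0)"
    by (simp add: dir_coords_def rep cat comp_def)
  show "expo (index_of (dir_coords \<sigma>)) c = expo \<sigma> c"
    unfolding e by (cases c) (simp_all add: sum_list_distinct_conv_sum_set coords expo_def)
qed

lemma lwt_dir_coords: "lwt (dir_coords \<sigma>) = weight \<sigma>"
  by (metis index_of_dir_coords weight_index_of)

lemma D_eq_cderiv: "D \<sigma> g = cderiv (dir_coords \<sigma>) g"
  by (simp add: D_def dirs_eq)

section \<open>Lower bounds for polynomials in terms of their coefficients, by compactness\<close>

lemma open_Collect_all_finite:
  "(\<And>c::'c::finite. open {x. P c x}) \<Longrightarrow> open {x. \<forall>c. P c x}"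
  by (simp add: Collect_all_eq open_INT)

text \<open>Vanishing near \<open>z\<close> kills all derivatives at \<open>z\<close>, hence the
  polynomial, hence its derivatives at 0, which are the coefficients.\<close>

lemma poly_box_vanish:
  assumes a: "\<And>\<sigma>. k < weight \<sigma> \<Longrightarrow> b \<sigma> = 0" and r: "0 < r"
    and v: "\<And>Z. (\<And>c. \<bar>coord Z c - coord z c\<bar> < r) \<Longrightarrow> cpoly k b 0 Z = 0"
  shows "b \<sigma> = 0"
proof -
  define U where "U = {Z. \<forall>c. \<bar>coord Z c - coord z c\<bar> < r}"
  have "open U" unfolding U_def by (intro open_Collect_all_finite open_Collect_less continuous_intros)
  moreover have "z \<in> U" using r by (simp add: U_def)
  ultimately have "cderiv cs (cpoly k b 0) z = 0" for cs
    using cderiv_local[of U "cpoly k b 0" "\<lambda>X. 0" z cs] v by (simp add: U_def cderiv_zero)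
  then have "cpoly k b 0 X = 0" for X
    using poly_eq_zero[of "cpoly k b 0" k z] smooth_pol[of k b, OF a] cderiv_pol_zero[of k b, OF a] by blast
  then have "cpoly k b 0 = (\<lambda>X. 0)" by (rule ext)
  then show ?thesis
    using cderiv_pol_center[of k b "dir_coords \<sigma>" 0] a by (simp add: index_of_dir_coords cderiv_zero)
qed

text \<open>Coefficient families are functions on all multi-indices with the product topology.
  Pinning those above weight \<open>k\<close> to 0 makes the set a product of compact sets.\<close>

lemma compact_coefficient_box:
  "compact {b :: 'n::finite mindex \<Rightarrow> real. (\<forall>\<sigma>. \<bar>b \<sigma>\<bar> \<le> 1) \<and> (\<forall>\<sigma>. k < weight \<sigma> \<longrightarrow> b \<sigma> = 0)}"
proof -
  let ?I = "\<lambda>\<sigma>::'n mindex. if weight \<sigma> \<le> k then {-1..1::real} else {0}"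
  have "{b. (\<forall>\<sigma>. \<bar>b \<sigma>\<bar> \<le> 1) \<and> (\<forall>\<sigma>. k < weight \<sigma> \<longrightarrow> b \<sigma> = 0)} = PiE UNIV ?I"
    unfolding PiE_UNIV_domain Pi_def
    by (intro Collect_cong) (smt (verit) atLeastAtMost_iff not_less singletonD singletonI UNIV_I)
  moreover have "compactin (product_topology (\<lambda>_. euclidean) UNIV) (PiE UNIV ?I)"
    by (subst compactin_PiE) auto
  ultimately show ?thesis by (simp add: euclidean_product_topology)
qed

text \<open>Each normalised polynomial is nonzero somewhere in the box, and exceeding a given size
  at a fixed point is an open condition on the coefficients. A finite subcover of the compact set of
  normalised families yields one \<delta> for all of them.\<close>

lemma poly_point_lower_bound:
  fixes z :: "'n::finite pt"
  assumes r: "0 < r"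
  obtains \<delta> where "0 < \<delta>"
    "\<And>b. (\<And>\<sigma>. \<bar>b \<sigma>\<bar> \<le> 1) \<Longrightarrow> (\<And>\<sigma>. k < weight \<sigma> \<Longrightarrow> b \<sigma> = 0) \<Longrightarrow> (\<exists>\<sigma>. \<bar>b \<sigma>\<bar> = 1) \<Longrightarrow>
      \<exists>Z. (\<forall>c. \<bar>coord Z c - coord z c\<bar> < r) \<and> \<delta> < \<bar>cpoly k b 0 Z\<bar>"
proof -
  define S where "S = {b :: 'n mindex \<Rightarrow> real. (\<forall>\<sigma>. \<bar>b \<sigma>\<bar> \<le> 1) \<and> (\<forall>\<sigma>. k < weight \<sigma> \<longrightarrow> b \<sigma> = 0)}
      \<inter> (\<Union>\<sigma>\<in>{\<sigma>. weight \<sigma> \<le> k}. {b. \<bar>b \<sigma>\<bar> = 1})"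
  define U where "U i = {b. snd i < \<bar>cpoly k b 0 (fst i)\<bar>}" for i :: "'n pt \<times> real"
  define I where "I = {i :: 'n pt \<times> real. (\<forall>c. \<bar>coord (fst i) c - coord z c\<bar> < r) \<and> 0 < snd i}"
  have "closed {b :: 'n mindex \<Rightarrow> real. \<bar>b \<sigma>\<bar> = 1}" for \<sigma>
    by (intro closed_Collect_eq continuous_intros continuous_on_product_coordinates)
  then have S: "compact S"
    unfolding S_def by (intro compact_Int_closed compact_coefficient_box closed_UN finite_weight_le) auto
  have U: "open (U i)" for i
    unfolding U_def cpoly_def
    by (intro open_Collect_less continuous_intros continuous_on_product_coordinates)
  have cover: "S \<subseteq> (\<Union>i\<in>I. U i)"
  proof
    fix b assume b: "b \<in> S"
    then obtain \<sigma> where "\<bar>b \<sigma>\<bar> = 1" unfolding S_def by blast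
    then have "b \<sigma> \<noteq> 0" by auto
    then obtain Z where Z: "\<And>c. \<bar>coord Z c - coord z c\<bar> < r" "cpoly k b 0 Z \<noteq> 0"
      using poly_box_vanish[of k b r z \<sigma>] b r unfolding S_def by blast
    then have "(Z, \<bar>cpoly k b 0 Z\<bar> / 2) \<in> I" "b \<in> U (Z, \<bar>cpoly k b 0 Z\<bar> / 2)"
      by (auto simp: I_def U_def)
    then show "b \<in> (\<Union>i\<in>I. U i)" by blast
  qed
  obtain J where J: "J \<subseteq> I" "finite J" "S \<subseteq> (\<Union>i\<in>J. U i)"
    using compactE_image[OF S, of I U] U cover by blast
  \<comment> \<open>Inserting 1 keeps the minimum defined and positive when \<open>J\<close> is
    empty.\<close>
  define \<delta> where "\<delta> = Min (insert 1 (snd ` J))"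
  have "0 < \<delta>" using J by (auto simp: \<delta>_def I_def)
  moreover have "\<exists>Z. (\<forall>c. \<bar>coord Z c - coord z c\<bar> < r) \<and> \<delta> < \<bar>cpoly k b 0 Z\<bar>"
    if b: "\<And>\<sigma>. \<bar>b \<sigma>\<bar> \<le> 1" "\<And>\<sigma>. k < weight \<sigma> \<Longrightarrow> b \<sigma> = 0" "\<exists>\<sigma>. \<bar>b \<sigma>\<bar> = 1" for b
  proof -
    obtain \<sigma> where "\<bar>b \<sigma>\<bar> = 1" using b by blast
    moreover have "weight \<sigma> \<le> k" using calculation b(2)[of \<sigma>] by force
    ultimately have "b \<in> S" using b(1,2) unfolding S_def by blast
    then obtain i where i: "i \<in> J" "b \<in> U i" using J by blast
    have "\<delta> \<le> snd i" unfolding \<delta>_def using i J by (intro Min_le) auto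
    then show ?thesis using i J by (intro exI[of _ "fst i"]) (auto simp: U_def I_def)
  qed
  ultimately show ?thesis using that by blast
qed

text \<open>A bound at a point says nothing about integrals; a gradient bound uniform over
  normalised coefficients spreads it over a box of radius \<eta>. The box moves with the polynomial,
  but \<eta> and \<delta> do not depend on it, and homogeneity removes the normalisation.\<close>

lemma poly_box_lower_bound:
  fixes z :: "'n::finite pt"
  assumes r: "0 < r" "r \<le> 1" and z: "\<And>c. \<bar>coord z c\<bar> \<le> 1"
  obtains \<delta> \<eta> where "0 < \<delta>" "0 < \<eta>" "\<eta> \<le> r"
    "\<And>b. (\<And>\<sigma>. k < weight \<sigma> \<Longrightarrow> b \<sigma> = 0) \<Longrightarrow>
      \<exists>Z\<^sub>0. (\<forall>c. \<bar>coord Z\<^sub>0 c - coord z c\<bar> \<le> r) \<and>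
        (\<forall>Z. (\<forall>c. \<bar>coord Z c - coord Z\<^sub>0 c\<bar> \<le> \<eta>) \<longrightarrow> (\<forall>\<sigma>. \<delta> * \<bar>b \<sigma>\<bar> \<le> \<bar>cpoly k b 0 Z\<bar>))"
proof -
  obtain \<delta>' where \<delta>': "0 < \<delta>'"
    "\<And>b. (\<And>\<sigma>. \<bar>b \<sigma>\<bar> \<le> 1) \<Longrightarrow> (\<And>\<sigma>. k < weight \<sigma> \<Longrightarrow> b \<sigma> = 0) \<Longrightarrow> (\<exists>\<sigma>. \<bar>b \<sigma>\<bar> = 1) \<Longrightarrow>
      \<exists>Z. (\<forall>c. \<bar>coord Z c - coord z c\<bar> < r) \<and> \<delta>' < \<bar>cpoly k b 0 Z\<bar>"
    using poly_point_lower_bound[OF r(1), of k z] by blast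
  \<comment> \<open>All points involved have coordinates at most 3: 1 for \<open>z\<close>, and at
    most 1 each for \<open>r\<close> and \<eta>.\<close>
  define B where "B = (1 + real CARD('n option) * 3\<^sup>2) ^ Suc k"
  define n where "n = real CARD('n option)"
  \<comment> \<open>Chosen so that the polynomial changes by at most half of
    \<open>\<delta>'\<close> across the box.\<close>
  define \<eta> where "\<eta> = min r (\<delta>' / (2 * n * B))"
  have B: "0 < B" "0 < n" by (auto simp: B_def n_def add_pos_nonneg)
  have \<eta>: "0 < \<eta>" "\<eta> \<le> r" "n * (\<eta> * B) \<le> \<delta>' / 2"
  proof -
    have "\<eta> \<le> \<delta>' / (2 * n * B)" by (simp add: \<eta>_def)
    then show "n * (\<eta> * B) \<le> \<delta>' / 2" using B by (simp add: field_simps)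
  qed (use r \<delta>' B in \<open>auto simp: \<eta>_def\<close>)
  have normalised: "\<exists>Z\<^sub>0. (\<forall>c. \<bar>coord Z\<^sub>0 c - coord z c\<bar> \<le> r) \<and>
      (\<forall>Z. (\<forall>c. \<bar>coord Z c - coord Z\<^sub>0 c\<bar> \<le> \<eta>) \<longrightarrow> \<delta>' / 2 \<le> \<bar>cpoly k b 0 Z\<bar>)"
    if b: "\<And>\<sigma>. \<bar>b \<sigma>\<bar> \<le> 1" "\<And>\<sigma>. k < weight \<sigma> \<Longrightarrow> b \<sigma> = 0" "\<exists>\<sigma>. \<bar>b \<sigma>\<bar> = 1" for b :: "'n mindex \<Rightarrow> real"
  proof -
    obtain Z\<^sub>0 where Z0: "\<And>c. \<bar>coord Z\<^sub>0 c - coord z c\<bar> < r" "\<delta>' < \<bar>cpoly k b 0 Z\<^sub>0\<bar>"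
      using \<delta>'(2)[OF b] by blast
    have "dbound 0 k 1 1 (cpoly k b 0)"
      unfolding dbound_def using b(1) cderiv_pol_center[of k b _ 0] b(2) by simp
    then have dbound: "dbound W k (B * 1) 1 (cpoly k b 0)" if "pclose (3 * 1) W 0" for W
      unfolding B_def using that smooth_pol[of k b, OF b(2)] cderiv_pol_zero[of k b, OF b(2)] \<open>dbound 0 k 1 1 _\<close>
      by (intro poly_propagation) auto
    have "\<bar>cpoly k b 0 Z - cpoly k b 0 Z\<^sub>0\<bar> \<le> \<delta>' / 2" if Z: "\<And>c. \<bar>coord Z c - coord Z\<^sub>0 c\<bar> \<le> \<eta>" for Z
    proof -
      have "\<bar>cpoly k b 0 Z - cpoly k b 0 Z\<^sub>0\<bar> \<le> (\<Sum>c\<in>UNIV. \<bar>coord Z c - coord Z\<^sub>0 c\<bar> * B)"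
      proof (rule mvt_box)
        fix c :: "'n option"
        show "has_pd c (cpoly k b 0) (cderiv [c] (cpoly k b 0))"
          using smooth_has_pd_itd[OF smooth_pol[of k b 2 0, OF b(2)], of "[]" c] cwt_pos(2)[of c] by simp
        fix W assume W: "\<And>d. \<bar>coord W d - coord Z\<^sub>0 d\<bar> \<le> \<bar>coord Z d - coord Z\<^sub>0 d\<bar>"
        have "pclose (3 * 1) W 0"
          unfolding pclose_def
        proof
          fix d
          have "\<bar>coord W d\<bar> \<le> 3" using W[of d] Z[of d] Z0(1)[of d] z[of d] \<eta>(2) r(2) by linarith
          also have "3 \<le> (3::real) ^ cwt d" using cwt_pos(3)[of d] by (intro self_le_power) auto
          finally show "\<bar>coord W d - coord 0 d\<bar> \<le> (3 * 1) ^ cwt d" by simp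
        qed
        from dbound[OF this] show "\<bar>cderiv [c] (cpoly k b 0) W\<bar> \<le> B"
          using cderiv_pol_zero[of k b, OF b(2), of "[c]" 0 W] B(1)
          by (cases "lwt [c] \<le> k") (auto dest: dboundD[of _ _ _ _ _ "[c]"])
      qed
      also have "\<dots> \<le> (\<Sum>c\<in>(UNIV::'n option set). \<eta> * B)"
        using Z B by (intro sum_mono mult_right_mono) auto
      also have "\<dots> = n * (\<eta> * B)" by (simp add: n_def)
      finally show ?thesis using \<eta>(3) by linarith
    qed
    then have "\<delta>' / 2 \<le> \<bar>cpoly k b 0 Z\<bar>" if "\<forall>c. \<bar>coord Z c - coord Z\<^sub>0 c\<bar> \<le> \<eta>" for Z
      using that Z0(2) \<delta>'(1) by (smt (verit, best) field_sum_of_halves)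
    then show ?thesis using Z0(1) less_imp_le by blast
  qed
  show ?thesis
  proof (rule that[of "\<delta>' / 2" \<eta>])
    fix b :: "'n mindex \<Rightarrow> real" assume b: "\<And>\<sigma>. k < weight \<sigma> \<Longrightarrow> b \<sigma> = 0"
    define m where "m = Max ((\<lambda>\<sigma>. \<bar>b \<sigma>\<bar>) ` {\<sigma>. weight \<sigma> \<le> k})"
    have ne: "(0 :: 'n mindex) \<in> {\<sigma>. weight \<sigma> \<le> k}" by (simp add: weight_expo)
    have fin: "finite ((\<lambda>\<sigma>. \<bar>b \<sigma>\<bar>) ` {\<sigma>. weight \<sigma> \<le> k})" by (intro finite_imageI finite_weight_le)
    have m': "\<bar>b \<sigma>\<bar> \<le> m" if "weight \<sigma> \<le> k" for \<sigma>
      unfolding m_def using that by (intro Max_ge fin) auto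
    have "0 \<le> m" using m'[of 0] ne by force
    then have m: "\<bar>b \<sigma>\<bar> \<le> m" for \<sigma> using m'[of \<sigma>] b[of \<sigma>] by (cases "weight \<sigma> \<le> k") auto
    obtain \<sigma>' where \<sigma>': "\<bar>b \<sigma>'\<bar> = m"
      using Max_in[OF fin] ne unfolding m_def by (metis (no_types, lifting) empty_iff image_iff image_is_empty)
    show "\<exists>Z\<^sub>0. (\<forall>c. \<bar>coord Z\<^sub>0 c - coord z c\<bar> \<le> r) \<and>
        (\<forall>Z. (\<forall>c. \<bar>coord Z c - coord Z\<^sub>0 c\<bar> \<le> \<eta>) \<longrightarrow> (\<forall>\<sigma>. \<delta>' / 2 * \<bar>b \<sigma>\<bar> \<le> \<bar>cpoly k b 0 Z\<bar>))"
    proof (cases "m = 0")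
      case True
      then show ?thesis using m r by (intro exI[of _ z]) auto
    next
      case False
      with \<open>0 \<le> m\<close> have m0: "0 < m" by simp
      define b' where "b' \<sigma> = b \<sigma> / m" for \<sigma>
      have e: "\<bar>cpoly k b' 0 Z\<bar> = \<bar>cpoly k b 0 Z\<bar> / m" for Z
        using m0 by (simp add: cpoly_def b'_def sum_divide_distrib[symmetric])
      obtain Z\<^sub>0 where Z0: "\<forall>c. \<bar>coord Z\<^sub>0 c - coord z c\<bar> \<le> r"
        "\<And>Z. (\<forall>c. \<bar>coord Z c - coord Z\<^sub>0 c\<bar> \<le> \<eta>) \<Longrightarrow> \<delta>' / 2 \<le> \<bar>cpoly k b' 0 Z\<bar>"
      proof -
        have "\<bar>b' \<sigma>\<bar> \<le> 1" for \<sigma> using m[of \<sigma>] m0 by (simp add: b'_def)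
        moreover have "\<bar>b' \<sigma>'\<bar> = 1" using \<sigma>' m0 by (simp add: b'_def)
        moreover have "b' \<sigma> = 0" if "k < weight \<sigma>" for \<sigma> using b[OF that] by (simp add: b'_def)
        ultimately show ?thesis using normalised[of b'] that by blast
      qed
      have "\<delta>' / 2 * \<bar>b \<sigma>\<bar> \<le> \<bar>cpoly k b 0 Z\<bar>" if "\<forall>c. \<bar>coord Z c - coord Z\<^sub>0 c\<bar> \<le> \<eta>" for Z \<sigma>
      proof -
        have "\<delta>' / 2 * \<bar>b \<sigma>\<bar> \<le> \<delta>' / 2 * m" using m[of \<sigma>] \<delta>' by (intro mult_left_mono) auto
        also have "\<dots> \<le> \<bar>cpoly k b 0 Z\<bar>" using Z0(2)[OF that] m0 unfolding e by (simp add: field_simps)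
        finally show ?thesis .
      qed
      then show ?thesis using Z0(1) by blast
    qed
  qed (use \<delta>' \<eta> in auto)
qed

section \<open>Mean norms control mean integrals\<close>

lemma epowr_measurable [measurable]:
  assumes [measurable]: "h \<in> borel_measurable M"
  shows "(\<lambda>x. epowr (h x) a) \<in> borel_measurable M"
  unfolding epowr_def by measurable

lemma epowr_mono:
  assumes "x \<le> y" "0 \<le> a"
  shows "epowr x a \<le> epowr y a"
proof (cases "y = \<infinity>")
  case False
  then have y: "y < top" by (simp add: less_top)
  then have "x < top" using assms(1) by (rule le_less_trans[rotated])
  moreover have "enn2real x \<le> enn2real y" using assms(1) y by (rule enn2real_mono)
  ultimately show ?thesis using assms y by (auto simp: epowr_def intro!: ennreal_leI powr_mono2)
qed (simp add: epowr_def)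

lemma epowr_le_imp_le:
  assumes "epowr I (1 / a) \<le> ennreal u" "0 < a" "0 \<le> u"
  shows "I \<le> ennreal (u powr a)"
proof (cases I)
  case (real v)
  then have "v powr (1 / a) \<le> u" using assms by (simp add: epowr_def)
  then have "(v powr (1 / a)) powr a \<le> u powr a" using assms by (intro powr_mono2) auto
  then show ?thesis using real assms by (simp add: powr_powr ennreal_leI)
next
  case top
  then show ?thesis using assms by (simp add: epowr_def top_unique)
qed

text \<open>Below \<open>u\<close> the first summand suffices; above it, \<open>h / u\<close> is at
  least 1 and so does not exceed its power with exponent \<open>a\<close>.\<close>

lemma le_one_plus_epowr:
  assumes "1 \<le> a" "0 < u"
  shows "h \<le> ennreal u + ennreal (u / u powr a) * epowr h a"
proof (cases h)
  case (real v)
  have "v \<le> u + u / u powr a * v powr a"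
  proof (cases "v \<le> u")
    case True
    then show ?thesis using assms by (simp add: add_increasing2)
  next
    case False
    then have "1 \<le> v / u" using assms by simp
    then have "v / u \<le> (v / u) powr a" using assms powr_mono[of 1 a "v / u"] by simp
    then have "v / u \<le> v powr a / u powr a" using assms real by (simp add: powr_divide)
    then have "v \<le> u / u powr a * v powr a" using assms by (simp add: field_simps)
    then show ?thesis using assms by simp
  qed
  then have "ennreal v \<le> ennreal (u + u / u powr a * v powr a)" by (rule ennreal_leI)
  also have "\<dots> = ennreal u + ennreal (u / u powr a) * ennreal (v powr a)"
    using assms by (subst ennreal_plus) (auto simp: ennreal_mult[symmetric])
  finally show ?thesis using real by (simp add: epowr_def)
next
  case top
  have "0 < u / u powr a" using assms by simp
  then show ?thesis using top assms(2) by (simp add: epowr_def ennreal_mult_top)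
qed

text \<open>The crude factor 2 (instead of Jensen's 1) comes from \<open>x \<le> 1 + x\<^sup>p\<close>. Only \<open>h'\<close> is assumed
  to be measurable; \<open>h\<close> will be a norm of slices.\<close>

lemma nn_integral_le_lp_norm:
  assumes [measurable]: "h' \<in> borel_measurable M"
    and le: "AE x in M. h' x \<le> h x" and M: "emeasure M (space M) \<le> 1" and p: "1 \<le> p"
  shows "(\<integral>\<^sup>+ x. h' x \<partial>M) \<le> 2 * lp_norm p M h"
proof (cases "p = \<infinity>")
  case True
  have "AE x in M. h' x \<le> lp_norm p M h"
    using le esssup_AE[of h M] True by (auto simp: lp_norm_def)
  then have "(\<integral>\<^sup>+ x. h' x \<partial>M) \<le> (\<integral>\<^sup>+ x. lp_norm p M h \<partial>M)" by (rule nn_integral_mono_AE)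
  also have "\<dots> \<le> lp_norm p M h * 1" using mult_left_mono[OF M, of "lp_norm p M h"] by simp
  also have "\<dots> \<le> 2 * lp_norm p M h" by (simp add: mult_2 add_increasing)
  finally show ?thesis .
next
  case False
  define a where "a = enn2real p"
  have pt: "p < top" using False by (simp add: less_top)
  have a: "1 \<le> a" unfolding a_def using enn2real_mono[OF p pt] by simp
  have lp: "lp_norm p M h = epowr (\<integral>\<^sup>+ x. epowr (h x) a \<partial>M) (1 / a)"
    using False by (simp add: lp_norm_def a_def)
  show ?thesis
  proof (cases "lp_norm p M h")
    case (real n)
    \<comment> \<open>A scale \<open>u\<close> strictly above the norm \<open>n\<close> is used
      because \<open>n\<close> may be 0; \<open>u\<close> then tends to \<open>n\<close>.\<close>
    have "(\<integral>\<^sup>+ x. h' x \<partial>M) \<le> 2 * ennreal u" if u: "n < u" for u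
    proof -
      have u0: "0 < u" using u real by linarith
      have "epowr (\<integral>\<^sup>+ x. epowr (h x) a \<partial>M) (1 / a) \<le> ennreal u"
        using lp real u by (metis ennreal_leI less_imp_le)
      then have I: "(\<integral>\<^sup>+ x. epowr (h x) a \<partial>M) \<le> ennreal (u powr a)"
        using a u0 by (intro epowr_le_imp_le) auto
      have "(\<integral>\<^sup>+ x. epowr (h' x) a \<partial>M) \<le> (\<integral>\<^sup>+ x. epowr (h x) a \<partial>M)"
        using le a by (intro nn_integral_mono_AE) (auto elim!: eventually_mono intro!: epowr_mono)
      then have I': "(\<integral>\<^sup>+ x. epowr (h' x) a \<partial>M) \<le> ennreal (u powr a)" using I by simp
      have "(\<integral>\<^sup>+ x. h' x \<partial>M) \<le> (\<integral>\<^sup>+ x. ennreal u + ennreal (u / u powr a) * epowr (h' x) a \<partial>M)"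
        using a u0 by (intro nn_integral_mono le_one_plus_epowr)
      also have "\<dots> = ennreal u * emeasure M (space M) + ennreal (u / u powr a) * (\<integral>\<^sup>+ x. epowr (h' x) a \<partial>M)"
        by (simp add: nn_integral_add nn_integral_cmult)
      also have "\<dots> \<le> ennreal u * 1 + ennreal (u / u powr a) * ennreal (u powr a)"
        using M I' by (intro add_mono mult_left_mono) auto
      also have "\<dots> = 2 * ennreal u"
        using u0 by (simp add: ennreal_mult[symmetric] mult_2)
      finally show ?thesis .
    qed
    note main = this
    have "(\<integral>\<^sup>+ x. h' x \<partial>M) \<le> 2 * ennreal n"
    proof (rule ennreal_le_epsilon)
      fix e :: real assume e: "0 < e"
      have "(\<integral>\<^sup>+ x. h' x \<partial>M) \<le> 2 * ennreal (n + e / 2)" using main[of "n + e / 2"] e by simp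
      also have "\<dots> = ennreal (2 * (n + e / 2))"
        using e real by (subst ennreal_mult) auto
      also have "\<dots> = 2 * ennreal n + ennreal e"
        using e real by (simp add: distrib_left ennreal_plus ennreal_mult)
      finally show "(\<integral>\<^sup>+ x. h' x \<partial>M) \<le> 2 * ennreal n + ennreal e" .
    qed
    then show ?thesis using real by simp
  qed (simp add: ennreal_mult_top)
qed

lemma measurable_mean_measure:
  assumes "h \<in> borel_measurable borel"
  shows "h \<in> borel_measurable (mean_measure A)"
proof -
  have "h \<in> borel_measurable lebesgue" using measurable_completion[of h lborel borel] assms by simp
  then have "h \<in> borel_measurable (lebesgue_on A)" by (rule measurable_restrict_space1)
  then show ?thesis by (simp add: mean_measure_def cong: measurable_cong_sets)
qed

lemma nn_integral_mean_measure:
  assumes [measurable]: "A \<in> sets lborel" "h \<in> borel_measurable borel"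
    and A: "emeasure lborel A = ennreal v" "0 < v"
  shows "(\<integral>\<^sup>+ x. h x \<partial>mean_measure A) = ennreal (1 / v) * (\<integral>\<^sup>+ x. h x * indicator A x \<partial>lborel)"
proof -
  have Al: "A \<in> sets lebesgue" using assms(1) by simp
  have h: "h \<in> borel_measurable lebesgue" using measurable_completion[of h lborel borel] by simp
  have "1 / emeasure lebesgue A = ennreal (1 / v)"
    using A assms(1) divide_ennreal[of 1 v] by simp
  then have "(\<integral>\<^sup>+ x. h x \<partial>mean_measure A) = ennreal (1 / v) * (\<integral>\<^sup>+ x. h x \<partial>lebesgue_on A)"
    unfolding mean_measure_def
    by (subst nn_integral_scale_measure) (auto intro!: measurable_restrict_space1 h)
  also have "(\<integral>\<^sup>+ x. h x \<partial>lebesgue_on A) = (\<integral>\<^sup>+ x. h x * indicator A x \<partial>lborel)"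
    using Al by (simp add: nn_integral_restrict_space nn_integral_completion)
  finally show ?thesis .
qed

lemma mean_measure_AE:
  assumes "A \<in> sets lborel" "AE x in lborel. x \<in> A \<longrightarrow> P x"
  shows "AE x in mean_measure A. P x"
proof -
  have Al: "A \<in> sets lebesgue" using assms(1) by simp
  have "AE x in lebesgue. x \<in> A \<longrightarrow> P x" using assms(2) by (rule AE_completion)
  then have "AE x in lebesgue_on A. P x" using Al by (simp add: AE_restrict_space_iff)
  then obtain N where N: "{x \<in> space (lebesgue_on A). \<not> P x} \<subseteq> N" "emeasure (lebesgue_on A) N = 0"
    "N \<in> sets (lebesgue_on A)"
    by (rule AE_E)
  show ?thesis
    by (rule AE_I[of _ _ N]) (use N in \<open>auto simp: mean_measure_def space_scale_measure\<close>)
qed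

lemma emeasure_mean_measure_space:
  assumes "A \<in> sets lborel" "emeasure lborel A = ennreal v" "0 < v"
  shows "emeasure (mean_measure A) (space (mean_measure A)) = 1"
proof -
  have "A \<in> sets lebesgue" using assms(1) by simp
  then have "emeasure (mean_measure A) (space (mean_measure A)) = 1 / ennreal v * ennreal v"
    using assms by (simp add: mean_measure_def space_scale_measure space_restrict_space emeasure_restrict_space)
  also have "\<dots> = 1" using assms(3) divide_ennreal[of 1 v]
    by (simp add: ennreal_mult[symmetric])
  finally show ?thesis .
qed

text \<open>Fubini for null sets: the exceptional set is enlarged to a Borel null set, and the order
  of the variables is exchanged so that time comes first.\<close>

lemma AE_lborel_slices:
  assumes "AE X in (lborel :: ('a::euclidean_space \<times> 'b::euclidean_space) measure). P X"
  shows "AE t in lborel. AE x in lborel. P (x, t)"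
proof -
  obtain N where N: "{X \<in> space lborel. \<not> P X} \<subseteq> N" "emeasure lborel N = 0" "N \<in> sets (lborel :: ('a \<times> 'b) measure)"
    using AE_E[OF assms] by blast
  have N': "N \<in> sets (lborel \<Otimes>\<^sub>M lborel)" using N(3) by (simp only: lborel_prod)
  have "AE X in (lborel \<Otimes>\<^sub>M lborel). X \<notin> N"
    unfolding lborel_prod by (rule AE_I[of _ _ N]) (use N in auto)
  then have 1: "AE x in lborel. AE t in lborel. (x, t) \<notin> N" by (rule lborel_pair.AE_pair)
  have "{X \<in> space (lborel \<Otimes>\<^sub>M lborel). (fst X, snd X) \<notin> N} = space (lborel \<Otimes>\<^sub>M lborel) - N"
    by auto
  then have "{X \<in> space (lborel \<Otimes>\<^sub>M lborel). (fst X, snd X) \<notin> N} \<in> sets (lborel \<Otimes>\<^sub>M lborel)"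
    using N' by (metis sets.compl_sets)
  from lborel_pair.AE_commute[OF this] 1 have "AE t in lborel. AE x in lborel. (x, t) \<notin> N" by simp
  then show ?thesis using N(1) by (auto elim!: eventually_mono)
qed

text \<open>The bound for a single Lebesgue norm is applied to almost every time slice and then to
  the resulting function of time, giving \<open>2 * 2 = 4\<close>. The Borel function
  \<open>g'\<close> supplies measurable slices, while the norm keeps the given
  \<open>g\<close>.\<close>

lemma nn_integral_le_mean_norm:
  fixes g g' :: "'a::euclidean_space \<times> 'b::euclidean_space \<Rightarrow> real"
  assumes B: "B \<in> sets lborel" "emeasure lborel B = ennreal v" "0 < v"
    and I: "I \<in> sets lborel" "emeasure lborel I = ennreal w" "0 < w"
    and p: "1 \<le> p" "1 \<le> p'"
    and [measurable]: "g' \<in> borel_measurable borel"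
    and ae: "AE X in lborel. X \<in> B \<times> I \<longrightarrow> g X = g' X"
  shows "(\<integral>\<^sup>+ X. ennreal \<bar>g' X\<bar> * indicator (B \<times> I) X \<partial>lborel) \<le> 4 * mean_norm p p' B I g * ennreal (v * w)"
proof -
  define n where "n t = lp_norm p (mean_measure B) (\<lambda>x. ennreal \<bar>g (x, t)\<bar>)" for t
  define l where "l t = (\<integral>\<^sup>+ x. ennreal \<bar>g' (x, t)\<bar> * indicator B x \<partial>lborel)" for t
  have [measurable]: "B \<in> sets borel" "I \<in> sets borel" using B I by auto
  have gm: "(\<lambda>X. ennreal \<bar>g' X\<bar>) \<in> borel_measurable (borel \<Otimes>\<^sub>M borel)"
    by (simp add: borel_prod)
  have sl: "(\<lambda>x. ennreal \<bar>g' (x, t)\<bar>) \<in> borel_measurable borel" for t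
    by (rule measurable_compose[OF measurable_Pair2' gm]) simp
  have [measurable]: "l \<in> borel_measurable borel"
  proof -
    have "(\<lambda>(t, x). ennreal \<bar>g' (x, t)\<bar> * indicator B x) \<in> borel_measurable (borel \<Otimes>\<^sub>M lborel)"
      using measurable_compose[OF measurable_pair_swap' gm] by (simp add: split_beta')
    from lborel.borel_measurable_nn_integral[OF this] show ?thesis
      by (simp add: l_def[abs_def])
  qed
  \<comment> \<open>The 2 from the slice estimate is moved to the left, so that the outer estimate
    applies to a measurable minorant of the slice norm \<open>n\<close>, whose own measurability is
    not at hand.\<close>
  have inner: "AE t in mean_measure I. ennreal (1 / (2 * v)) * l t \<le> n t"
  proof (rule mean_measure_AE[OF I(1)])
    have "AE t in lborel. AE x in lborel. (x, t) \<in> B \<times> I \<longrightarrow> g (x, t) = g' (x, t)"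
      using AE_lborel_slices[OF ae] by simp
    then show "AE t in lborel. t \<in> I \<longrightarrow> ennreal (1 / (2 * v)) * l t \<le> n t"
    proof eventually_elim
      case (elim t)
      show ?case
      proof
        assume t: "t \<in> I"
        have "AE x in mean_measure B. ennreal \<bar>g' (x, t)\<bar> \<le> ennreal \<bar>g (x, t)\<bar>"
          by (rule mean_measure_AE[OF B(1)]) (use elim t in \<open>auto elim!: eventually_mono\<close>)
        moreover have "(\<lambda>x. ennreal \<bar>g' (x, t)\<bar>) \<in> borel_measurable (mean_measure B)"
          by (rule measurable_mean_measure[OF sl])
        ultimately have "(\<integral>\<^sup>+ x. ennreal \<bar>g' (x, t)\<bar> \<partial>mean_measure B) \<le> 2 * n t"
          unfolding n_def using emeasure_mean_measure_space[OF B] p(1)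
          by (intro nn_integral_le_lp_norm) auto
        then have "ennreal (1 / 2) * (ennreal (1 / v) * l t) \<le> ennreal (1 / 2) * (2 * n t)"
          unfolding l_def nn_integral_mean_measure[OF B(1) sl B(2,3)] by (intro mult_left_mono) auto
        moreover have "ennreal (1 / 2) * 2 = 1"
          using ennreal_mult[of "1/2" 2] by simp
        ultimately show "ennreal (1 / (2 * v)) * l t \<le> n t"
          using B(3) ennreal_mult[of "1 / 2" "1 / v"] by (simp add: mult.assoc[symmetric])
      qed
    qed
  qed
  have "(\<lambda>t. ennreal (1 / (2 * v)) * l t) \<in> borel_measurable (mean_measure I)"
    by (rule measurable_mean_measure) simp
  then have "(\<integral>\<^sup>+ t. ennreal (1 / (2 * v)) * l t \<partial>mean_measure I) \<le> 2 * mean_norm p p' B I g"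
    unfolding mean_norm_def mixed_norm_def n_def[symmetric, abs_def]
    using inner emeasure_mean_measure_space[OF I] p(2) unfolding n_def[abs_def]
    by (intro nn_integral_le_lp_norm) auto
  also have "(\<integral>\<^sup>+ t. ennreal (1 / (2 * v)) * l t \<partial>mean_measure I) =
      ennreal (1 / w) * (ennreal (1 / (2 * v)) * (\<integral>\<^sup>+ t. l t * indicator I t \<partial>lborel))"
    by (subst nn_integral_mean_measure[OF I(1) _ I(2,3)]) (simp_all add: mult.assoc nn_integral_cmult)
  also have "(\<integral>\<^sup>+ t. l t * indicator I t \<partial>lborel) =
      (\<integral>\<^sup>+ t. (\<integral>\<^sup>+ x. ennreal \<bar>g' (x, t)\<bar> * indicator (B \<times> I) (x, t) \<partial>lborel) \<partial>lborel)"
  proof (rule nn_integral_cong)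
    fix t
    have "l t * indicator I t = (\<integral>\<^sup>+ x. ennreal \<bar>g' (x, t)\<bar> * indicator B x * indicator I t \<partial>lborel)"
      unfolding l_def by (rule nn_integral_multc[symmetric]) (use sl in simp)
    then show "l t * indicator I t = (\<integral>\<^sup>+ x. ennreal \<bar>g' (x, t)\<bar> * indicator (B \<times> I) (x, t) \<partial>lborel)"
      by (simp add: indicator_times mult.assoc)
  qed
  also have "\<dots> = (\<integral>\<^sup>+ X. ennreal \<bar>g' X\<bar> * indicator (B \<times> I) X \<partial>(lborel \<Otimes>\<^sub>M lborel))"
    by (rule lborel_pair.nn_integral_snd) (use gm in simp)
  also have "\<dots> = (\<integral>\<^sup>+ X. ennreal \<bar>g' X\<bar> * indicator (B \<times> I) X \<partial>lborel)"
    by (simp only: lborel_prod)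
  finally have "ennreal (1 / w) * (ennreal (1 / (2 * v)) *
      (\<integral>\<^sup>+ X. ennreal \<bar>g' X\<bar> * indicator (B \<times> I) X \<partial>lborel)) \<le> 2 * mean_norm p p' B I g" (is "_ * (_ * ?J) \<le> 2 * ?m") .
  then have "ennreal (2 * v * w) * (ennreal (1 / w) * (ennreal (1 / (2 * v)) * ?J)) \<le> ennreal (2 * v * w) * (2 * ?m)"
    by (rule mult_left_mono) simp
  moreover have "ennreal (2 * v * w) * (ennreal (1 / w) * (ennreal (1 / (2 * v)) * ?J)) = ?J"
  proof -
    have "ennreal (2 * v * w) * (ennreal (1 / w) * ennreal (1 / (2 * v))) = 1"
      using B(3) I(3) by (simp add: ennreal_mult[symmetric])
    then show ?thesis by (simp add: mult.assoc[symmetric])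
  qed
  moreover have "ennreal (2 * v * w) * (2 * ?m) = 4 * ?m * ennreal (v * w)"
  proof -
    have "ennreal (2 * v * w) = 2 * ennreal (v * w)"
      using B(3) I(3) ennreal_mult[of 2 "v * w"] by (simp add: mult.assoc)
    moreover have "2 * ennreal (v * w) * (2 * ?m) = (2 * 2) * ?m * ennreal (v * w)" by (simp only: ac_simps)
    ultimately show ?thesis by simp
  qed
  ultimately show ?thesis by simp
qed

section \<open>Compatibility of the approximating polynomials\<close>

lemma emeasure_lborel_coord_box:
  fixes m :: "'n::finite option \<Rightarrow> real"
  assumes h: "\<And>c. 0 \<le> h c"
  shows "emeasure lborel {Z. \<forall>c. \<bar>coord Z c - m c\<bar> \<le> h c} = ennreal (\<Prod>c\<in>UNIV. 2 * h c)"
    "{Z. \<forall>c. \<bar>coord Z c - m c\<bar> \<le> h c} \<in> sets lborel"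
proof -
  let ?B = "cbox (\<chi> i. m (Some i) - h (Some i)) (\<chi> i. m (Some i) + h (Some i)) :: (real^'n) set"
  let ?I = "{m None - h None..m None + h None}"
  have e: "{Z. \<forall>c. \<bar>coord Z c - m c\<bar> \<le> h c} = ?B \<times> ?I"
    by (auto simp: mem_box_cart coord_def abs_le_iff split_option_all algebra_simps)
  have b: "emeasure lborel ?B = ennreal (\<Prod>i\<in>UNIV. 2 * h (Some i))"
  proof -
    have "(\<chi> i. m (Some i)) \<in> ?B" using h by (simp add: mem_box_cart)
    then have "?B \<noteq> {}" by blast
    then have "measure lborel ?B = (\<Prod>i\<in>UNIV. 2 * h (Some i))"
      by (subst content_cbox_cart) (auto intro!: prod.cong)
    moreover have "emeasure lborel ?B = ennreal (measure lborel ?B)"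
      by (rule emeasure_eq_ennreal_measure)
         (use emeasure_lborel_cbox_finite in \<open>simp add: less_top infinity_ennreal_def\<close>)
    ultimately show ?thesis by simp
  qed
  have "emeasure lborel (?B \<times> ?I) = emeasure (lborel \<Otimes>\<^sub>M lborel) (?B \<times> ?I)" by (simp only: lborel_prod)
  also have "\<dots> = emeasure lborel ?B * emeasure lborel ?I"
    by (rule lborel.emeasure_pair_measure_Times) auto
  also have "\<dots> = ennreal (\<Prod>i\<in>UNIV. 2 * h (Some i)) * ennreal (2 * h None)"
    using h by (simp add: b)
  also have "\<dots> = ennreal (\<Prod>c\<in>UNIV. 2 * h c)"
    using h by (simp add: prod_UNIV_option ennreal_mult prod_nonneg)
  finally show "emeasure lborel {Z. \<forall>c. \<bar>coord Z c - m c\<bar> \<le> h c} = ennreal (\<Prod>c\<in>UNIV. 2 * h c)"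
    by (simp add: e)
  show "{Z. \<forall>c. \<bar>coord Z c - m c\<bar> \<le> h c} \<in> sets lborel"
    unfolding e sets_lborel by (intro borel_Times) auto
qed

text \<open>The exponent is the homogeneous dimension, in which time counts twice.\<close>

lemma prod_cwt_power: "(\<Prod>c\<in>(UNIV::'n::finite option set). x ^ cwt c) = (x::real) ^ (CARD('n) + 2)"
  by (simp add: prod_UNIV_option cwt_def power_add power2_eq_square)

lemma abs_coord_le_norm: "\<bar>coord X (Some i)\<bar> \<le> norm (fst X)"
  by (simp add: coord_def component_le_norm_cart)

lemma norm_fst_le_coords:
  fixes X :: "'n::finite pt"
  assumes "\<And>i. \<bar>coord X (Some i)\<bar> \<le> r"
  shows "norm (fst X) \<le> real CARD('n) * r"
proof -
  have "norm (fst X) \<le> (\<Sum>i\<in>UNIV. \<bar>fst X $ i\<bar>)" by (rule norm_le_l1_cart)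
  also have "\<dots> \<le> (\<Sum>i\<in>(UNIV::'n set). r)" using assms by (intro sum_mono) (simp add: coord_def)
  finally show ?thesis by simp
qed

lemma ball_measure:
  fixes x :: "real^'n::finite"
  assumes "0 < r"
  obtains v where "emeasure lborel (ball x r) = ennreal v" "0 < v" "v \<le> (2 * r) ^ CARD('n)"
proof -
  define v where "v = measure lborel (ball x r)"
  have e: "emeasure lborel (ball x r) = ennreal v"
    unfolding v_def by (rule emeasure_eq_ennreal_measure) (use emeasure_lborel_ball_finite[of x r] in auto)
  have "0 < v" unfolding v_def using content_ball_pos[OF assms, of x] by simp
  moreover have "v \<le> (2 * r) ^ CARD('n)"
  proof -
    let ?B = "cbox (\<chi> i. x $ i - r) (\<chi> i. x $ i + r)"
    have "ball x r \<subseteq> ?B"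
    proof
      fix y assume "y \<in> ball x r"
      then have "\<bar>(y - x) $ i\<bar> < r" for i
        using component_le_norm_cart[of "y - x" i] by (simp add: dist_norm norm_minus_commute)
      then show "y \<in> ?B" by (simp add: mem_box_cart abs_less_iff) (smt (verit))
    qed
    then have "v \<le> measure lborel ?B"
      unfolding v_def by (intro measure_mono_fmeasurable) (auto simp: fmeasurable_cbox)
    also have "\<dots> = (2 * r) ^ CARD('n)"
    proof -
      have "x \<in> ?B" using assms by (simp add: mem_box_cart)
      then have "?B \<noteq> {}" by blast
      then show ?thesis by (subst content_cbox_cart) auto
    qed
    finally show ?thesis .
  qed
  ultimately show ?thesis using that e by blast
qed

lemma cyl_time_measure: "0 < r \<Longrightarrow> emeasure lborel (cyl_time X r) = ennreal (r\<^sup>2)"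
  by (simp add: cyl_time_def)

lemma sets_cyl: "cyl X r \<in> sets borel"
  unfolding cyl_def cyl_time_def by (intro borel_Times) auto

text \<open>The parabolic dilation, under which monomials are homogeneous of degree
  \<open>weight\<close>.\<close>

definition pscale :: "real \<Rightarrow> 'n::finite pt \<Rightarrow> 'n pt" where
  "pscale \<rho> Z = pt_of (\<lambda>c. \<rho> ^ cwt c * coord Z c)"

lemma coord_pscale [simp]: "coord (pscale \<rho> Z) c = \<rho> ^ cwt c * coord Z c"
  by (simp add: pscale_def)

lemma nmon_pscale: "nmon \<sigma> (pscale \<rho> Z) = \<rho> ^ weight \<sigma> * nmon \<sigma> Z"
proof -
  have "nmon \<sigma> (pscale \<rho> Z) = (\<Prod>c\<in>UNIV. \<rho> ^ (cwt c * expo \<sigma> c) * (coord Z c ^ expo \<sigma> c / fact (expo \<sigma> c)))"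
    unfolding nmon_def by (intro prod.cong) (auto simp: power_mult_distrib power_mult)
  then show ?thesis by (simp only: prod.distrib power_sum[symmetric] weight_expo nmon_def)
qed

lemma cpoly_pscale: "cpoly k b X (X + pscale \<rho> Z) = cpoly k (\<lambda>\<sigma>. \<rho> ^ weight \<sigma> * b \<sigma>) 0 Z"
  by (simp add: cpoly_def nmon_pscale ac_simps)

text \<open>On the smaller cylinder the two given integrals bound that of the difference. After
  dilation to unit size, the difference dominates a multiple of each coefficient on a box of fixed
  volume, and coefficients about \<open>X\<close> are derivatives at \<open>X\<close>.\<close>

lemma poly_diff_bound_from_integrals:
  obtains C where "0 < C"
    "\<And>(f' :: 'n::finite pt \<Rightarrow> real) P\<^sub>1 P\<^sub>2 X Y \<rho> A N.
      f' \<in> borel_measurable borel \<Longrightarrow> P\<^sub>1 \<in> par_polys k \<Longrightarrow> P\<^sub>2 \<in> par_polys k \<Longrightarrow> 0 < \<rho> \<Longrightarrow> 0 \<le> A \<Longrightarrow>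
      pclose \<rho> X Y \<Longrightarrow> snd X \<le> snd Y \<Longrightarrow>
      (\<integral>\<^sup>+ Z. ennreal \<bar>f' Z - P\<^sub>1 Z\<bar> * indicator (cyl X \<rho>) Z \<partial>lborel) \<le> ennreal (A * \<rho> ^ (CARD('n) + 2)) \<Longrightarrow>
      (\<integral>\<^sup>+ Z. ennreal \<bar>f' Z - P\<^sub>2 Z\<bar> * indicator (cyl Y (real CARD('n option) * \<rho>)) Z \<partial>lborel)
        \<le> ennreal (A * \<rho> ^ (CARD('n) + 2)) \<Longrightarrow>
      dbound X N (C * A) \<rho> (\<lambda>Z. P\<^sub>1 Z - P\<^sub>2 Z)"
proof -
  define n where "n = real CARD('n option)"
  have n2: "real CARD('n) + 1 = n" "2 \<le> n"
    using zero_less_card_finite[where 'a = 'n] by (simp_all add: n_def del: zero_less_card_finite)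
  \<comment> \<open>The centre of the unit cylinder, which extends backwards in time.\<close>
  define z :: "'n pt" where "z = pt_of (\<lambda>c. if c = None then -1/2 else 0)"
  \<comment> \<open>Points within \<open>2 * r\<close> of \<open>z\<close> in each coordinate then
    stay in the unit cylinder: the spatial norm is below \<open>2 * n * r = 1/2\<close>, and time
    stays between -3/4 and -1/4.\<close>
  define r where "r = 1 / (4 * n)"
  have r: "0 < r" "r \<le> 1/8" "n * r = 1/4" using n2 by (auto simp: r_def field_simps)
  obtain \<delta> \<eta> where de: "0 < \<delta>" "0 < \<eta>" "\<eta> \<le> r"
    "\<And>b. (\<And>\<sigma>. k < weight \<sigma> \<Longrightarrow> b \<sigma> = 0) \<Longrightarrow>
      \<exists>Z\<^sub>0. (\<forall>c. \<bar>coord Z\<^sub>0 c - coord z c\<bar> \<le> r) \<and>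
        (\<forall>Z. (\<forall>c. \<bar>coord Z c - coord Z\<^sub>0 c\<bar> \<le> \<eta>) \<longrightarrow> (\<forall>\<sigma>. \<delta> * \<bar>b \<sigma>\<bar> \<le> \<bar>cpoly k b 0 Z\<bar>))"
  proof (rule poly_box_lower_bound[of r z k])
    show "\<bar>coord z c\<bar> \<le> 1" for c by (simp add: z_def)
  qed (use r that in auto)
  define w where "w = (2 * \<eta>) ^ CARD('n option)"
  have w: "0 < w" using de by (simp add: w_def)
  show ?thesis
  \<comment> \<open>2 counts the two integrals; \<open>w\<close> is the volume of the lower-bound
    box at unit scale.\<close>
  proof (rule that[of "2 / (\<delta> * w)"])
    show "0 < 2 / (\<delta> * w)" using de w by simp
    fix f' :: "'n pt \<Rightarrow> real" and P\<^sub>1 P\<^sub>2 X Y \<rho> A N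
    assume [measurable]: "f' \<in> borel_measurable borel" and P: "P\<^sub>1 \<in> par_polys k" "P\<^sub>2 \<in> par_polys k"
      and \<rho>: "0 < \<rho>" and A: "0 \<le> A" and cl: "pclose \<rho> X Y" and tXY: "snd X \<le> snd Y"
      and I1: "(\<integral>\<^sup>+ Z. ennreal \<bar>f' Z - P\<^sub>1 Z\<bar> * indicator (cyl X \<rho>) Z \<partial>lborel) \<le> ennreal (A * \<rho> ^ (CARD('n) + 2))"
      and I2: "(\<integral>\<^sup>+ Z. ennreal \<bar>f' Z - P\<^sub>2 Z\<bar> * indicator (cyl Y (real CARD('n option) * \<rho>)) Z \<partial>lborel)
        \<le> ennreal (A * \<rho> ^ (CARD('n) + 2))"
    obtain a1 where a1: "\<And>\<sigma>. k < weight \<sigma> \<Longrightarrow> a1 \<sigma> = 0" "P\<^sub>1 = cpoly k a1 X"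
      using par_polysE[OF P(1)] by blast
    obtain a2 where a2: "\<And>\<sigma>. k < weight \<sigma> \<Longrightarrow> a2 \<sigma> = 0" "P\<^sub>2 = cpoly k a2 X"
      using par_polysE[OF P(2)] by blast
    define b where "b \<sigma> = a1 \<sigma> - a2 \<sigma>" for \<sigma>
    have b: "b \<sigma> = 0" if "k < weight \<sigma>" for \<sigma> using that a1 a2 by (simp add: b_def)
    have q: "(\<lambda>Z. P\<^sub>1 Z - P\<^sub>2 Z) = cpoly k b X"
      by (intro ext) (simp add: a1 a2 cpoly_def b_def sum_subtractf left_diff_distrib)
    have [measurable]: "P\<^sub>1 \<in> borel_measurable borel" "P\<^sub>2 \<in> borel_measurable borel"
      unfolding a1(2) a2(2) by (rule borel_measurable_continuous_onI, rule continuous_on_cpoly)+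
    have [measurable]: "cyl X r \<in> sets borel" for X :: "'n pt" and r by (rule sets_cyl)
    \<comment> \<open>In space \<open>n * \<rho>\<close> covers the displacement
      \<open>CARD('n) * \<rho>\<close> plus the radius \<rho>; in time \<open>n \<ge> 2\<close>
      covers both depths. The tops are ordered because \<open>X\<close> is not later than
      \<open>Y\<close>.\<close>
    have "cyl X \<rho> \<subseteq> cyl Y (n * \<rho>)"
    proof
      fix Z assume Z: "Z \<in> cyl X \<rho>"
      have "norm (fst (X - Y)) \<le> real CARD('n) * \<rho>"
        by (rule norm_fst_le_coords) (use cl in \<open>auto simp: pclose_def cwt_def split: option.splits\<close>)
      moreover have "dist (fst X) (fst Z) < \<rho>" using Z by (auto simp: cyl_def)
      ultimately have "dist (fst Y) (fst Z) < n * \<rho>"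
        using dist_triangle[of "fst Y" "fst Z" "fst X"] n2(1)
        by (simp add: dist_norm norm_minus_commute distrib_right flip: n2(1))
      moreover have "snd Y - (n * \<rho>)\<^sup>2 < snd Z"
      proof -
        have "snd Y - snd X \<le> \<rho>\<^sup>2"
          using cl[unfolded pclose_def, rule_format, of None] by (simp add: coord_def cwt_def)
        moreover have "snd X - \<rho>\<^sup>2 < snd Z" using Z by (auto simp: cyl_def cyl_time_def)
        moreover have "2 * \<rho>\<^sup>2 \<le> (n * \<rho>)\<^sup>2"
          using n2 power_mono[of 2 n 2] mult_right_mono[of 2 "n\<^sup>2" "\<rho>\<^sup>2"] by (simp add: power_mult_distrib)
        ultimately show ?thesis by linarith
      qed
      moreover have "snd Z \<le> snd Y" using Z tXY by (auto simp: cyl_def cyl_time_def)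
      ultimately show "Z \<in> cyl Y (n * \<rho>)" by (cases Z) (auto simp: cyl_def cyl_time_def)
    qed
    then have ind: "indicator (cyl X \<rho>) Z \<le> (indicator (cyl Y (n * \<rho>)) Z :: ennreal)" for Z
      by (auto simp: indicator_def)
    let ?q = "cpoly k b X"
    have "(\<integral>\<^sup>+ Z. ennreal \<bar>?q Z\<bar> * indicator (cyl X \<rho>) Z \<partial>lborel)
        \<le> (\<integral>\<^sup>+ Z. ennreal \<bar>f' Z - P\<^sub>1 Z\<bar> * indicator (cyl X \<rho>) Z + ennreal \<bar>f' Z - P\<^sub>2 Z\<bar> * indicator (cyl Y (n * \<rho>)) Z \<partial>lborel)"
    proof (rule nn_integral_mono)
      fix Z
      have "\<bar>?q Z\<bar> \<le> \<bar>f' Z - P\<^sub>1 Z\<bar> + \<bar>f' Z - P\<^sub>2 Z\<bar>" using fun_cong[OF q, of Z] by linarith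
      then have "ennreal \<bar>?q Z\<bar> \<le> ennreal (\<bar>f' Z - P\<^sub>1 Z\<bar> + \<bar>f' Z - P\<^sub>2 Z\<bar>)"
        by (rule ennreal_leI)
      also have "\<dots> = ennreal \<bar>f' Z - P\<^sub>1 Z\<bar> + ennreal \<bar>f' Z - P\<^sub>2 Z\<bar>"
        by (rule ennreal_plus) auto
      finally have "ennreal \<bar>?q Z\<bar> \<le> ennreal \<bar>f' Z - P\<^sub>1 Z\<bar> + ennreal \<bar>f' Z - P\<^sub>2 Z\<bar>" .
      then have "ennreal \<bar>?q Z\<bar> * indicator (cyl X \<rho>) Z \<le>
          (ennreal \<bar>f' Z - P\<^sub>1 Z\<bar> + ennreal \<bar>f' Z - P\<^sub>2 Z\<bar>) * indicator (cyl X \<rho>) Z"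
        by (rule mult_right_mono) simp
      also have "\<dots> \<le> ennreal \<bar>f' Z - P\<^sub>1 Z\<bar> * indicator (cyl X \<rho>) Z + ennreal \<bar>f' Z - P\<^sub>2 Z\<bar> * indicator (cyl Y (n * \<rho>)) Z"
        unfolding distrib_right by (intro add_left_mono mult_left_mono ind) simp
      finally show "ennreal \<bar>?q Z\<bar> * indicator (cyl X \<rho>) Z \<le> \<dots>" .
    qed
    also have "\<dots> = (\<integral>\<^sup>+ Z. ennreal \<bar>f' Z - P\<^sub>1 Z\<bar> * indicator (cyl X \<rho>) Z \<partial>lborel)
        + (\<integral>\<^sup>+ Z. ennreal \<bar>f' Z - P\<^sub>2 Z\<bar> * indicator (cyl Y (n * \<rho>)) Z \<partial>lborel)"
      by (rule nn_integral_add) auto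
    also have "\<dots> \<le> ennreal (A * \<rho> ^ (CARD('n) + 2)) + ennreal (A * \<rho> ^ (CARD('n) + 2))"
      unfolding n_def by (intro add_mono I1 I2)
    also have "\<dots> = ennreal (2 * A * \<rho> ^ (CARD('n) + 2))"
      using A \<rho> by (subst ennreal_plus[symmetric]) auto
    finally have upper: "(\<integral>\<^sup>+ Z. ennreal \<bar>?q Z\<bar> * indicator (cyl X \<rho>) Z \<partial>lborel) \<le> ennreal (2 * A * \<rho> ^ (CARD('n) + 2))" .
    have coeff: "\<bar>b \<sigma>\<bar> \<le> 2 / (\<delta> * w) * A / \<rho> ^ weight \<sigma>" for \<sigma>
    proof -
      define b' where "b' \<sigma> = \<rho> ^ weight \<sigma> * b \<sigma>" for \<sigma>
      have b'0: "b' \<sigma> = 0" if "k < weight \<sigma>" for \<sigma> using b[OF that] by (simp add: b'_def)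
      obtain Z\<^sub>0 where Z0: "\<And>c. \<bar>coord Z\<^sub>0 c - coord z c\<bar> \<le> r"
        "\<And>Z \<sigma>. (\<And>c. \<bar>coord Z c - coord Z\<^sub>0 c\<bar> \<le> \<eta>) \<Longrightarrow> \<delta> * \<bar>b' \<sigma>\<bar> \<le> \<bar>cpoly k b' 0 Z\<bar>"
        using de(4)[of b', OF b'0] by blast
      define W where "W = {Z. \<forall>c. \<bar>coord Z c - (coord X c + \<rho> ^ cwt c * coord Z\<^sub>0 c)\<bar> \<le> \<eta> * \<rho> ^ cwt c}"
      have W: "emeasure lborel W = ennreal (w * \<rho> ^ (CARD('n) + 2))" "W \<in> sets lborel"
      proof -
        have h: "0 \<le> \<eta> * \<rho> ^ cwt c" for c :: "'n option" using de(2) \<rho> by simp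
        have "(\<Prod>c\<in>(UNIV :: 'n option set). 2 * (\<eta> * \<rho> ^ cwt c)) = w * \<rho> ^ (CARD('n) + 2)"
          by (simp only: w_def mult.assoc[symmetric] prod.distrib prod_cwt_power prod_constant power_mult_distrib)
        then show "emeasure lborel W = ennreal (w * \<rho> ^ (CARD('n) + 2))"
          unfolding W_def emeasure_lborel_coord_box(1)[OF h] by (simp only:)
        show "W \<in> sets lborel" unfolding W_def by (rule emeasure_lborel_coord_box(2)[OF h])
      qed
      have inW: "\<delta> * \<bar>b' \<sigma>\<bar> \<le> \<bar>?q Z\<bar>" "Z \<in> cyl X \<rho>" if Z: "Z \<in> W" for Z
      proof -
        define Z' where "Z' = pt_of (\<lambda>c. (coord Z c - coord X c) / \<rho> ^ cwt c)"
        have ZZ: "Z = X + pscale \<rho> Z'" by (rule pt_eqI) (use \<rho> in \<open>simp add: Z'_def\<close>)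
        have Z': "\<bar>coord Z' c - coord Z\<^sub>0 c\<bar> \<le> \<eta>" for c
        proof -
          have "\<rho> ^ cwt c * \<bar>coord Z' c - coord Z\<^sub>0 c\<bar> = \<bar>\<rho> ^ cwt c * (coord Z' c - coord Z\<^sub>0 c)\<bar>"
            using \<rho> by (simp add: abs_mult)
          also have "\<dots> \<le> \<rho> ^ cwt c * \<eta>" using Z[unfolded W_def ZZ] by (simp add: algebra_simps)
          finally show ?thesis using \<rho> by simp
        qed
        show "\<delta> * \<bar>b' \<sigma>\<bar> \<le> \<bar>?q Z\<bar>"
          using Z0(2)[OF Z'] unfolding ZZ cpoly_pscale b'_def .
        have d: "\<bar>coord Z' c - coord z c\<bar> \<le> 2 * r" for c using Z'[of c] Z0(1)[of c] de(3) by linarith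
        have "norm (fst Z') \<le> real CARD('n) * (2 * r)"
        proof (rule norm_fst_le_coords)
          show "\<bar>coord Z' (Some i)\<bar> \<le> 2 * r" for i using d[of "Some i"] by (simp add: z_def)
        qed
        also have "\<dots> < n * (2 * r)" using n2 r by (intro mult_strict_right_mono) auto
        also have "\<dots> \<le> 1" using r by simp
        finally have "norm (\<rho> *\<^sub>R fst Z') < \<rho>" using \<rho> by simp
        moreover have "fst Z = fst X + \<rho> *\<^sub>R fst Z'"
          unfolding ZZ by (simp add: vec_eq_iff pscale_def pt_of_def coord_def cwt_def)
        moreover have "snd Z = snd X + \<rho>\<^sup>2 * snd Z'"
          unfolding ZZ by (simp add: pscale_def pt_of_def coord_def cwt_def)
        moreover have "-1 < snd Z'" "snd Z' \<le> 0"
          using d[of None] r by (auto simp: z_def coord_def pt_of_def abs_le_iff)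
        moreover have "\<rho>\<^sup>2 * (-1) < \<rho>\<^sup>2 * snd Z'" "\<rho>\<^sup>2 * snd Z' \<le> 0"
          using calculation(4,5) \<rho> by (intro mult_strict_left_mono mult_nonneg_nonpos; simp)+
        ultimately show "Z \<in> cyl X \<rho>" by (cases Z) (auto simp: cyl_def cyl_time_def dist_norm)
      qed
      have "ennreal (\<delta> * \<bar>b' \<sigma>\<bar> * (w * \<rho> ^ (CARD('n) + 2))) = (\<integral>\<^sup>+ Z. ennreal (\<delta> * \<bar>b' \<sigma>\<bar>) * indicator W Z \<partial>lborel)"
        using W de w \<rho> by (simp add: nn_integral_cmult_indicator ennreal_mult)
      also have "\<dots> \<le> (\<integral>\<^sup>+ Z. ennreal \<bar>?q Z\<bar> * indicator (cyl X \<rho>) Z \<partial>lborel)"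
        by (intro nn_integral_mono) (use inW in \<open>auto simp: indicator_def intro: ennreal_leI\<close>)
      also have "\<dots> \<le> ennreal (2 * A * \<rho> ^ (CARD('n) + 2))" by (rule upper)
      finally have "\<delta> * \<bar>b' \<sigma>\<bar> * (w * \<rho> ^ (CARD('n) + 2)) \<le> 2 * A * \<rho> ^ (CARD('n) + 2)"
        using A \<rho> by (simp add: ennreal_le_iff)
      then have "\<delta> * \<bar>b' \<sigma>\<bar> * w \<le> 2 * A" using \<rho> by (simp add: mult.assoc[symmetric] del: power_add power_Suc)
      then show ?thesis using de w \<rho> by (simp add: b'_def abs_mult field_simps)
    qed
    show "dbound X N (2 / (\<delta> * w) * A) \<rho> (\<lambda>Z. P\<^sub>1 Z - P\<^sub>2 Z)"
      unfolding q dbound_def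
    proof (intro allI impI)
      fix cs :: "'n option list"
      show "\<bar>cderiv cs (cpoly k b X) X\<bar> \<le> 2 / (\<delta> * w) * A / \<rho> ^ lwt cs"
        using coeff[of "index_of cs"] cderiv_pol_center[of k b cs X, OF b] by (simp add: weight_index_of)
    qed
  qed
qed

lemma borel_version:
  fixes f :: "'a::euclidean_space \<Rightarrow> real"
  assumes "f \<in> borel_measurable (lebesgue_on S)" "S \<in> sets lebesgue"
  obtains f' where "f' \<in> borel_measurable borel" "AE X in lborel. X \<in> S \<longrightarrow> f X = f' X"
proof -
  have "(\<lambda>X. if X \<in> S then f X else 0) \<in> borel_measurable lebesgue"
    using assms by (simp add: borel_measurable_if)
  then obtain f' where "f' \<in> borel_measurable lborel" "AE X in lborel. (if X \<in> S then f X else 0) = f' X"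
    using completion_ex_borel_measurable_real by blast
  then show ?thesis by (intro that[of f']) (auto elim!: eventually_mono)
qed

lemma cyl_half_subset:
  assumes "X \<in> cyl 0 (1/2)" "0 < r" "r < 1/2"
  shows "cyl X r \<subseteq> cyl 0 1"
proof
  fix Z assume Z: "Z \<in> cyl X r"
  have "norm (fst Z) < 1"
    using assms Z dist_triangle[of 0 "fst Z" "fst X"] by (auto simp: cyl_def)
  moreover have "r\<^sup>2 < (1/2)\<^sup>2" using assms by (intro power_strict_mono) auto
  ultimately show "Z \<in> cyl 0 1"
    using assms(1) Z by (cases Z; cases X) (auto simp: cyl_def cyl_time_def power2_eq_square)
qed

lemma cyl_half_close:
  assumes "X \<in> cyl 0 (1/2)" "Y \<in> cyl 0 (1/2)"
  shows "pclose 1 X Y"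
  unfolding pclose_def
proof
  fix c
  have "norm (fst X) < 1/2" "norm (fst Y) < 1/2" using assms by (auto simp: cyl_def)
  then have "\<bar>coord X (Some i) - coord Y (Some i)\<bar> \<le> 1" for i
    using abs_coord_le_norm[of X i] abs_coord_le_norm[of Y i] by linarith
  moreover have "\<bar>coord X None - coord Y None\<bar> \<le> 1"
    using assms by (auto simp: cyl_def cyl_time_def coord_def power2_eq_square)
  ultimately show "\<bar>coord X c - coord Y c\<bar> \<le> 1 ^ cwt c" by (cases c) auto
qed

lemma dbound_diff_commute:
  assumes "smooth N f" "smooth N g" "dbound X N A \<epsilon> (\<lambda>Z. f Z - g Z)"
  shows "dbound X N A \<epsilon> (\<lambda>Z. g Z - f Z)"
  unfolding dbound_def
proof (intro allI impI)
  fix cs :: "'a option list" assume w: "lwt cs \<le> N"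
  have "cderiv cs (\<lambda>Z. g Z - f Z) X = - cderiv cs (\<lambda>Z. f Z - g Z) X"
    by (simp add: cderiv_diff[OF assms(1,2) w] cderiv_diff[OF assms(2,1) w])
  then show "\<bar>cderiv cs (\<lambda>Z. g Z - f Z) X\<bar> \<le> A / \<epsilon> ^ lwt cs"
    using dboundD[OF assms(3) w] by simp
qed

lemma par_polys_sm: "P \<in> par_polys k \<Longrightarrow> smooth N P"
  by (metis par_polysE smooth_pol)

lemma par_polys_itd_zero: "P \<in> par_polys k \<Longrightarrow> k < lwt cs \<Longrightarrow> cderiv cs P X = 0"
  by (metis par_polysE cderiv_pol_zero)

lemma par_polys_propagation:
  fixes P :: "'n::finite pt \<Rightarrow> real"
  assumes "P \<in> par_polys k" "dbound Y k A \<epsilon> P" "pclose (a * \<epsilon>) X Y" "1 \<le> a" "0 < \<epsilon>"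
  shows "dbound X N ((1 + real CARD('n option) * a\<^sup>2) ^ Suc k * A) \<epsilon> P"
  using assms by (intro poly_propagation par_polys_sm par_polys_itd_zero) auto

lemma par_polys_diff_propagation:
  fixes P :: "'n::finite pt \<Rightarrow> real"
  assumes "P \<in> par_polys k" "Q \<in> par_polys k" "dbound Y k A \<epsilon> (\<lambda>Z. P Z - Q Z)" "pclose (a * \<epsilon>) X Y" "1 \<le> a" "0 < \<epsilon>"
  shows "dbound X N ((1 + real CARD('n option) * a\<^sup>2) ^ Suc k * A) \<epsilon> (\<lambda>Z. P Z - Q Z)"
proof (rule poly_propagation[OF _ _ assms(3-6)])
  show "smooth N (\<lambda>Z. P Z - Q Z)" for N using assms by (intro smooth_diff par_polys_sm)
  show "cderiv cs (\<lambda>Z. P Z - Q Z) X = 0" if "k < lwt cs" for cs X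
    using cderiv_diff[OF par_polys_sm[OF assms(1)] par_polys_sm[OF assms(2)] order_refl, of cs]
      par_polys_itd_zero[OF assms(1) that, of X] par_polys_itd_zero[OF assms(2) that, of X] by simp
qed

text \<open>If \<open>\<rho>\<close> is small, compare both polynomials with \<open>f\<close> on the cylinder below the earlier of the two
  points; if \<open>\<rho>\<close> is bounded below, the bound on the coefficients suffices.\<close>

lemma compatibility:
  fixes k :: nat and \<alpha> :: real
  assumes \<alpha>: "0 < \<alpha>"
  obtains C where "1 \<le> C"
    "\<And>p p' (f :: 'n::finite pt \<Rightarrow> real) E P K M X Y \<rho> N.
      1 \<le> p \<Longrightarrow> 1 \<le> p' \<Longrightarrow> f \<in> mixed_space p p' (ball 0 1) (cyl_time (0 :: 'n pt) 1) \<Longrightarrow>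
      E \<subseteq> cyl 0 (1/2) \<Longrightarrow> (\<And>X. X \<in> E \<Longrightarrow> P X \<in> par_polys k) \<Longrightarrow> approximates p p' k \<alpha> f E P K \<Longrightarrow>
      0 \<le> K \<Longrightarrow> K \<le> M \<Longrightarrow> (\<And>X. X \<in> E \<Longrightarrow> dbound X k M 1 (P X)) \<Longrightarrow>
      X \<in> E \<Longrightarrow> Y \<in> E \<Longrightarrow> 0 < \<rho> \<Longrightarrow> pclose \<rho> X Y \<Longrightarrow>
      dbound X N (C * M * \<rho> powr (real k + \<alpha>)) \<rho> (\<lambda>Z. P X Z - P Y Z)"
proof -
  define n where "n = real CARD('n option)"
  have n2: "2 \<le> n"
    using zero_less_card_finite[where 'a = 'n] by (simp add: n_def del: zero_less_card_finite)
  obtain C\<^sub>0 where C0: "0 < C\<^sub>0"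
    "\<And>(f' :: 'n::finite pt \<Rightarrow> real) P\<^sub>1 P\<^sub>2 X Y \<rho> A N.
      f' \<in> borel_measurable borel \<Longrightarrow> P\<^sub>1 \<in> par_polys k \<Longrightarrow> P\<^sub>2 \<in> par_polys k \<Longrightarrow> 0 < \<rho> \<Longrightarrow> 0 \<le> A \<Longrightarrow>
      pclose \<rho> X Y \<Longrightarrow> snd X \<le> snd Y \<Longrightarrow>
      (\<integral>\<^sup>+ Z. ennreal \<bar>f' Z - P\<^sub>1 Z\<bar> * indicator (cyl X \<rho>) Z \<partial>lborel) \<le> ennreal (A * \<rho> ^ (CARD('n) + 2)) \<Longrightarrow>
      (\<integral>\<^sup>+ Z. ennreal \<bar>f' Z - P\<^sub>2 Z\<bar> * indicator (cyl Y (real CARD('n option) * \<rho>)) Z \<partial>lborel)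
        \<le> ennreal (A * \<rho> ^ (CARD('n) + 2)) \<Longrightarrow>
      dbound X N (C\<^sub>0 * A) \<rho> (\<lambda>Z. P\<^sub>1 Z - P\<^sub>2 Z)"
    using poly_diff_bound_from_integrals[of k] by blast
  \<comment> \<open>Propagation constant for two points at distance at most one unit of the
    scale.\<close>
  define B where "B = (1 + n * 1\<^sup>2) ^ Suc k"
  have B: "1 \<le> B" unfolding B_def using n2 by (intro one_le_power) auto
  \<comment> \<open>4 comes from the iterated norm estimate, the real power of \<open>n\<close> from
    approximating at radius up to \<open>n * \<rho>\<close>, and the rest from the volume of a
    cylinder of that radius.\<close>
  define C\<^sub>1 where "C\<^sub>1 = C\<^sub>0 * (4 * n powr (real k + \<alpha>) * 2 ^ CARD('n) * n ^ (CARD('n) + 2))"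
  \<comment> \<open>Below \<open>h\<close> the larger radius \<open>n * \<rho>\<close> is under 1/2,
    the range in which approximation is assumed.\<close>
  define h where "h = 1 / (2 * n)"
  define C\<^sub>2 where "C\<^sub>2 = (1 + B) / h powr (real k + \<alpha>)"
  have h: "0 < h" "h \<le> 1" using n2 by (auto simp: h_def)
  have "0 \<le> C\<^sub>1" using C0(1) n2 by (simp add: C\<^sub>1_def)
  then have C12: "0 \<le> C\<^sub>1" "0 \<le> C\<^sub>2" "C\<^sub>1 \<le> B * C\<^sub>1"
    using B h mult_right_mono[of 1 B C\<^sub>1] by (auto simp: C\<^sub>2_def)
  define C where "C = 1 + B * C\<^sub>1 + C\<^sub>2"
  have C: "1 \<le> C" "C\<^sub>1 \<le> C" "B * C\<^sub>1 \<le> C" "C\<^sub>2 \<le> C" using C12 B by (auto simp: C_def)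
  show ?thesis
  proof (rule that[OF C(1)])
    fix p p' :: ennreal and f :: "'n::finite pt \<Rightarrow> real" and E P K M X Y \<rho> N
    assume p: "1 \<le> p" "1 \<le> p'" and f: "f \<in> mixed_space p p' (ball 0 1) (cyl_time (0 :: 'n pt) 1)"
      and E: "E \<subseteq> cyl 0 (1/2)" and P: "\<And>X. X \<in> E \<Longrightarrow> P X \<in> par_polys k"
      and ap: "approximates p p' k \<alpha> f E P K" and K: "0 \<le> K" "K \<le> M"
      and M: "\<And>X. X \<in> E \<Longrightarrow> dbound X k M 1 (P X)"
      and XE: "X \<in> E" and YE: "Y \<in> E" and \<rho>: "0 < \<rho>" and cl: "pclose \<rho> X Y"
    have M0: "0 \<le> M" using K by simp
    have grow: "c * M * \<rho> powr (real k + \<alpha>) \<le> C * M * \<rho> powr (real k + \<alpha>)" if "c \<le> C" for c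
      using that M0 by (intro mult_right_mono) auto
    show "dbound X N (C * M * \<rho> powr (real k + \<alpha>)) \<rho> (\<lambda>Z. P X Z - P Y Z)"
    proof (cases "h \<le> \<rho>")
      case True
      have "dbound X (max N k) (B * M) 1 (P Y)"
        unfolding B_def n_def using cyl_half_close[of X Y] E XE YE P M
        by (intro par_polys_propagation[of _ _ Y]) auto
      then have "dbound X k (B * M) 1 (P Y)" by (rule dbound_mono) auto
      from dbound_diff[OF par_polys_sm[OF P[OF XE]] par_polys_sm[OF P[OF YE]] M[OF XE] this]
      have d: "dbound X k (M + B * M) 1 (\<lambda>Z. P X Z - P Y Z)" .
      have "M + B * M \<le> C * M * \<rho> powr (real k + \<alpha>) / \<rho> ^ w" if w: "w \<le> k" for w
      proof -
        \<comment> \<open>As \<open>h \<le> 1\<close>, one constant with exponent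
          \<open>k + \<alpha>\<close> serves all weights \<open>w \<le> k\<close>.\<close>
        have "h powr (real k + \<alpha>) \<le> h powr (real k + \<alpha> - real w)"
          using h by (intro powr_mono') auto
        also have "\<dots> \<le> \<rho> powr (real k + \<alpha> - real w)"
          using True h w \<alpha> by (intro powr_mono2) auto
        also have "\<dots> = \<rho> powr (real k + \<alpha>) / \<rho> ^ w"
          using \<rho> by (simp add: powr_diff powr_realpow)
        finally have "C\<^sub>2 * M * h powr (real k + \<alpha>) \<le> C * M * (\<rho> powr (real k + \<alpha>) / \<rho> ^ w)"
          using C C12 M0 by (intro mult_mono) auto
        moreover have "C\<^sub>2 * M * h powr (real k + \<alpha>) = M + B * M"
          using h by (simp add: C\<^sub>2_def field_simps)
        ultimately show ?thesis by simp
      qed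
      note le = this
      show ?thesis
        unfolding dbound_def
      proof (intro allI impI)
        fix cs :: "'n option list"
        show "\<bar>cderiv cs (\<lambda>Z. P X Z - P Y Z) X\<bar> \<le> C * M * \<rho> powr (real k + \<alpha>) / \<rho> ^ lwt cs"
        proof (cases "lwt cs \<le> k")
          case True
          then show ?thesis using dboundD[OF d True] le[OF True] by simp
        next
          case False
          then have "cderiv cs (\<lambda>Z. P X Z - P Y Z) X = 0"
            using cderiv_diff[OF par_polys_sm[OF P[OF XE]] par_polys_sm[OF P[OF YE]] order_refl, of cs]
              par_polys_itd_zero[OF P[OF XE], of cs X] par_polys_itd_zero[OF P[OF YE], of cs X] by simp
          then show ?thesis using C M0 \<rho> by simp
        qed
      qed
    next
      case False
      then have \<rho>h: "n * \<rho> < 1/2" using n2 by (simp add: h_def field_simps)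
      have cylS: "cyl 0 1 \<in> sets lebesgue"
        by (intro sets_completionI_sets) (simp add: sets_cyl)
      have "f \<in> borel_measurable (lebesgue_on (cyl 0 1))"
        using f by (simp add: mixed_space_def cyl_def)
      from borel_version[OF this cylS]
      obtain f' where f': "f' \<in> borel_measurable borel" "AE X in lborel. X \<in> cyl 0 1 \<longrightarrow> f X = f' X"
        by blast
      define A where "A = 4 * (K * (n * \<rho>) powr (real k + \<alpha>)) * (2 ^ CARD('n) * n ^ (CARD('n) + 2))"
      have A0: "0 \<le> A" using K n2 by (simp add: A_def)
      have int: "(\<integral>\<^sup>+ Z. ennreal \<bar>f' Z - P W Z\<bar> * indicator (cyl W r) Z \<partial>lborel) \<le> ennreal (A * \<rho> ^ (CARD('n) + 2))"
        if W: "W \<in> E" and r: "0 < r" "r \<le> n * \<rho>" for W r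
      proof -
        have r2: "r < 1/2" using r \<rho>h by simp
        obtain v where v: "emeasure lborel (ball (fst W) r) = ennreal v" "0 < v" "v \<le> (2 * r) ^ CARD('n)"
          using ball_measure[OF r(1)] by blast
        obtain a where "P W = cpoly k a 0" using par_polysE[OF P[OF W], of 0] by blast
        then have [measurable]: "P W \<in> borel_measurable borel"
          by (metis continuous_on_cpoly borel_measurable_continuous_onI)
        have mn: "mean_norm p p' (ball (fst W) r) (cyl_time W r) (\<lambda>X. f X - P W X) \<le> ennreal (K * r powr (real k + \<alpha>))"
          using ap W r r2 unfolding approximates_def by blast
        have "(\<integral>\<^sup>+ Z. ennreal \<bar>f' Z - P W Z\<bar> * indicator (ball (fst W) r \<times> cyl_time W r) Z \<partial>lborel)
          \<le> 4 * mean_norm p p' (ball (fst W) r) (cyl_time W r) (\<lambda>X. f X - P W X) * ennreal (v * r\<^sup>2)"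
        proof (rule nn_integral_le_mean_norm)
          have "cyl W r \<subseteq> cyl 0 1" using cyl_half_subset W E r r2 by blast
          then show "AE X in lborel. X \<in> ball (fst W) r \<times> cyl_time W r \<longrightarrow> f X - P W X = f' X - P W X"
            using f'(2) unfolding cyl_def by (auto elim!: eventually_mono)
          show "emeasure lborel (cyl_time W r) = ennreal (r\<^sup>2)" using r by (intro cyl_time_measure)
          show "cyl_time W r \<in> sets lborel" by (simp add: cyl_time_def)
        qed (use p v r f'(1) in auto)
        also have "\<dots> \<le> 4 * ennreal (K * r powr (real k + \<alpha>)) * ennreal (v * r\<^sup>2)"
          using mn by (intro mult_right_mono mult_left_mono) auto
        also have "\<dots> = ennreal (4 * (K * r powr (real k + \<alpha>)) * (v * r\<^sup>2))"
          using K v by (simp add: ennreal_mult)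
        also have "\<dots> \<le> ennreal (A * \<rho> ^ (CARD('n) + 2))"
        proof (rule ennreal_leI)
          have "4 * (K * r powr (real k + \<alpha>)) * (v * r\<^sup>2)
              \<le> 4 * (K * (n * \<rho>) powr (real k + \<alpha>)) * ((2 * (n * \<rho>)) ^ CARD('n) * (n * \<rho>)\<^sup>2)"
          proof (intro mult_mono mult_left_mono)
            show "r powr (real k + \<alpha>) \<le> (n * \<rho>) powr (real k + \<alpha>)" using r \<alpha> by (intro powr_mono2) auto
            show "v \<le> (2 * (n * \<rho>)) ^ CARD('n)"
              using r by (intro order_trans[OF v(3)] power_mono) auto
            show "r\<^sup>2 \<le> (n * \<rho>)\<^sup>2" using r by (intro power_mono) auto
          qed (use K v r \<rho> n2 in auto)
          also have "\<dots> = A * \<rho> ^ (CARD('n) + 2)"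
            by (simp add: A_def power_mult_distrib power_add power2_eq_square)
          finally show "4 * (K * r powr (real k + \<alpha>)) * (v * r\<^sup>2) \<le> A * \<rho> ^ (CARD('n) + 2)" .
        qed
        finally show ?thesis by (simp add: cyl_def)
      qed
      have A: "C\<^sub>0 * A \<le> C\<^sub>1 * M * \<rho> powr (real k + \<alpha>)"
      proof -
        have "C\<^sub>0 * A = C\<^sub>1 * K * \<rho> powr (real k + \<alpha>)"
          using n2 \<rho> by (simp add: A_def C\<^sub>1_def powr_mult)
        then show ?thesis using C12 K by (simp add: mult_left_mono mult_right_mono)
      qed
      have le: "\<rho> \<le> n * \<rho>" "0 < n * \<rho>" using n2 \<rho> by auto
      have core: "dbound V L (C\<^sub>1 * M * \<rho> powr (real k + \<alpha>)) \<rho> (\<lambda>Z. P V Z - P W Z)"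
        if VW: "V \<in> E" "W \<in> E" "pclose \<rho> V W" "snd V \<le> snd W" for V W L
      proof -
        have "dbound V L (C\<^sub>0 * A) \<rho> (\<lambda>Z. P V Z - P W Z)"
          by (rule C0(2)[OF f'(1) P[OF VW(1)] P[OF VW(2)] \<rho> A0 VW(3,4)])
            (use int[OF VW(1) \<rho> le(1)] int[OF VW(2) le(2) order_refl] in \<open>simp_all add: n_def\<close>)
        then show ?thesis using A \<rho> by (rule dbound_mono[OF _ order_refl _ _ order_refl])
      qed
      show ?thesis
      proof (cases "snd X \<le> snd Y")
        case True
        show ?thesis
          by (rule dbound_mono[OF core[OF XE YE cl True] order_refl grow[OF C(2)] \<rho> order_refl])
      next
        case F: False
        \<comment> \<open>With \<open>Y\<close> earlier, the estimate is centred at \<open>Y\<close>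
          and transported to \<open>X\<close> at the cost of the factor \<open>B\<close>.\<close>
        have "dbound Y k (C\<^sub>1 * M * \<rho> powr (real k + \<alpha>)) \<rho> (\<lambda>Z. P Y Z - P X Z)"
          using F cl by (intro core XE YE) (auto simp: pclose_sym)
        from par_polys_diff_propagation[OF P[OF YE] P[OF XE] this, of 1 X N] cl \<rho>
        have "dbound X N (B * (C\<^sub>1 * M * \<rho> powr (real k + \<alpha>))) \<rho> (\<lambda>Z. P Y Z - P X Z)"
          unfolding B_def n_def by simp
        then have "dbound X N (B * (C\<^sub>1 * M * \<rho> powr (real k + \<alpha>))) \<rho> (\<lambda>Z. P X Z - P Y Z)"
          by (rule dbound_diff_commute[OF par_polys_sm[OF P[OF YE]] par_polys_sm[OF P[OF XE]]])
        then show ?thesis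
          using grow[OF C(3)] \<rho> by (elim dbound_mono) (auto simp: mult.assoc)
      qed
    qed
  qed
qed

section \<open>The extension\<close>

text \<open>The Weierstrass test for every derivative of weight at most \<open>K\<close> permits
  differentiation under the sum, one direction at a time.\<close>

lemma smooth_series:
  fixes u :: "nat \<Rightarrow> 'n::finite pt \<Rightarrow> real"
  assumes smooth: "\<And>l. smooth K (u l)"
    and b: "\<And>cs l X. lwt cs \<le> K \<Longrightarrow> \<bar>cderiv cs (u l) X\<bar> \<le> b l" and s: "summable b"
  shows "smooth K (\<lambda>X. \<Sum>l. u l X)"
    "\<And>cs. lwt cs \<le> K \<Longrightarrow> cderiv cs (\<lambda>X. \<Sum>l. u l X) = (\<lambda>X. \<Sum>l. cderiv cs (u l) X)"
proof -
  have step: "has_pd c (\<lambda>X. \<Sum>l. cderiv cs (u l) X) (\<lambda>X. \<Sum>l. cderiv (c # cs) (u l) X)"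
    if w: "lwt (c # cs) \<le> K" for c cs
    unfolding has_pd_def
  proof
    fix X
    have "((\<lambda>s. \<Sum>l. cderiv cs (u l) (X + s *\<^sub>R cdir c)) has_real_derivative
        (\<Sum>l. cderiv (c # cs) (u l) (X + 0 *\<^sub>R cdir c))) (at 0)"
    proof (rule has_field_derivative_series'(2)[where S = UNIV and ?x0.0 = 0])
      fix l s
      have "has_pd c (cderiv cs (u l)) (cderiv (c # cs) (u l))"
        using w by (intro smooth_has_pd_itd[OF smooth]) simp
      from has_pd_line[OF this]
      show "((\<lambda>s. cderiv cs (u l) (X + s *\<^sub>R cdir c)) has_real_derivative cderiv (c # cs) (u l) (X + s *\<^sub>R cdir c)) (at s within UNIV)"
        by simp
    next
      show "uniformly_convergent_on UNIV (\<lambda>n s. \<Sum>i<n. cderiv (c # cs) (u i) (X + s *\<^sub>R cdir c))"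
        using b[OF w] by (intro Weierstrass_m_test'[OF _ s]) auto
      show "summable (\<lambda>l. cderiv cs (u l) (X + 0 *\<^sub>R cdir c))"
        using b[of cs] w by (intro summable_comparison_test'[OF s]) auto
    qed auto
    then show "((\<lambda>s. \<Sum>l. cderiv cs (u l) (X + s *\<^sub>R cdir c)) has_real_derivative
        (\<Sum>l. cderiv (c # cs) (u l) X)) (at 0)" by simp
  qed
  have i: "cderiv cs (\<lambda>X. \<Sum>l. u l X) = (\<lambda>X. \<Sum>l. cderiv cs (u l) X) \<and>
      iter_D_exists UNIV (map cdir cs) (\<lambda>X. \<Sum>l. u l X)" if "lwt cs \<le> K" for cs
    using that
  proof (induction cs)
    case (Cons c cs)
    then have IH: "cderiv cs (\<lambda>X. \<Sum>l. u l X) = (\<lambda>X. \<Sum>l. cderiv cs (u l) X)"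
      "iter_D_exists UNIV (map cdir cs) (\<lambda>X. \<Sum>l. u l X)" by simp_all
    have h: "has_pd c (cderiv cs (\<lambda>X. \<Sum>l. u l X)) (\<lambda>X. \<Sum>l. cderiv (c # cs) (u l) X)"
      unfolding IH using step[OF Cons.prems] .
    then have "has_pd c (cderiv cs (\<lambda>X. \<Sum>l. u l X)) (pd c (cderiv cs (\<lambda>X. \<Sum>l. u l X)))"
      by (simp only: pd_eq[OF h])
    then have "\<forall>X. (\<lambda>s. cderiv cs (\<lambda>X. \<Sum>l. u l X) (X + s *\<^sub>R cdir c)) field_differentiable (at 0)"
      by (rule has_pd_pd_iff[THEN iffD1])
    then show ?case
      using IH(2) pd_eq[OF h] unfolding list.map iter_D.simps iter_D_exists.simps by blast
  qed simp
  then show "\<And>cs. lwt cs \<le> K \<Longrightarrow> cderiv cs (\<lambda>X. \<Sum>l. u l X) = (\<lambda>X. \<Sum>l. cderiv cs (u l) X)" by blast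
  have "continuous_on UNIV (\<lambda>X. \<Sum>l. cderiv cs (u l) X)" if w: "lwt cs \<le> K" for cs
  proof (rule uniform_limit_theorem[OF _ Weierstrass_m_test[OF _ s]])
    show "\<forall>\<^sub>F n in sequentially. continuous_on UNIV (\<lambda>X. \<Sum>l<n. cderiv cs (u l) X)"
      using smooth w unfolding smooth_def by (intro always_eventually allI continuous_on_sum) blast
  qed (use b[OF w] in auto)
  then show "smooth K (\<lambda>X. \<Sum>l. u l X)"
    unfolding smooth_def using i by auto
qed

text \<open>The auxiliary constants \<open>n\<close>, \<open>Cb\<close>, \<open>\<kappa>\<close> are parameters so that the constants derived from them do
  not depend on \<open>E\<close>, \<open>P\<close> and \<open>M\<close>.\<close>

locale whitney =
  fixes k :: nat and \<alpha> M :: real and E :: "'n::finite pt set" and P :: "'n pt \<Rightarrow> 'n pt \<Rightarrow> real"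
    and n Cb \<kappa> :: real
  assumes \<alpha>: "0 < \<alpha>" "\<alpha> \<le> 1" and E: "compact E" and M: "0 \<le> M"
    and P: "\<And>Y. Y \<in> E \<Longrightarrow> P Y \<in> par_polys k"
    and P_bnd: "\<And>Y. Y \<in> E \<Longrightarrow> dbound Y k M 1 (P Y)"
    and P_comp: "\<And>X Y \<rho>. X \<in> E \<Longrightarrow> Y \<in> E \<Longrightarrow> 0 < \<rho> \<Longrightarrow> pclose \<rho> X Y \<Longrightarrow>
      dbound X k (M * \<rho> powr (real k + \<alpha>)) \<rho> (\<lambda>Z. P X Z - P Y Z)"
    and n_def: "n = real CARD('n option)"
    and Cb_def: "Cb = real ((k + 5) ^ CARD('n option)) * (2 ^ (k + 2) * bump_const (k + 2) TYPE('n))"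
    and \<kappa>_def: "\<kappa> = (1 + real CARD('n option) * (2 * real k + 9)\<^sup>2) ^ Suc k"
begin

text \<open>The mean value theorem is applied to derivatives of weight up to \<open>k\<close>, and
  one more direction weighs at most 2.\<close>

definition N :: nat where "N = k + 2"

text \<open>In units of \<open>eps j\<close>, a cell lies within \<open>N + 2 = k + 4\<close> of its
  corner. One more unit reaches \<open>E\<close> from the corner of any cell meeting
  \<open>inner j\<close>, giving \<open>b\<close>; a point of an active cell is then within
  \<open>a = (N + 2) + b\<close> of the chosen point of \<open>E\<close>. Finally
  \<open>\<Lambda> = a + 1\<close>, so that \<open>outer (Suc j)\<close> fits into
  \<open>inner j\<close>.\<close>

definition \<Lambda> :: real where "\<Lambda> = 2 * real k + 10"
definition eps :: "nat \<Rightarrow> real" where "eps j = (1 / \<Lambda>) ^ j"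
definition a :: real where "a = 2 * real k + 9"
definition b :: real where "b = real k + 5"

lemma cfacts: "1 < \<Lambda>" "a < \<Lambda>" "1 \<le> a" "0 \<le> Cb" "1 \<le> \<kappa>" "real N + 2 + 1 = b" "real N + 2 + b = a" "2 \<le> n" "k \<le> N"
proof -
  show "1 \<le> \<kappa>" unfolding \<kappa>_def by (intro one_le_power) simp
  show "2 \<le> n" using zero_less_card_finite[where 'a = 'n]
    by (simp add: n_def del: zero_less_card_finite)
qed (auto simp: N_def \<Lambda>_def a_def b_def Cb_def bump_const_def)

lemma eps_pos: "0 < eps j" using cfacts by (simp add: eps_def)
lemma eps_0: "eps 0 = 1" by (simp add: eps_def)
lemma eps_Suc: "eps j = \<Lambda> * eps (Suc j)" using cfacts by (simp add: eps_def)
lemma eps_Suc_le: "eps (Suc j) \<le> eps j"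
  using cfacts eps_pos[of "Suc j"] unfolding eps_Suc[of j] by simp

lemma eps_powr: "eps (i + j) powr e = eps j powr e * ((1 / \<Lambda>) powr e) ^ i"
proof -
  have "((1 / \<Lambda>) ^ i) powr e = ((1 / \<Lambda>) powr e) ^ i"
  proof (induction i)
    case (Suc i)
    have "((1 / \<Lambda>) ^ Suc i) powr e = (1 / \<Lambda>) powr e * ((1 / \<Lambda>) ^ i) powr e"
      unfolding power_Suc by (rule powr_mult)
    then show ?case using Suc by simp
  qed simp
  moreover have "eps (i + j) powr e = eps j powr e * ((1 / \<Lambda>) ^ i) powr e"
    unfolding eps_def power_add mult.commute[of "(1 / \<Lambda>) ^ i"] by (rule powr_mult)
  ultimately show ?thesis by simp
qed

section \<open>Active cells, local averages and corrections at scale \<open>eps j\<close>\<close>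

definition act :: "nat \<Rightarrow> ('n option \<Rightarrow> int) set" where
  "act j = {m. \<exists>Y\<in>E. pclose (b * eps j) (lattice_pt (eps j) m) Y}"

definition near :: "nat \<Rightarrow> ('n option \<Rightarrow> int) \<Rightarrow> 'n pt" where
  "near j m = (SOME Y. Y \<in> E \<and> pclose (b * eps j) (lattice_pt (eps j) m) Y)"

text \<open>Every cell at a point of this set is active, so the cut-off is 1 here; strict
  inequalities make the set open, which allows passing to derivatives.\<close>

definition inner :: "nat \<Rightarrow> 'n pt set" where
  "inner j = {X. \<exists>Y\<in>E. \<forall>c. \<bar>coord X c - coord Y c\<bar> < eps j ^ cwt c}"

text \<open>The pieces at scale \<open>j\<close> vanish off this set. It is closed because
  \<open>E\<close> is compact, so their derivatives vanish there as well.\<close>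

definition outer :: "nat \<Rightarrow> 'n pt set" where
  "outer j = {X. \<exists>Y\<in>E. pclose (a * eps j) X Y}"

definition chi :: "nat \<Rightarrow> 'n pt \<Rightarrow> real" where
  "chi j X = (\<Sum>m\<in>act j. bump N (eps j) m X)"

definition h :: "nat \<Rightarrow> 'n pt \<Rightarrow> real" where
  "h j X = (\<Sum>m\<in>act j. bump N (eps j) m X * P (near j m) X)"

text \<open>The correction exchanges \<open>h j\<close> for \<open>h (Suc j)\<close> where the finer
  cut-off is 1, and fades out within the finer outer neighbourhood.\<close>

definition u :: "nat \<Rightarrow> 'n pt \<Rightarrow> real" where
  "u j X = h (Suc j) X - chi (Suc j) X * h j X"

primrec G :: "nat \<Rightarrow> 'n pt \<Rightarrow> real" where
  "G 0 = h 0" | "G (Suc j) = (\<lambda>X. G j X + u j X)"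

lemma near: "m \<in> act j \<Longrightarrow> near j m \<in> E \<and> pclose (b * eps j) (lattice_pt (eps j) m) (near j m)"
  unfolding act_def near_def by (rule someI_ex) blast

lemma finite_act: "finite (act j)"
proof -
  obtain B where B: "\<And>Y. Y \<in> E \<Longrightarrow> norm Y \<le> B"
    using compact_imp_bounded[OF E] by (auto simp: bounded_iff)
  have coord: "\<bar>coord Y c\<bar> \<le> B" if "Y \<in> E" for Y c
  proof (cases c)
    case None
    then show ?thesis using norm_snd_le[of "snd Y" "fst Y"] B[OF that] by (simp add: coord_def)
  next
    case (Some i)
    then show ?thesis using abs_coord_le_norm[of Y i] norm_fst_le[of "fst Y" "snd Y"] B[OF that] by simp
  qed
  define R where "R c = \<lceil>((b * eps j) ^ cwt c + B) / eps j ^ cwt c\<rceil>" for c :: "'n option"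
  have "act j \<subseteq> (\<Pi>\<^sub>E c\<in>UNIV. {- R c..R c})"
  proof
    fix m assume "m \<in> act j"
    then obtain Y where Y: "Y \<in> E" "pclose (b * eps j) (lattice_pt (eps j) m) Y" by (auto simp: act_def)
    have "m c \<in> {- R c..R c}" for c
    proof -
      have "\<bar>eps j ^ cwt c * of_int (m c) - coord Y c\<bar> \<le> (b * eps j) ^ cwt c"
        using Y(2) by (simp add: pclose_def lattice_pt_def)
      then have "eps j ^ cwt c * \<bar>of_int (m c)\<bar> \<le> (b * eps j) ^ cwt c + B"
        using coord[OF Y(1), of c] eps_pos[of j] abs_mult[of "eps j ^ cwt c" "of_int (m c)"] by simp
      then have "\<bar>real_of_int (m c)\<bar> \<le> ((b * eps j) ^ cwt c + B) / eps j ^ cwt c"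
        using eps_pos[of j] by (simp add: field_simps)
      also have "\<dots> \<le> real_of_int (R c)" unfolding R_def by (rule le_of_int_ceiling)
      finally show ?thesis by (simp add: abs_le_iff)
    qed
    then show "m \<in> (\<Pi>\<^sub>E c\<in>UNIV. {- R c..R c})" by auto
  qed
  then show ?thesis by (rule finite_subset) (intro finite_PiE; simp)
qed

lemma open_inner: "open (inner j)"
proof -
  have "inner j = (\<Union>Y\<in>E. {X. \<forall>c. \<bar>coord X c - coord Y c\<bar> < eps j ^ cwt c})" by (auto simp: inner_def)
  moreover have "open {X :: 'n pt. \<forall>c. \<bar>coord X c - coord Y c\<bar> < eps j ^ cwt c}" for Y
    by (intro open_Collect_all_finite open_Collect_less continuous_intros)
  ultimately show ?thesis by auto
qed

lemma closed_outer: "closed (outer j)"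
proof -
  have "closed {W :: 'n pt. \<forall>c. \<bar>coord W c\<bar> \<le> (a * eps j) ^ cwt c}"
    by (intro closed_Collect_all closed_Collect_le continuous_intros)
  from compact_closed_sums[OF E this]
  have "closed (\<Union>Y\<in>E. \<Union>W\<in>{W. \<forall>c. \<bar>coord W c\<bar> \<le> (a * eps j) ^ cwt c}. {Y + W})" .
  moreover have "(\<Union>Y\<in>E. \<Union>W\<in>{W. \<forall>c. \<bar>coord W c\<bar> \<le> (a * eps j) ^ cwt c}. {Y + W}) = outer j"
  proof (intro set_eqI iffI)
    fix X assume "X \<in> outer j"
    then obtain Y where "Y \<in> E" "pclose (a * eps j) X Y" by (auto simp: outer_def)
    then show "X \<in> (\<Union>Y\<in>E. \<Union>W\<in>{W. \<forall>c. \<bar>coord W c\<bar> \<le> (a * eps j) ^ cwt c}. {Y + W})"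
      by (intro UN_I[of Y] UN_I[of "X - Y"]) (auto simp: pclose_def)
  next
    fix X assume "X \<in> (\<Union>Y\<in>E. \<Union>W\<in>{W. \<forall>c. \<bar>coord W c\<bar> \<le> (a * eps j) ^ cwt c}. {Y + W})"
    then obtain Y W where "Y \<in> E" "X = Y + W" "\<forall>c. \<bar>coord W c\<bar> \<le> (a * eps j) ^ cwt c" by blast
    then show "X \<in> outer j" unfolding outer_def by (intro CollectI bexI[of _ Y]) (simp_all add: pclose_def)
  qed
  ultimately show ?thesis by simp
qed

lemma outer_subset_inner: "outer (Suc j) \<subseteq> inner j"
proof
  fix X assume "X \<in> outer (Suc j)"
  then obtain Y where Y: "Y \<in> E" "pclose (a * eps (Suc j)) X Y" by (auto simp: outer_def)
  have lt: "a * eps (Suc j) < eps j" "0 \<le> a * eps (Suc j)"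
    using cfacts eps_pos[of "Suc j"] unfolding eps_Suc[of j] by auto
  have "\<bar>coord X c - coord Y c\<bar> < eps j ^ cwt c" for c
    using Y(2)[unfolded pclose_def, rule_format, of c] power_strict_mono[OF lt, of "cwt c"] cwt_pos(3)[of c] by simp
  then show "X \<in> inner j" using Y(1) by (auto simp: inner_def)
qed

lemma innerE:
  assumes "X \<in> inner j"
  obtains Y where "Y \<in> E" "pclose (eps j) X Y" "pclose (a * eps j) X Y"
proof -
  obtain Y where Y: "Y \<in> E" "pclose (eps j) X Y"
    using assms by (auto simp: inner_def pclose_def intro: less_imp_le)
  moreover have "pclose (a * eps j) X Y"
    by (rule pclose_mono[OF Y(2)]) (use eps_pos[of j] cfacts(3) in auto)
  ultimately show ?thesis using that by blast
qed

lemma inner_subset_outer: "inner j \<subseteq> outer j"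
  using innerE unfolding outer_def by blast

lemma inner_Suc: "inner (Suc j) \<subseteq> inner j"
  using inner_subset_outer outer_subset_inner by blast

lemma E_subset_inner: "E \<subseteq> inner j"
proof
  fix X assume "X \<in> E"
  then show "X \<in> inner j" unfolding inner_def by (intro CollectI bexI[of _ X]) (simp_all add: eps_pos)
qed

lemma cells_subset_act: "X \<in> inner j \<Longrightarrow> cells_at N (eps j) X \<subseteq> act j"
proof
  fix m assume X: "X \<in> inner j" and m: "m \<in> cells_at N (eps j) X"
  obtain Y where Y: "Y \<in> E" "pclose (eps j) X Y" using innerE[OF X] by blast
  have "pclose ((real N + 2) * eps j) (lattice_pt (eps j) m) X"
    using m bump_cell_close[OF _ eps_pos] by (simp add: cells_at_def pclose_sym)
  from pclose_trans[OF this Y(2)] have "pclose ((real N + 2) * eps j + eps j) (lattice_pt (eps j) m) Y"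
    using eps_pos[of j] by simp
  also have "(real N + 2) * eps j + eps j = b * eps j"
    using cfacts(6) by (metis distrib_right mult_1)
  finally show "m \<in> act j" using Y(1) by (auto simp: act_def)
qed

lemma chi_inner: "X \<in> inner j \<Longrightarrow> chi j X = 1"
  unfolding chi_def by (rule bump_partition[OF finite_act cells_subset_act])

lemma near_close:
  assumes "m \<in> act j" "m \<in> cells_at N (eps j) X"
  shows "near j m \<in> E" "pclose (a * eps j) X (near j m)"
proof -
  show "near j m \<in> E" using near[OF assms(1)] by blast
  have "pclose ((real N + 2) * eps j) X (lattice_pt (eps j) m)"
    using assms(2) bump_cell_close[OF _ eps_pos] by (simp add: cells_at_def)
  from pclose_trans[OF this near[OF assms(1), THEN conjunct2]]
  have "pclose ((real N + 2) * eps j + b * eps j) X (near j m)"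
    using eps_pos[of j] by (simp add: b_def)
  also have "(real N + 2) * eps j + b * eps j = a * eps j"
    using cfacts(7) by (metis distrib_right)
  finally show "pclose (a * eps j) X (near j m)" .
qed

lemma outer_zero:
  assumes "X \<notin> outer j"
  shows "chi j X = 0" "h j X = 0"
proof -
  have "bump N (eps j) m X = 0" if "m \<in> act j" for m
    using near_close[OF that, of X] assms bump_eq_0[of X N "eps j" m]
    unfolding outer_def cells_at_def by blast
  then show "chi j X = 0" "h j X = 0" by (simp_all add: chi_def h_def)
qed

lemma P_sm: "Y \<in> E \<Longrightarrow> smooth L (P Y)"
  by (rule par_polys_sm[OF P])

lemma smooth_bump: "smooth N (bump N (eps j) m :: 'n pt \<Rightarrow> real)"
  by (rule bump_sm_bnd(1)[OF eps_pos])

lemma smooth_chi: "smooth N (chi j)"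
  unfolding chi_def[abs_def] by (intro smooth_sum finite_act smooth_bump)

lemma smooth_h: "smooth N (h j)"
  unfolding h_def[abs_def] using near by (intro smooth_sum finite_act smooth_mult smooth_bump P_sm) blast

lemma smooth_u: "smooth N (u j)"
  unfolding u_def[abs_def] by (intro smooth_diff smooth_mult smooth_h smooth_chi)

lemma smooth_G: "smooth N (G j)"
  by (induction j) (auto intro: smooth_h smooth_add smooth_u)

text \<open>Only the boundedly many cells containing \<open>X\<close> contribute near
  \<open>X\<close>, so neither the number of active cells nor the size of \<open>q\<close> on other
  cells enters.\<close>

lemma bump_sum_bnd:
  assumes smooth: "\<And>m. m \<in> act j \<Longrightarrow> smooth N (q m)"
    and q: "\<And>m. m \<in> act j \<Longrightarrow> m \<in> cells_at N (eps j) X \<Longrightarrow> dbound X N A (eps j) (q m)" and A: "0 \<le> A"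
  shows "dbound X N (Cb * A) (eps j) (\<lambda>X. \<Sum>m\<in>act j. bump N (eps j) m X * q m X)"
proof -
  let ?c = "cells_at N (eps j) X" and ?t = "\<lambda>m X. bump N (eps j) m X * q m X"
  \<comment> \<open>The finitely many active cells missing \<open>X\<close> are closed; off their
    union only the cells at \<open>X\<close> remain in the sum.\<close>
  define U where "U = - (\<Union>m\<in>act j - ?c. bump_cell N (eps j) m)"
  have U: "open U" unfolding U_def
    by (intro open_Compl closed_UN) (use finite_act closed_bump_cell in auto)
  have XU: "X \<in> U" by (auto simp: U_def cells_at_def)
  have eq: "(\<Sum>m\<in>act j. ?t m Z) = (\<Sum>m\<in>act j \<inter> ?c. ?t m Z)" if "Z \<in> U" for Z
  proof (rule sum.mono_neutral_right[OF finite_act])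
    show "\<forall>m\<in>act j - act j \<inter> ?c. ?t m Z = 0"
      using that bump_eq_0[of Z N "eps j"] by (auto simp: U_def)
  qed auto
  let ?B = "2 ^ N * (bump_const N TYPE('n) * A)"
  have B: "0 \<le> ?B" using A by (simp add: bump_const_def)
  have "dbound X N (real (card (act j \<inter> ?c)) * ?B) (eps j) (\<lambda>X. \<Sum>m\<in>act j \<inter> ?c. ?t m X)"
    using finite_act A eps_pos
    by (intro dbound_sum smooth_mult dbound_mult smooth_bump smooth bump_sm_bnd(2) q) (auto simp: bump_const_def)
  moreover have "real (card (act j \<inter> ?c)) * ?B \<le> Cb * A"
  proof -
    have "card (act j \<inter> ?c) \<le> card ?c" by (intro card_mono finite_cells_at) auto
    also have "\<dots> \<le> (k + 5) ^ CARD('n option)"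
      using card_cells_at[of N "eps j" X] by (simp only: N_def add.assoc) simp
    finally have "real (card (act j \<inter> ?c)) * ?B \<le> real ((k + 5) ^ CARD('n option)) * ?B"
      using B by (intro mult_right_mono) (auto simp only: of_nat_le_iff)
    then show ?thesis by (simp add: Cb_def N_def mult.assoc)
  qed
  ultimately have "dbound X N (Cb * A) (eps j) (\<lambda>X. \<Sum>m\<in>act j \<inter> ?c. ?t m X)"
    using eps_pos by (elim dbound_mono) auto
  then show ?thesis using dbound_local[OF U eq XU] by simp
qed

lemma chi_bnd: "dbound X N Cb (eps j) (chi j)"
proof -
  have "dbound X N (Cb * 1) (eps j) (\<lambda>X. \<Sum>m\<in>act j. bump N (eps j) m X * 1)"
    by (intro bump_sum_bnd smooth_const dbound_one eps_pos) auto
  then show ?thesis by (simp add: chi_def[abs_def])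
qed

section \<open>Size estimates for the averages, corrections and partial sums\<close>

definition th :: "nat \<Rightarrow> real" where "th j = eps j powr (real k + \<alpha>)"

lemma th_pos: "0 < th j" using eps_pos[of j] by (simp add: th_def)

text \<open>\<open>K1\<close> compares nearby polynomials, \<open>K2\<close> the average
  \<open>h j\<close> with one polynomial, \<open>K3\<close> bounds the correction and
  \<open>K4\<close> bounds \<open>h 0\<close>, each up to the factor \<open>M\<close> and the size
  at the scale in question.\<close>

definition K1 where "K1 = \<kappa> * (2 * a) powr (real k + \<alpha>)"
definition K2 where "K2 = Cb * K1"
definition K3 where "K3 = K2 + 2 ^ N * (Cb * (K2 * \<Lambda> powr (real k + \<alpha>)))"
definition K4 where "K4 = Cb * \<kappa>"

lemma K_nonneg: "0 \<le> K1" "0 \<le> K2" "0 \<le> K3" "0 \<le> K4"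
  using cfacts by (auto simp: K1_def K2_def K3_def K4_def)

text \<open>Both points of \<open>E\<close> are within \<open>a * eps j\<close> of \<open>X\<close>,
  hence within twice that of each other; compatibility at that radius is read at the finer scale
  \<open>eps j\<close> and propagated to \<open>X\<close>.\<close>

lemma near_diff_bnd:
  assumes m: "m \<in> act j" "m \<in> cells_at N (eps j) X" and Y: "Y \<in> E" "pclose (a * eps j) X Y"
  shows "dbound X N (K1 * M * th j) (eps j) (\<lambda>Z. P (near j m) Z - P Y Z)"
proof -
  let ?y = "near j m"
  note y = near_close[OF m]
  have e: "0 < a * eps j" "eps j \<le> 2 * a * eps j"
    using cfacts(3) eps_pos[of j] mult_right_mono[of 1 "2 * a" "eps j"] by simp_all
  have "pclose (a * eps j + a * eps j) ?y Y"
    using y(2)[unfolded pclose_sym[of _ X]] Y(2) e(1) by (intro pclose_trans[of _ ?y X]) auto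
  then have "pclose (2 * a * eps j) ?y Y" by (simp only: mult_2 distrib_right)
  then have "dbound ?y k (M * (2 * a * eps j) powr (real k + \<alpha>)) (2 * a * eps j) (\<lambda>Z. P ?y Z - P Y Z)"
    using P_comp[OF y(1) Y(1), of "2 * a * eps j"] e eps_pos[of j] by linarith
  then have "dbound ?y k (M * ((2 * a) powr (real k + \<alpha>) * th j)) (eps j) (\<lambda>Z. P ?y Z - P Y Z)"
    by (rule dbound_mono[OF _ order_refl _ eps_pos e(2)]) (simp only: th_def powr_mult order_refl)
  from par_polys_diff_propagation[OF P[OF y(1)] P[OF Y(1)] this, of a X N]
  have "dbound X N (\<kappa> * (M * ((2 * a) powr (real k + \<alpha>) * th j))) (eps j) (\<lambda>Z. P ?y Z - P Y Z)"
    unfolding \<kappa>_def a_def[symmetric] using y(2) cfacts(3) eps_pos[of j] by blast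
  then show ?thesis by (simp add: K1_def ac_simps)
qed

text \<open>With \<open>chi j\<close> in front of \<open>P Y\<close>, each bump multiplies a
  difference of two polynomials, so the estimate also holds where the bumps do not sum to 1.\<close>

lemma h_diff_bnd:
  assumes Y: "Y \<in> E" "pclose (a * eps j) X Y"
  shows "dbound X N (K2 * M * th j) (eps j) (\<lambda>Z. h j Z - chi j Z * P Y Z)"
proof -
  have "(\<lambda>Z. h j Z - chi j Z * P Y Z) = (\<lambda>Z. \<Sum>m\<in>act j. bump N (eps j) m Z * (P (near j m) Z - P Y Z))"
    by (simp add: h_def chi_def sum_distrib_right right_diff_distrib sum_subtractf)
  moreover have "dbound X N (Cb * (K1 * M * th j)) (eps j)
      (\<lambda>Z. \<Sum>m\<in>act j. bump N (eps j) m Z * (P (near j m) Z - P Y Z))"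
    using near Y K_nonneg M th_pos[of j]
    by (intro bump_sum_bnd near_diff_bnd smooth_diff P_sm) auto
  ultimately show ?thesis by (simp add: K2_def mult.assoc)
qed

lemma h_minus_P_bnd:
  assumes "X \<in> inner j" "Y \<in> E" "pclose (a * eps j) X Y"
  shows "dbound X N (K2 * M * th j) (eps j) (\<lambda>Z. h j Z - P Y Z)"
  using h_diff_bnd[OF assms(2,3)] dbound_local[OF open_inner _ assms(1), of "\<lambda>Z. h j Z - chi j Z * P Y Z" "\<lambda>Z. h j Z - P Y Z"]
    chi_inner by simp

lemma th_Suc: "th j = \<Lambda> powr (real k + \<alpha>) * th (Suc j)"
  using cfacts eps_pos[of "Suc j"] unfolding th_def eps_Suc[of j] by (simp add: powr_mult)

text \<open>Off \<open>outer (Suc j)\<close> the correction vanishes nearby. On it, one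
  \<open>P Y\<close> is subtracted from both averages; \<open>chi j\<close> is 1 there, so
  \<open>h j - P Y\<close> is small too, and its coarser scale costs only a fixed power of
  \<Lambda>.\<close>

lemma u_bnd: "dbound X N (K3 * M * th (Suc j)) (eps (Suc j)) (u j)"
proof (cases "X \<in> outer (Suc j)")
  case False
  have "u j Z = 0" if "Z \<in> - outer (Suc j)" for Z
    using outer_zero[of Z "Suc j"] that by (simp add: u_def)
  then have "dbound X N (K3 * M * th (Suc j)) (eps (Suc j)) (u j) \<longleftrightarrow>
      dbound X N (K3 * M * th (Suc j)) (eps (Suc j)) (\<lambda>X. 0)"
    using False closed_outer by (intro dbound_local[of "- outer (Suc j)"]) auto
  moreover have "dbound X N (K3 * M * th (Suc j)) (eps (Suc j)) (\<lambda>X. 0)"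
    using K_nonneg M th_pos[of "Suc j"] eps_pos by (intro dbound_zero) auto
  ultimately show ?thesis by simp
next
  case True
  then obtain Y where Y: "Y \<in> E" "pclose (a * eps (Suc j)) X Y" by (auto simp: outer_def)
  have Yj: "pclose (a * eps j) X Y"
    using cfacts eps_pos[of "Suc j"] eps_Suc_le[of j] by (intro pclose_mono[OF Y(2)]) auto
  have X: "X \<in> inner j" using True outer_subset_inner by blast
  have e: "u j = (\<lambda>Z. (h (Suc j) Z - chi (Suc j) Z * P Y Z) - chi (Suc j) Z * (h j Z - P Y Z))"
    by (intro ext) (simp add: u_def algebra_simps)
  have A: "0 \<le> K2 * M * th j" using K_nonneg M th_pos[of j] by simp
  have "dbound X N (K2 * M * th j) (eps (Suc j)) (\<lambda>Z. h j Z - P Y Z)"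
    by (rule dbound_mono[OF h_minus_P_bnd[OF X Y(1) Yj]]) (auto simp: eps_pos eps_Suc_le)
  then have "dbound X N (K2 * M * th (Suc j) + 2 ^ N * (Cb * (K2 * M * th j))) (eps (Suc j)) (u j)"
    unfolding e using Y cfacts A eps_pos
    by (intro dbound_diff dbound_mult smooth_diff smooth_mult smooth_h smooth_chi P_sm h_diff_bnd chi_bnd) auto
  moreover have "K2 * M * th (Suc j) + 2 ^ N * (Cb * (K2 * M * th j)) = K3 * M * th (Suc j)"
    unfolding th_Suc[of j] by (simp add: K3_def algebra_simps)
  ultimately show ?thesis by simp
qed

lemma h_0_bnd: "dbound X N (K4 * M) 1 (h 0)"
proof -
  have "dbound X N (\<kappa> * M) (eps 0) (P (near 0 m))" if m: "m \<in> act 0" "m \<in> cells_at N (eps 0) X" for m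
    using near_close[OF m] P P_bnd cfacts unfolding eps_0 \<kappa>_def a_def[symmetric]
    by (intro par_polys_propagation[of _ _ "near 0 m"]) auto
  then have "dbound X N (Cb * (\<kappa> * M)) (eps 0) (h 0)"
    unfolding h_def[abs_def] using near cfacts M by (intro bump_sum_bnd P_sm) auto
  then show ?thesis by (simp add: eps_0 K4_def mult.assoc)
qed

lemma G_inner: "X \<in> inner j \<Longrightarrow> G j X = h j X"
proof (induction j)
  case (Suc j)
  then have "G j X = h j X" using inner_Suc by blast
  then show ?case using chi_inner[OF Suc.prems] by (simp add: u_def)
qed simp

definition K5 where "K5 = K4 + K2 + K3"

text \<open>On \<open>inner j\<close> the partial sum \<open>G j\<close> is \<open>h j\<close>, and
  the bound for \<open>Suc j\<close> is derived afresh; elsewhere \<open>u j\<close> vanishes nearby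
  and the old bound is inherited, so the constant does not grow with \<open>j\<close>. Passing to
  the finer scale weakens the bound, since the exponent is at most 0 by
  \<open>\<alpha> \<le> 1\<close>.\<close>

lemma G_high_bnd:
  assumes cs: "k < lwt cs" "lwt cs \<le> N"
  shows "\<bar>cderiv cs (G j) Z\<bar> \<le> K5 * M * eps j powr (real k + \<alpha> - real (lwt cs))"
proof (induction j)
  case 0
  have "\<bar>cderiv cs (h 0) Z\<bar> \<le> K4 * M" using dboundD[OF h_0_bnd cs(2)] by simp
  also have "\<dots> \<le> K5 * M" using K_nonneg M by (intro mult_right_mono) (auto simp: K5_def)
  finally show ?case by (simp add: eps_0)
next
  case (Suc j)
  let ?e = "real k + \<alpha> - real (lwt cs)"
  have th: "th i / eps i ^ lwt cs = eps i powr ?e" for i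
    using eps_pos[of i] by (simp add: th_def powr_diff powr_realpow)
  have mono: "eps j powr ?e \<le> eps (Suc j) powr ?e"
    using cs \<alpha> eps_pos eps_Suc_le by (intro powr_mono2') auto
  show ?case
  proof (cases "Z \<in> inner j")
    case True
    obtain Y where Y: "Y \<in> E" "pclose (a * eps j) Z Y" using innerE[OF True] by blast
    have "cderiv cs (\<lambda>Z. h j Z - P Y Z) Z = cderiv cs (h j) Z - cderiv cs (P Y) Z"
      by (simp add: cderiv_diff[OF smooth_h P_sm[OF Y(1)] cs(2)])
    then have "\<bar>cderiv cs (h j) Z\<bar> \<le> K2 * M * th j / eps j ^ lwt cs"
      using dboundD[OF h_minus_P_bnd[OF True Y] cs(2)] par_polys_itd_zero[OF P[OF Y(1)] cs(1), of Z] by simp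
    also have "\<dots> = K2 * M * eps j powr ?e" using th[of j] by (metis times_divide_eq_right)
    also have "\<dots> \<le> K2 * M * eps (Suc j) powr ?e" using mono K_nonneg M by (intro mult_left_mono) auto
    finally have 1: "\<bar>cderiv cs (h j) Z\<bar> \<le> K2 * M * eps (Suc j) powr ?e" .
    have 2: "\<bar>cderiv cs (u j) Z\<bar> \<le> K3 * M * eps (Suc j) powr ?e"
      using dboundD[OF u_bnd cs(2), of j Z] th[of "Suc j"] by (metis times_divide_eq_right)
    have "cderiv cs (G j) Z = cderiv cs (h j) Z" using G_inner by (intro cderiv_local[OF open_inner _ True]) auto
    then have "\<bar>cderiv cs (G (Suc j)) Z\<bar> \<le> \<bar>cderiv cs (h j) Z\<bar> + \<bar>cderiv cs (u j) Z\<bar>"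
      by (simp add: cderiv_add[OF smooth_G smooth_u cs(2)])
    also have "\<dots> \<le> (K2 + K3) * M * eps (Suc j) powr ?e" using 1 2 by (simp add: algebra_simps)
    also have "\<dots> \<le> K5 * M * eps (Suc j) powr ?e"
      using K_nonneg M by (intro mult_right_mono) (auto simp: K5_def)
    finally show ?thesis .
  next
    case False
    then have Z: "Z \<in> - outer (Suc j)" using outer_subset_inner by blast
    have "G (Suc j) W = G j W" if "W \<in> - outer (Suc j)" for W
      using outer_zero[of W "Suc j"] that by (simp add: u_def)
    then have "cderiv cs (G (Suc j)) Z = cderiv cs (G j) Z"
      using closed_outer Z by (intro cderiv_local[of "- outer (Suc j)"]) auto
    also have "\<bar>\<dots>\<bar> \<le> K5 * M * eps (Suc j) powr ?e"
      using Suc mono K_nonneg M by (smt (verit, best) K5_def mult_left_mono mult_nonneg_nonneg)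
    finally show ?thesis .
  qed
qed

section \<open>Convergence of the corrections, agreement on \<open>E\<close> and the Hoelder
  estimate\<close>

definition q :: real where "q = (1 / \<Lambda>) powr \<alpha>"
definition S :: real where "S = 1 / (1 - q)"
definition g :: "'n pt \<Rightarrow> real" where "g X = h 0 X + (\<Sum>l. u l X)"

lemma q: "0 < q" "q < 1" "0 < S"
proof -
  show "0 < q" using cfacts by (simp add: q_def)
  have "(1 / \<Lambda>) powr \<alpha> < 1 powr \<alpha>" using cfacts \<alpha> by (intro powr_less_mono2) auto
  then show "q < 1" by (simp add: q_def)
  then show "0 < S" by (simp add: S_def)
qed

text \<open>For weight at most \<open>k\<close> the exponent is at least \<alpha>, so consecutive
  scales gain the ratio \<open>q\<close>; the index \<open>i + j\<close> prepares the estimate of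
  the tail from \<open>j\<close> on.\<close>

lemma u_itd_bnd:
  assumes "lwt cs \<le> k"
  shows "\<bar>cderiv cs (u (i + j)) X\<bar> \<le> K3 * M * eps j powr (real k + \<alpha> - real (lwt cs)) * q ^ i"
proof -
  let ?e = "real k + \<alpha> - real (lwt cs)"
  have e: "\<alpha> \<le> ?e" using assms by simp
  have "\<bar>cderiv cs (u (i + j)) X\<bar> \<le> K3 * M * th (Suc (i + j)) / eps (Suc (i + j)) ^ lwt cs"
    using dboundD[OF u_bnd order_trans[OF assms cfacts(9)], of "i + j" X] by (simp only: add_Suc)
  also have "\<dots> = K3 * M * eps (Suc i + j) powr ?e"
    unfolding th_def powr_diff add_Suc powr_realpow[OF eps_pos] by (simp only: times_divide_eq_right)
  also have "\<dots> = K3 * M * (eps j powr ?e * ((1 / \<Lambda>) powr ?e) ^ Suc i)" by (simp only: eps_powr)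
  also have "\<dots> \<le> K3 * M * (eps j powr ?e * q ^ i)"
  proof -
    have "(1 / \<Lambda>) powr ?e \<le> q" unfolding q_def using e cfacts(1) by (intro powr_mono') auto
    then have "((1 / \<Lambda>) powr ?e) ^ Suc i \<le> q ^ Suc i" by (intro power_mono) auto
    also have "\<dots> \<le> q ^ i" using q by (intro power_decreasing) auto
    finally show ?thesis using K_nonneg M by (intro mult_left_mono) auto
  qed
  finally show ?thesis by (simp add: mult.assoc)
qed

lemma u_itd_summable:
  assumes "lwt cs \<le> k"
  shows "summable (\<lambda>l. cderiv cs (u l) X)"
proof (rule summable_comparison_test')
  show "summable (\<lambda>i. K3 * M * eps 0 powr (real k + \<alpha> - real (lwt cs)) * q ^ i)"
    using q by (intro summable_mult summable_geometric) auto
  show "norm (cderiv cs (u l) X) \<le> K3 * M * eps 0 powr (real k + \<alpha> - real (lwt cs)) * q ^ l" for l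
    using u_itd_bnd[OF assms, of l 0 X] by simp
qed

lemma g_series:
  shows "smooth k (\<lambda>X. \<Sum>l. u l X)"
    "lwt cs \<le> k \<Longrightarrow> cderiv cs (\<lambda>X. \<Sum>l. u l X) = (\<lambda>X. \<Sum>l. cderiv cs (u l) X)"
proof -
  have b: "\<bar>cderiv cs (u l) X\<bar> \<le> K3 * M * q ^ l" if "lwt cs \<le> k" for cs l X
    using u_itd_bnd[OF that, of l 0 X] by (simp add: eps_0)
  have s: "summable (\<lambda>l. K3 * M * q ^ l)" using q by (intro summable_mult summable_geometric) auto
  have smooth: "smooth k (u l)" for l by (rule smooth_mono[OF smooth_u cfacts(9)])
  show "smooth k (\<lambda>X. \<Sum>l. u l X)" by (rule smooth_series(1)[OF smooth b s])
  show "lwt cs \<le> k \<Longrightarrow> cderiv cs (\<lambda>X. \<Sum>l. u l X) = (\<lambda>X. \<Sum>l. cderiv cs (u l) X)"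
    by (rule smooth_series(2)[OF smooth b s])
qed

lemma smooth_g: "smooth k g"
  unfolding g_def[abs_def] by (intro smooth_add g_series(1) smooth_mono[OF smooth_h] cfacts)

lemma cderiv_G: "lwt cs \<le> N \<Longrightarrow> cderiv cs (G j) X = cderiv cs (h 0) X + (\<Sum>l<j. cderiv cs (u l) X)"
  by (induction j) (simp_all add: cderiv_add[OF smooth_G smooth_u])

lemma cderiv_g: "lwt cs \<le> k \<Longrightarrow> cderiv cs g X = cderiv cs (h 0) X + (\<Sum>l. cderiv cs (u l) X)"
  unfolding g_def[abs_def] using cderiv_add[OF smooth_mono[OF smooth_h cfacts(9)] g_series(1), of cs 0] g_series(2)[of cs] by simp

lemma g_minus_G:
  assumes w: "lwt cs \<le> k"
  shows "\<bar>cderiv cs g X - cderiv cs (G j) X\<bar> \<le> K3 * M * S * eps j powr (real k + \<alpha> - real (lwt cs))"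
proof -
  let ?A = "K3 * M * eps j powr (real k + \<alpha> - real (lwt cs))"
  have s: "summable (\<lambda>i. ?A * q ^ i)" using q by (intro summable_mult summable_geometric) auto
  have "cderiv cs g X - cderiv cs (G j) X = (\<Sum>l. cderiv cs (u l) X) - (\<Sum>l<j. cderiv cs (u l) X)"
    using w cfacts by (simp add: cderiv_g cderiv_G)
  also have "\<dots> = (\<Sum>i. cderiv cs (u (i + j)) X)"
    using suminf_split_initial_segment[OF u_itd_summable[OF w], of X j] by simp
  also have "\<bar>\<dots>\<bar> \<le> (\<Sum>i. ?A * q ^ i)"
    using norm_suminf_le[OF _ s, of "\<lambda>i. cderiv cs (u (i + j)) X"] u_itd_bnd[OF w, of _ j X] by simp
  also have "\<dots> = ?A * S"
    using q suminf_mult[of "\<lambda>i. q ^ i" ?A] by (simp add: S_def suminf_geometric summable_geometric)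
  finally show ?thesis by (simp add: ac_simps)
qed

lemma g_sup_bnd:
  assumes w: "lwt cs \<le> k"
  shows "\<bar>cderiv cs g X\<bar> \<le> (K4 + K3 * S) * M"
proof -
  have "\<bar>cderiv cs g X - cderiv cs (G 0) X\<bar> \<le> K3 * M * S"
    using g_minus_G[OF w, of X 0] by (simp add: eps_0)
  moreover have "\<bar>cderiv cs (G 0) X\<bar> \<le> K4 * M"
    using dboundD[OF h_0_bnd, of cs X] w cfacts by simp
  ultimately show ?thesis by (simp add: algebra_simps)
qed

lemma eps_tendsto: "eps \<longlonglongrightarrow> 0"
  unfolding eps_def[abs_def] using cfacts by (intro LIMSEQ_power_zero) auto

text \<open>Near a point of \<open>E\<close> every \<open>G j\<close> is \<open>h j\<close>, whose
  derivatives match those of \<open>P X\<close> up to a positive power of \<open>eps j\<close>; the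
  distance from \<open>G j\<close> to \<open>g\<close> is of the same order, and \<open>j\<close>
  tends to infinity.\<close>

lemma g_on_E:
  assumes X: "X \<in> E" and w: "lwt cs \<le> k"
  shows "cderiv cs g X = cderiv cs (P X) X"
proof -
  let ?e = "real k + \<alpha> - real (lwt cs)"
  have "\<bar>cderiv cs g X - cderiv cs (P X) X\<bar> \<le> (K3 * S + K2) * M * eps j powr ?e" for j
  proof -
    have Xi: "X \<in> inner j" using X E_subset_inner by blast
    have "pclose (a * eps j) X X" using cfacts eps_pos[of j] by (intro pclose_refl) auto
    from dboundD[OF h_minus_P_bnd[OF Xi X this], of cs] w cfacts
    have "\<bar>cderiv cs (h j) X - cderiv cs (P X) X\<bar> \<le> K2 * M * th j / eps j ^ lwt cs"
      using cderiv_diff[OF smooth_h P_sm[OF X], of cs] cfacts by simp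
    also have "\<dots> = K2 * M * eps j powr ?e"
      using eps_pos[of j] by (simp add: th_def powr_diff powr_realpow)
    finally have 1: "\<bar>cderiv cs (h j) X - cderiv cs (P X) X\<bar> \<le> K2 * M * eps j powr ?e" .
    have "cderiv cs (G j) X = cderiv cs (h j) X" using G_inner by (intro cderiv_local[OF open_inner _ Xi]) auto
    then show ?thesis using 1 g_minus_G[OF w, of X j] by (simp add: algebra_simps)
  qed
  moreover have "(\<lambda>j. (K3 * S + K2) * M * eps j powr ?e) \<longlonglongrightarrow> (K3 * S + K2) * M * 0"
    using w \<alpha>
    by (intro tendsto_mult tendsto_const tendsto_zero_powrI[OF eps_tendsto tendsto_const])
       (auto intro!: always_eventually less_imp_le[OF eps_pos])
  ultimately have "\<bar>cderiv cs g X - cderiv cs (P X) X\<bar> \<le> 0"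
    by (intro LIMSEQ_le_const[of _ 0]) auto
  then show ?thesis by simp
qed

text \<open>The first summand covers \<open>\<rho> \<ge> 1\<close>; in the second, the power of
  \<Lambda> pays for replacing \<open>eps j\<close> by \<rho>.\<close>

definition K6 where "K6 = 2 * (K4 + K3 * S) + (2 * (K3 * S) + n * K5) * \<Lambda> powr (real k + \<alpha>)"

text \<open>With \<open>eps j\<close> comparable to \<rho>, \<open>g\<close> is replaced by
  \<open>G j\<close> at both points and the mean value theorem is applied to \<open>G j\<close>. By
  \<open>dir\<close> every direction used raises the weight above \<open>k\<close>, where the bounds
  for \<open>G j\<close> hold at all points.\<close>

lemma g_holder:
  assumes w: "lwt cs \<le> k" and \<rho>: "0 < \<rho>" "pclose \<rho> X Y"
    and dir: "\<And>c. coord X c \<noteq> coord Y c \<Longrightarrow> k < lwt cs + cwt c"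
  shows "\<bar>cderiv cs g X - cderiv cs g Y\<bar> \<le> K6 * M * \<rho> powr (real k + \<alpha> - real (lwt cs))"
proof (cases "1 \<le> \<rho>")
  let ?e = "real k + \<alpha> - real (lwt cs)"
  have e0: "0 \<le> ?e" using w \<alpha> by simp
  have K: "0 \<le> K5" "0 \<le> K4 + K3 * S" "0 \<le> K3 * S" using K_nonneg q by (auto simp: K5_def)
  have K6: "2 * (K4 + K3 * S) \<le> K6" "(2 * (K3 * S) + n * K5) * \<Lambda> powr (real k + \<alpha>) \<le> K6"
    using K cfacts by (auto simp: K6_def)
  case True
  \<comment> \<open>No scale exceeds 1, so for large \<rho> the sup bound at both points is
    used.\<close>
  have "\<bar>cderiv cs g X - cderiv cs g Y\<bar> \<le> 2 * (K4 + K3 * S) * M * 1"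
  proof -
    have "\<bar>cderiv cs g X - cderiv cs g Y\<bar> \<le> (K4 + K3 * S) * M + (K4 + K3 * S) * M"
      using g_sup_bnd[OF w, of X] g_sup_bnd[OF w, of Y] by linarith
    then show ?thesis by (simp add: algebra_simps)
  qed
  also have "\<dots> \<le> K6 * M * \<rho> powr ?e"
    using True e0 K6 M K by (intro mult_mono ge_one_powr_ge_zero) auto
  finally show ?thesis .
next
  let ?e = "real k + \<alpha> - real (lwt cs)"
  have e0: "0 \<le> ?e" using w \<alpha> by simp
  have K: "0 \<le> K5" "0 \<le> K4 + K3 * S" "0 \<le> K3 * S" using K_nonneg q by (auto simp: K5_def)
  have K6: "(2 * (K3 * S) + n * K5) * \<Lambda> powr (real k + \<alpha>) \<le> K6"
    using K by (auto simp: K6_def)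
  case False
  have "\<exists>j. eps j \<le> \<rho>"
    using order_tendstoD(2)[OF eps_tendsto \<rho>(1)] by (metis eventually_sequentially less_imp_le order_refl)
  \<comment> \<open>\<open>i\<close> is the first scale not above \<rho>. It is positive because
    \<open>eps 0 = 1\<close>, so \<rho> lies between \<open>eps i\<close> and the next coarser
    scale, which is \<open>\<Lambda> * eps i\<close>.\<close>
  define i where "i = (LEAST j. eps j \<le> \<rho>)"
  have i: "eps i \<le> \<rho>" "\<And>j. j < i \<Longrightarrow> \<rho> < eps j"
    unfolding i_def using LeastI_ex[OF \<open>\<exists>j. eps j \<le> \<rho>\<close>] not_less_Least by (auto simp: not_le[symmetric])
  then obtain j where j: "i = Suc j" using False eps_0 by (cases i) auto
  have \<rho>j: "\<rho> \<le> eps j" "eps j \<le> \<Lambda> * \<rho>"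
    using i(2)[of j] i(1) cfacts unfolding j eps_Suc[of j] by auto
  have "\<bar>cderiv cs (G j) X - cderiv cs (G j) Y\<bar> \<le>
      (\<Sum>c\<in>UNIV. \<bar>coord X c - coord Y c\<bar> * (K5 * M * eps j powr (real k + \<alpha> - real (lwt (c # cs)))))"
  proof (rule mvt_box)
    fix c assume c: "coord X c \<noteq> coord Y c"
    have wc: "lwt (c # cs) \<le> N" using w cwt_pos(2)[of c] by (simp add: N_def)
    show "has_pd c (cderiv cs (G j)) (cderiv (c # cs) (G j))"
      using wc by (intro smooth_has_pd_itd[OF smooth_G]) simp
    show "\<bar>cderiv (c # cs) (G j) Z\<bar> \<le> K5 * M * eps j powr (real k + \<alpha> - real (lwt (c # cs)))" for Z
      using dir[OF c] wc by (intro G_high_bnd) auto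
  qed
  also have "\<dots> \<le> (\<Sum>c\<in>(UNIV :: 'n option set). K5 * M * eps j powr ?e)"
  proof (rule sum_mono)
    fix c :: "'n option"
    have "\<bar>coord X c - coord Y c\<bar> \<le> eps j ^ cwt c"
      using \<rho>(2)[unfolded pclose_def, rule_format, of c] power_mono[OF \<rho>j(1), of "cwt c"] \<rho>(1) by simp
    then have "\<bar>coord X c - coord Y c\<bar> * (K5 * M * eps j powr (real k + \<alpha> - real (lwt (c # cs))))
        \<le> eps j ^ cwt c * (K5 * M * eps j powr (real k + \<alpha> - real (lwt (c # cs))))"
      using K M by (intro mult_right_mono) auto
    also have "\<dots> = K5 * M * eps j powr ?e"
      using eps_pos[of j] by (simp add: powr_diff powr_add powr_realpow)
    finally show "\<bar>coord X c - coord Y c\<bar> * (K5 * M * eps j powr (real k + \<alpha> - real (lwt (c # cs))))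
        \<le> K5 * M * eps j powr ?e" .
  qed
  finally have "\<bar>cderiv cs (G j) X - cderiv cs (G j) Y\<bar> \<le> n * (K5 * M * eps j powr ?e)" by (simp add: n_def)
  then have "\<bar>cderiv cs g X - cderiv cs g Y\<bar> \<le> n * (K5 * M * eps j powr ?e) + 2 * (K3 * M * S * eps j powr ?e)"
    using g_minus_G[OF w, of X j] g_minus_G[OF w, of Y j] by linarith
  also have "\<dots> = (2 * (K3 * S) + n * K5) * M * eps j powr ?e" by (simp add: algebra_simps)
  also have "\<dots> \<le> (2 * (K3 * S) + n * K5) * M * (\<Lambda> powr (real k + \<alpha>) * \<rho> powr ?e)"
  proof (intro mult_left_mono)
    have "eps j powr ?e \<le> (\<Lambda> * \<rho>) powr ?e" using \<rho>j eps_pos[of j] e0 by (intro powr_mono2) auto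
    also have "\<dots> = \<Lambda> powr ?e * \<rho> powr ?e" using cfacts \<rho> by (simp add: powr_mult)
    also have "\<dots> \<le> \<Lambda> powr (real k + \<alpha>) * \<rho> powr ?e"
      using cfacts by (intro mult_right_mono powr_mono) auto
    finally show "eps j powr ?e \<le> \<Lambda> powr (real k + \<alpha>) * \<rho> powr ?e" .
  qed (use K M cfacts in auto)
  also have "\<dots> = ((2 * (K3 * S) + n * K5) * \<Lambda> powr (real k + \<alpha>)) * M * \<rho> powr ?e" by simp
  also have "\<dots> \<le> K6 * M * \<rho> powr ?e" using K6 M by (intro mult_right_mono) auto
  finally show ?thesis .
qed

lemma K_final: "0 \<le> K4 + K3 * S" "0 \<le> K6"
  using K_nonneg q cfacts by (auto simp: K6_def K5_def)

end

section \<open>Parabolic Hoelder norms\<close>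

lemma par_norm_close:
  fixes X Y :: "'n::finite pt"
  shows "pclose (par_norm (X - Y)) X Y"
  unfolding pclose_def
proof
  fix c
  have "0 \<le> (norm (fst (X - Y)))\<^sup>2 + \<bar>snd (X - Y)\<bar>" by simp
  then have sq: "(par_norm (X - Y))\<^sup>2 = (norm (fst (X - Y)))\<^sup>2 + \<bar>snd (X - Y)\<bar>"
    by (simp add: par_norm_def)
  show "\<bar>coord X c - coord Y c\<bar> \<le> par_norm (X - Y) ^ cwt c"
  proof (cases c)
    case None
    then show ?thesis using sq by (simp add: coord_def cwt_def)
  next
    case (Some i)
    have "\<bar>coord (X - Y) (Some i)\<bar> \<le> norm (fst (X - Y))" by (rule abs_coord_le_norm)
    also have "\<dots> \<le> par_norm (X - Y)" unfolding par_norm_def by (rule real_le_rsqrt) simp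
    finally show ?thesis using Some by (simp add: cwt_def)
  qed
qed

lemma par_norm_pos:
  fixes X Y :: "'n::finite pt"
  assumes "X \<noteq> Y"
  shows "0 < par_norm (X - Y)"
proof -
  have "fst (X - Y) \<noteq> 0 \<or> snd (X - Y) \<noteq> 0" using assms by (metis diff_eq_diff_eq diff_self prod_eqI right_minus_eq fst_diff snd_diff)
  then have "0 < (norm (fst (X - Y)))\<^sup>2 + \<bar>snd (X - Y)\<bar>"
    by (auto intro: add_pos_nonneg add_nonneg_pos)
  then show ?thesis by (simp add: par_norm_def)
qed

lemma iter_D_exists_subset: "iter_D_exists U es f \<Longrightarrow> V \<subseteq> U \<Longrightarrow> iter_D_exists V es f"
  by (induction es) auto

lemma smooth_imp_par_Ck: "smooth k f \<Longrightarrow> par_Ck k U f"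
  unfolding par_Ck_def smooth_def D_eq_cderiv dirs_eq
  by (metis iter_D_exists_subset continuous_on_subset subset_UNIV lwt_dir_coords)

lemma L2_set_weight_le:
  fixes F :: "'n::finite mindex \<Rightarrow> real"
  assumes "i \<le> k" "\<And>\<sigma>. weight \<sigma> = i \<Longrightarrow> \<bar>F \<sigma>\<bar> \<le> B" "0 \<le> B"
  shows "L2_set F {\<sigma>. weight \<sigma> = i} \<le> real (card {\<sigma> :: 'n mindex. weight \<sigma> \<le> k}) * B"
proof -
  have "L2_set F {\<sigma>. weight \<sigma> = i} \<le> (\<Sum>\<sigma> | weight \<sigma> = i. \<bar>F \<sigma>\<bar>)" by (rule L2_set_le_sum_abs)
  also have "\<dots> \<le> (\<Sum>\<sigma> :: 'n mindex | weight \<sigma> = i. B)" using assms by (intro sum_mono) auto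
  also have "\<dots> = real (card {\<sigma> :: 'n mindex. weight \<sigma> = i}) * B" by simp
  also have "\<dots> \<le> real (card {\<sigma> :: 'n mindex. weight \<sigma> \<le> k}) * B"
    using assms by (intro mult_right_mono of_nat_mono card_mono finite_weight_le) auto
  finally show ?thesis .
qed

text \<open>One hypothesis \<open>hol\<close> serves both seminorms: at weight \<open>k\<close>
  every direction raises the weight above \<open>k\<close>, and at weight \<open>k - 1\<close> the
  time direction, of weight 2, does so.\<close>

lemma holder_norm_le:
  fixes g :: "'n::finite pt \<Rightarrow> real"
  assumes sup: "\<And>cs X. lwt cs \<le> k \<Longrightarrow> \<bar>cderiv cs g X\<bar> \<le> B"
    and hol: "\<And>cs X Y \<rho>. lwt cs \<le> k \<Longrightarrow> 0 < \<rho> \<Longrightarrow> pclose \<rho> X Y \<Longrightarrow>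
      (\<And>c. coord X c \<noteq> coord Y c \<Longrightarrow> k < lwt cs + cwt c) \<Longrightarrow>
      \<bar>cderiv cs g X - cderiv cs g Y\<bar> \<le> H * \<rho> powr (real k + \<alpha> - real (lwt cs))"
    and B: "0 \<le> B" and H: "0 \<le> H"
  shows "holder_norm k \<alpha> U g \<le>
    ennreal (real (card {\<sigma> :: 'n mindex. weight \<sigma> \<le> k}) * ((real k + 1) * B + 2 * H))"
proof -
  define w where "w = real (card {\<sigma> :: 'n mindex. weight \<sigma> \<le> k})"
  have w: "0 \<le> w" by (simp add: w_def)
  have 1: "(SUP X\<in>U. ennreal (D_norm i g X)) \<le> ennreal (w * B)" if "i \<le> k" for i
    unfolding D_norm_def w_def D_eq_cderiv using that sup B
    by (intro SUP_least ennreal_leI L2_set_weight_le) (auto simp: lwt_dir_coords)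
  have "(\<Sum>i\<le>k. SUP X\<in>U. ennreal (D_norm i g X)) \<le> (\<Sum>i\<le>k. ennreal (w * B))"
    by (intro sum_mono 1) auto
  also have "\<dots> = ennreal ((real k + 1) * (w * B))"
    using w B by (simp add: ennreal_mult ennreal_of_nat_eq_real_of_nat add.commute)
  finally have S1: "(\<Sum>i\<le>k. SUP X\<in>U. ennreal (D_norm i g X)) \<le> ennreal ((real k + 1) * (w * B))" .
  have S2: "holder_seminorm k \<alpha> U g \<le> ennreal (w * H)"
    unfolding holder_seminorm_def
  proof (rule SUP_least)
    fix p assume "p \<in> {(X, Y). X \<in> U \<and> Y \<in> U \<and> X \<noteq> Y}"
    then obtain X Y where p: "p = (X, Y)" "X \<noteq> Y" by blast
    let ?\<rho> = "par_norm (X - Y)"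
    have \<rho>: "0 < ?\<rho>" by (rule par_norm_pos[OF p(2)])
    have "\<bar>D \<sigma> g X - D \<sigma> g Y\<bar> \<le> H * ?\<rho> powr \<alpha>" if "weight \<sigma> = k" for \<sigma>
    proof -
      have "\<bar>D \<sigma> g X - D \<sigma> g Y\<bar> \<le> H * ?\<rho> powr (real k + \<alpha> - real (lwt (dir_coords \<sigma>)))"
        unfolding D_eq_cderiv by (rule hol[OF _ \<rho> par_norm_close]) (use that cwt_pos(3) in \<open>auto simp: lwt_dir_coords\<close>)
      then show ?thesis using that by (simp add: lwt_dir_coords)
    qed
    then have "D_dist k g X Y \<le> w * (H * ?\<rho> powr \<alpha>)"
      unfolding D_dist_def w_def using H by (intro L2_set_weight_le) auto
    then have "D_dist k g X Y / ?\<rho> powr \<alpha> \<le> w * H" using \<rho> by (simp add: field_simps)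
    then show "(case p of (X, Y) \<Rightarrow> ennreal (D_dist k g X Y / par_norm (X - Y) powr \<alpha>)) \<le> ennreal (w * H)"
      unfolding p prod.case by (rule ennreal_leI)
  qed
  have S3: "(if k = 0 then 0 else holder_seminorm_t (k - 1) ((1 + \<alpha>) / 2) U g) \<le> ennreal (w * H)"
  proof (cases "k = 0")
    case False
    have "holder_seminorm_t (k - 1) ((1 + \<alpha>) / 2) U g \<le> ennreal (w * H)"
      unfolding holder_seminorm_t_def
    proof (rule SUP_least)
      fix p assume "p \<in> {(x, t, s). (x, t) \<in> U \<and> (x, s) \<in> U \<and> t \<noteq> s}"
      then obtain x t s where p: "p = (x, t, s)" "t \<noteq> s" by blast
      \<comment> \<open>Time increments have parabolic length \<open>sqrt \<bar>t - s\<bar>\<close>,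
        which turns the exponent \<open>1 + \<alpha>\<close> into
        \<open>(1 + \<alpha>) / 2\<close>.\<close>
      let ?\<rho> = "sqrt \<bar>t - s\<bar>"
      have \<rho>: "0 < ?\<rho>" using p(2) by simp
      have cl: "pclose ?\<rho> (x, t) (x, s)"
        unfolding pclose_def by (auto simp: coord_def cwt_def split: option.splits)
      have e: "?\<rho> powr (1 + \<alpha>) = \<bar>t - s\<bar> powr ((1 + \<alpha>) / 2)"
        by (simp add: powr_half_sqrt[symmetric] powr_powr)
      have "\<bar>D \<sigma> g (x, t) - D \<sigma> g (x, s)\<bar> \<le> H * \<bar>t - s\<bar> powr ((1 + \<alpha>) / 2)"
        if "weight \<sigma> = k - 1" for \<sigma>
      proof -
        have "\<bar>D \<sigma> g (x, t) - D \<sigma> g (x, s)\<bar> \<le> H * ?\<rho> powr (real k + \<alpha> - real (k - 1))"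
          unfolding D_eq_cderiv that[symmetric] lwt_dir_coords[symmetric]
        proof (rule hol[OF _ \<rho> cl])
          show "lwt (dir_coords \<sigma>) \<le> k" using that by (simp add: lwt_dir_coords)
          fix c :: "'n option" assume "coord (x, t) c \<noteq> coord (x, s) c"
          then have "c = None" by (cases c) (auto simp: coord_def)
          then show "k < lwt (dir_coords \<sigma>) + cwt c" using that False by (simp add: lwt_dir_coords cwt_def)
        qed
        moreover have "real k + \<alpha> - real (k - 1) = 1 + \<alpha>" using False by (simp add: of_nat_diff)
        ultimately show ?thesis by (simp only: e)
      qed
      then have "D_dist (k - 1) g (x, t) (x, s) \<le> w * (H * \<bar>t - s\<bar> powr ((1 + \<alpha>) / 2))"
        unfolding D_dist_def w_def using H by (intro L2_set_weight_le) auto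
      then have "D_dist (k - 1) g (x, t) (x, s) / \<bar>t - s\<bar> powr ((1 + \<alpha>) / 2) \<le> w * H"
        using p(2) by (simp add: field_simps)
      then show "(case p of (x, t, s) \<Rightarrow> ennreal (D_dist (k - 1) g (x, t) (x, s) / \<bar>t - s\<bar> powr ((1 + \<alpha>) / 2)))
          \<le> ennreal (w * H)"
        unfolding p prod.case by (rule ennreal_leI)
    qed
    then show ?thesis using False by simp
  qed simp
  have "holder_norm k \<alpha> U g \<le> ennreal ((real k + 1) * (w * B)) + ennreal (w * H) + ennreal (w * H)"
    unfolding holder_norm_def by (intro add_mono S1 S2 S3)
  also have "\<dots> = ennreal (w * ((real k + 1) * B + 2 * H))"
    using w B H by (simp add: ennreal_plus[symmetric] algebra_simps del: ennreal_plus)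
  finally show ?thesis by (simp add: w_def)
qed

text \<open>Derivatives of a polynomial at the centre depend only on the multi-index of the list, so
  bounds on \<open>D\<close> cover all orders of the directions.\<close>

lemma par_polys_center_bnd:
  assumes P: "P \<in> par_polys k" and b: "\<And>\<sigma>. weight \<sigma> \<le> k \<Longrightarrow> \<bar>D \<sigma> P X\<bar> \<le> M"
  shows "dbound X k M 1 P"
  unfolding dbound_def
proof (intro allI impI)
  fix cs :: "'a option list" assume w: "lwt cs \<le> k"
  obtain a where a: "\<And>\<sigma>. k < weight \<sigma> \<Longrightarrow> a \<sigma> = 0" "P = cpoly k a X" using par_polysE[OF P] by blast
  have "cderiv cs P X = D (index_of cs) P X"
    unfolding D_eq_cderiv a(2) by (simp only: cderiv_pol_center[of k a, OF a(1)] index_of_dir_coords)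
  then show "\<bar>cderiv cs P X\<bar> \<le> M / 1 ^ lwt cs" using b[of "index_of cs"] w by (simp add: weight_index_of)
qed

text \<open>The infimum is itself admissible: constants slightly above it satisfy every inequality,
  and for fixed \<open>X\<close> and \<open>r\<close> the excess tends to 0.\<close>

lemma approximates_INF:
  assumes "approximates p p' k \<alpha> f E P K" "0 \<le> K"
    and K: "(INF K\<in>{K. 0 \<le> K \<and> approximates p p' k \<alpha> f E P K}. ennreal K) \<le> ennreal K'" and K': "0 \<le> K'"
  shows "approximates p p' k \<alpha> f E P K'"
  unfolding approximates_def
proof (intro ballI allI impI)
  fix X and r :: real assume X: "X \<in> E" and r: "0 < r \<and> r < 1/2"
  let ?m = "mean_norm p p' (ball (fst X) r) (cyl_time X r) (\<lambda>Y. f Y - P X Y)"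
  let ?\<beta> = "r powr (real k + \<alpha>)"
  have \<beta>: "0 < ?\<beta>" using r by simp
  show "?m \<le> ennreal (K' * ?\<beta>)"
  proof (rule ennreal_le_epsilon)
    fix e :: real assume e: "0 < e"
    have "ennreal K' < ennreal (K' + e / ?\<beta>)"
      using K' e \<beta> by (intro ennreal_lessI) (auto intro: add_nonneg_pos)
    with K have "(INF K\<in>{K. 0 \<le> K \<and> approximates p p' k \<alpha> f E P K}. ennreal K) < ennreal (K' + e / ?\<beta>)"
      by (rule le_less_trans)
    then obtain L where L: "0 \<le> L" "approximates p p' k \<alpha> f E P L" "ennreal L < ennreal (K' + e / ?\<beta>)"
      unfolding INF_less_iff by blast
    then have "L < K' + e / ?\<beta>" by (simp add: ennreal_less_iff)
    then have "L * ?\<beta> \<le> K' * ?\<beta> + e" using \<beta> by (simp add: field_simps)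
    then have "ennreal (L * ?\<beta>) \<le> ennreal (K' * ?\<beta> + e)" by (rule ennreal_leI)
    also have "\<dots> = ennreal (K' * ?\<beta>) + ennreal e" using K' e by (intro ennreal_plus) auto
    finally show "?m \<le> ennreal (K' * ?\<beta>) + ennreal e"
      using L(2) X r unfolding approximates_def by (meson order_trans)
  qed
qed

theorem corollary7p11:
  fixes k :: nat and \<alpha> :: real
  assumes "0 < \<alpha>" and "\<alpha> \<le> 1"
  shows "\<exists>C::real. C > 0 \<and>
    (\<forall>(p::ennreal) (p'::ennreal) (f :: 'n::finite pt \<Rightarrow> real)
        (E :: 'n pt set) (P :: 'n pt \<Rightarrow> 'n pt \<Rightarrow> real).
       1 \<le> p \<longrightarrow> 1 \<le> p' \<longrightarrow>
       f \<in> mixed_space p p' (ball 0 1) (cyl_time (0 :: 'n pt) 1) \<longrightarrow>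
       compact E \<longrightarrow> E \<subseteq> cyl 0 (1/2) \<longrightarrow>
       (\<forall>X\<^sub>0\<in>E. P X\<^sub>0 \<in> par_polys k) \<longrightarrow>
       (\<exists>K\<ge>0. approximates p p' k \<alpha> f E P K) \<longrightarrow>
       whitney_const p p' k \<alpha> f E P < \<infinity> \<longrightarrow>
       (\<exists>g \<in> par_Ck_alpha k \<alpha> full_cyl1.
          (\<forall>X\<in>E. \<forall>\<sigma>. weight \<sigma> \<le> k \<longrightarrow> D \<sigma> g X = D \<sigma> (P X) X) \<and>
          holder_norm k \<alpha> full_cyl1 g \<le> ennreal C * whitney_const p p' k \<alpha> f E P))"
proof -
  obtain C\<^sub>1 where C1: "1 \<le> C\<^sub>1"
    "\<And>p p' (f :: 'n::finite pt \<Rightarrow> real) E P K M X Y \<rho> N.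
      1 \<le> p \<Longrightarrow> 1 \<le> p' \<Longrightarrow> f \<in> mixed_space p p' (ball 0 1) (cyl_time (0 :: 'n pt) 1) \<Longrightarrow>
      E \<subseteq> cyl 0 (1/2) \<Longrightarrow> (\<And>X. X \<in> E \<Longrightarrow> P X \<in> par_polys k) \<Longrightarrow> approximates p p' k \<alpha> f E P K \<Longrightarrow>
      0 \<le> K \<Longrightarrow> K \<le> M \<Longrightarrow> (\<And>X. X \<in> E \<Longrightarrow> dbound X k M 1 (P X)) \<Longrightarrow>
      X \<in> E \<Longrightarrow> Y \<in> E \<Longrightarrow> 0 < \<rho> \<Longrightarrow> pclose \<rho> X Y \<Longrightarrow>
      dbound X N (C\<^sub>1 * M * \<rho> powr (real k + \<alpha>)) \<rho> (\<lambda>Z. P X Z - P Y Z)"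
    using compatibility[OF assms(1), of k] by blast
  define n where "n = real CARD('n option)"
  define Cb where "Cb = real ((k + 5) ^ CARD('n option)) * (2 ^ (k + 2) * bump_const (k + 2) TYPE('n))"
  define \<kappa> where "\<kappa> = (1 + real CARD('n option) * (2 * real k + 9)\<^sup>2) ^ Suc k"
  \<comment> \<open>Outside its context the constants of the locale are functions of
    \<open>k\<close>, \<alpha>, \<open>n\<close>, \<open>Cb\<close> and \<kappa> alone, so they can
    be named before \<open>E\<close>, \<open>P\<close> and \<open>M\<close> are given.\<close>
  define B where "B = whitney.K4 Cb \<kappa> + whitney.K3 k \<alpha> Cb \<kappa> * whitney.S k \<alpha>"
  define H where "H = whitney.K6 k \<alpha> n Cb \<kappa>"
  \<comment> \<open>The 1 and the absolute value make \<open>C\<close> positive before the signs of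
    \<open>B\<close> and \<open>H\<close> are known; these become available inside the
    interpretation.\<close>
  define C where "C = 1 + \<bar>real (card {\<sigma> :: 'n mindex. weight \<sigma> \<le> k}) * ((real k + 1) * B + 2 * H) * C\<^sub>1\<bar>"
  have "0 < C" by (simp add: C_def add_pos_nonneg)
  moreover have "\<exists>g \<in> par_Ck_alpha k \<alpha> full_cyl1.
          (\<forall>X\<in>E. \<forall>\<sigma>. weight \<sigma> \<le> k \<longrightarrow> D \<sigma> g X = D \<sigma> (P X) X) \<and>
          holder_norm k \<alpha> full_cyl1 g \<le> ennreal C * whitney_const p p' k \<alpha> f E P"
    if p: "1 \<le> p" "1 \<le> p'" and f: "f \<in> mixed_space p p' (ball 0 1) (cyl_time (0 :: 'n pt) 1)"
      and E: "compact E" "E \<subseteq> cyl 0 (1/2)" and P: "\<forall>X\<^sub>0\<in>E. P X\<^sub>0 \<in> par_polys k"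
      and K: "\<exists>K\<ge>0. approximates p p' k \<alpha> f E P K" and fin: "whitney_const p p' k \<alpha> f E P < \<infinity>"
    for p p' :: ennreal and f :: "'n pt \<Rightarrow> real" and E P
  proof -
    define K\<^sub>0 where "K\<^sub>0 = enn2real (whitney_const p p' k \<alpha> f E P)"
    have W: "whitney_const p p' k \<alpha> f E P = ennreal K\<^sub>0" and K0: "0 \<le> K\<^sub>0"
      using fin by (simp_all add: K\<^sub>0_def less_top)
    have "dbound X k K\<^sub>0 1 (P X)" if X: "X \<in> E" for X
    proof (rule par_polys_center_bnd)
      show "P X \<in> par_polys k" using P X by blast
      fix \<sigma> :: "'n mindex" assume \<sigma>: "weight \<sigma> \<le> k"
      have "\<bar>D \<sigma> (P X) X\<bar> \<le> L2_set (\<lambda>\<sigma>. \<bar>D \<sigma> (P X) X\<bar>) {\<tau>. weight \<tau> = weight \<sigma>}"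
        by (rule member_le_L2_set) (auto intro: finite_weight_eq)
      also have "\<dots> = D_norm (weight \<sigma>) (P X) X" by (simp add: D_norm_def L2_set_def)
      also have "\<dots> \<le> (\<Sum>i\<le>k. D_norm i (P X) X)"
        using \<sigma> by (intro member_le_sum) (auto simp: D_norm_def)
      finally have 1: "\<bar>D \<sigma> (P X) X\<bar> \<le> (\<Sum>i\<le>k. D_norm i (P X) X)" .
      have "ennreal (\<Sum>i\<le>k. D_norm i (P X) X) \<le> (SUP X\<^sub>0\<in>E. ennreal (\<Sum>i\<le>k. D_norm i (P X\<^sub>0) X\<^sub>0))"
        using X by (rule SUP_upper)
      also have "\<dots> \<le> whitney_const p p' k \<alpha> f E P" unfolding whitney_const_def by simp
      finally have "(\<Sum>i\<le>k. D_norm i (P X) X) \<le> K\<^sub>0" unfolding W using K0 by (simp add: ennreal_le_iff)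
      then show "\<bar>D \<sigma> (P X) X\<bar> \<le> K\<^sub>0" using 1 by linarith
    qed
    note Pb = this
    have "(INF K\<in>{K. 0 \<le> K \<and> approximates p p' k \<alpha> f E P K}. ennreal K) \<le> ennreal K\<^sub>0"
      unfolding W[symmetric] whitney_const_def by simp
    then have ap: "approximates p p' k \<alpha> f E P K\<^sub>0" using K K0 approximates_INF by blast
    \<comment> \<open>A single \<open>M\<close> bounds the derivatives at the centres, as
      \<open>C\<^sub>1 \<ge> 1\<close>, and the compatibility estimates.\<close>
    define M where "M = C\<^sub>1 * K\<^sub>0"
    have M: "K\<^sub>0 \<le> M" "0 \<le> M" using C1(1) K0 mult_right_mono[of 1 C\<^sub>1 K\<^sub>0] by (auto simp: M_def)
    interpret whitney k \<alpha> M E P n Cb \<kappa>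
    proof
      show "0 < \<alpha>" "\<alpha> \<le> 1" "compact E" "0 \<le> M" by fact+
      show "P Y \<in> par_polys k" if "Y \<in> E" for Y using P that by blast
      show "dbound Y k M 1 (P Y)" if "Y \<in> E" for Y
        by (rule dbound_mono[OF Pb[OF that] order_refl M(1)]) auto
      show "dbound X k (M * \<rho> powr (real k + \<alpha>)) \<rho> (\<lambda>Z. P X Z - P Y Z)"
        if "X \<in> E" "Y \<in> E" "0 < \<rho>" "pclose \<rho> X Y" for X Y \<rho>
        unfolding M_def by (rule C1(2)[OF p f E(2) _ ap K0 order_refl Pb that]) (use P in blast)+
    qed (simp_all only: n_def Cb_def \<kappa>_def)
    have B: "0 \<le> B" and H: "0 \<le> H" using K_final by (simp_all only: B_def H_def)
    have "holder_norm k \<alpha> full_cyl1 g \<le>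
        ennreal (real (card {\<sigma> :: 'n mindex. weight \<sigma> \<le> k}) * ((real k + 1) * (B * M) + 2 * (H * M)))"
    proof (rule holder_norm_le)
      show "\<bar>cderiv cs g X\<bar> \<le> B * M" if "lwt cs \<le> k" for cs X
        using g_sup_bnd[OF that] by (simp only: B_def)
      show "\<bar>cderiv cs g X - cderiv cs g Y\<bar> \<le> H * M * \<rho> powr (real k + \<alpha> - real (lwt cs))"
        if "lwt cs \<le> k" "0 < \<rho>" "pclose \<rho> X Y" "\<And>c. coord X c \<noteq> coord Y c \<Longrightarrow> k < lwt cs + cwt c" for cs X Y \<rho>
        unfolding H_def by (rule g_holder[OF that(1-3)]) (rule that(4))
    qed (use B H M in auto)
    also have "\<dots> \<le> ennreal (C * K\<^sub>0)"
    proof (rule ennreal_leI)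
      have "real (card {\<sigma> :: 'n mindex. weight \<sigma> \<le> k}) * ((real k + 1) * (B * M) + 2 * (H * M)) =
          real (card {\<sigma> :: 'n mindex. weight \<sigma> \<le> k}) * ((real k + 1) * B + 2 * H) * C\<^sub>1 * K\<^sub>0"
        by (simp add: M_def algebra_simps)
      also have "\<dots> \<le> C * K\<^sub>0" using K0 by (intro mult_right_mono) (auto simp: C_def)
      finally show "real (card {\<sigma> :: 'n mindex. weight \<sigma> \<le> k}) * ((real k + 1) * (B * M) + 2 * (H * M)) \<le> C * K\<^sub>0" .
    qed
    also have "\<dots> = ennreal C * whitney_const p p' k \<alpha> f E P"
      using K0 \<open>0 < C\<close> by (simp add: W ennreal_mult)
    finally have hn: "holder_norm k \<alpha> full_cyl1 g \<le> ennreal C * whitney_const p p' k \<alpha> f E P" .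
    also have "\<dots> < \<infinity>" using fin by (simp add: W ennreal_mult_less_top)
    finally have "g \<in> par_Ck_alpha k \<alpha> full_cyl1"
      using smooth_imp_par_Ck[OF smooth_g] by (simp add: par_Ck_alpha_def)
    moreover have "D \<sigma> g X = D \<sigma> (P X) X" if "X \<in> E" "weight \<sigma> \<le> k" for X \<sigma>
      unfolding D_eq_cderiv using g_on_E[OF that(1)] that(2) by (simp add: lwt_dir_coords)
    ultimately show ?thesis using hn by blast
  qed
  ultimately show ?thesis by blast
qed

end
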